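(* (i) Let $H$ be an infinite-dimensional complex Hilbert space and let $\mathcal S=\mathcal S(H)$ be the set of positive trace-class operators on $H$ of trace one. There are bijections $\Theta_n:\mathcal S\to\mathcal S$ ($n\ge1$) and numbers $\varepsilon_n\ge 0$ with $\varepsilon_n\to0$ such that each $\Theta_n$ is an $\varepsilon_n$-isometry of $\mathcal S$ both for the Bures metric $d_{\mathrm b}$ and for the trace metric $d_1$, but for every $n$ $$\inf_U\sup_{\rho\in\mathcal S}d_{\mathrm b}\bigl(\Theta_n(\rho),U\rho U^*\bigr)\ge\sqrt{2-\sqrt3},\qquad \inf_U\sup_{\rho\in\mathcal S}\|\Theta_n(\rho)-U\rho U^*\|_1\ge1,$$ where the infima run over all unitary and antiunitary $U$ on $H$. (ii) Consequently, for neither metric $\mathsf d\in\{d_{\mathrm b},d_1\}$ is there a function $\omega:[0,\infty)\to[0,\infty)$ with $\omega(\varepsilon)\to0$ as $\varepsilon\to0^+$ such that for every $\varepsilon\geq0$ and every surjective $\varepsilon$-isometry $T$ of $(\mathcal S(H),\mathsf d)$ there is a unitary or antiunitary $U$ on $H$ with $\sup_{\rho\in\mathcal S}\mathsf d(T(\rho),U\rho U^* )\le\omega(\varepsilon)$. (iii) No such function can be uniform in the dimension: for neither $\mathsf d\in\{d_{\mathrm b},d_1\}$ is there a function $\omega:[0,\infty)\to[0,\infty)$ with $\omega(\varepsilon)\to0$ as $\varepsilon\to0^+$ such that for every finite $d\ge1$, every $\varepsilon\geq0$ and every surjective $\varepsilon$-isometry $T$ of $(\mathcal S(\mathbb C^d),\mathsf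 d)$ there is a unitary or antiunitary $U$ on $\mathbb C^d$ with $\sup_{\rho\in\mathcal S(\mathbb C^d)}\mathsf d(T(\rho),U\rho U^* )\le\omega(\varepsilon)$.
   Context: For a nonzero complex Hilbert space $K$, $\mathcal S(K)=\{A: A\ge0\text{ trace-class on }K,\ \operatorname{Tr}A=1\}$. For positive trace-class $A,B$: $d_1(A,B)=\|A-B\|_1$ with $\|X\|_1=\operatorname{Tr}|X|$, and $d_{\mathrm b}(A,B)\ge0$ is given by $$d_{\mathrm b}(A,B)^2=\operatorname{Tr}A+\operatorname{Tr}B-2\operatorname{Tr}\bigl[(A^{1/2}BA^{1/2})^{1/2}\bigr].$$ For $\varepsilon\ge0$, an $\varepsilon$-isometry of $(\mathcal S(K),\mathsf d)$ is a map $T:\mathcal S(K)\to\mathcal S(K)$ (no continuity or affinity assumed) with $|\mathsf d(T(\rho),T(\sigma))-\mathsf d(\rho,\sigma)|\le\varepsilon$ for all $\rho,\sigma\in\mathcal S(K)$. A unitary is a linear surjection $U$ with $\langle Ux,Uy\rangle=\langle x,y\rangle$; an antiunitary is a conjugate-linear surjection $U$ with $\langle Ux,Uy\rangle=\overline{\langle x,y\rangle}$; in both cases $U^*=U^{-1}$. *)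

theory Defs
  imports "HOL-Analysis.Analysis"
begin

section \<open>Complex Hilbert spaces\<close>

class complex_vector = real_vector +
  fixes scaleC :: "complex \<Rightarrow> 'a \<Rightarrow> 'a"  (infixr \<open>*\<^sub>C\<close> 75)
  assumes scaleC_add_right: "c *\<^sub>C (x + y) = c *\<^sub>C x + c *\<^sub>C y"
    and scaleC_add_left: "(c + d) *\<^sub>C x = c *\<^sub>C x + d *\<^sub>C x"
    and scaleC_scaleC: "c *\<^sub>C d *\<^sub>C x = (c * d) *\<^sub>C x"
    and scaleC_of_real: "complex_of_real r *\<^sub>C x = r *\<^sub>R x"

global_interpretation complex_vector: vector_space "scaleC :: complex \<Rightarrow> 'a \<Rightarrow> 'a::complex_vector"
  defines csubspace = complex_vector.subspace
    and cspan = complex_vector.span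
proof
  show "1 *\<^sub>C x = x" for x :: 'a
    using scaleC_of_real[of 1 x] by simp
qed (simp_all add: scaleC_add_right scaleC_add_left scaleC_scaleC)

text \<open>The inner product is linear in the second argument; its real part is the
  library's real inner product, which determines norm and topology.\<close>

class complex_inner = complex_vector + real_inner +
  fixes cinner :: "'a \<Rightarrow> 'a \<Rightarrow> complex"
  assumes cinner_commute: "cinner x y = cnj (cinner y x)"
    and cinner_add_right: "cinner x (y + z) = cinner x y + cinner x z"
    and cinner_scaleC_right: "cinner x (c *\<^sub>C y) = c * cinner x y"
    and Re_cinner: "Re (cinner x y) = inner x y"

class chilbert_space = complex_inner + complete_space

section \<open>Operators on a Hilbert space\<close>

text \<open>Throughout, a Hilbert space is a closed complex subspace \<open>K\<close> of some
  \<^class>\<open>chilbert_space\<close> type (possibly all of it). A linear operator on \<open>K\<close> is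
  represented by the function that agrees with it on \<open>K\<close> and is \<open>0\<close> outside \<open>K\<close>
  as a set, so that operators are equal iff the functions are, and sums, differences and
  composition of operators are those of functions.\<close>

definition bounded_ops :: "'a::chilbert_space set \<Rightarrow> ('a \<Rightarrow> 'a) set" where
  "bounded_ops K = {A. (\<forall>x\<in>K. A x \<in> K) \<and> (\<forall>x. x \<notin> K \<longrightarrow> A x = 0) \<and>
     (\<forall>x\<in>K. \<forall>y\<in>K. A (x + y) = A x + A y) \<and> (\<forall>c. \<forall>x\<in>K. A (c *\<^sub>C x) = c *\<^sub>C A x) \<and>
     (\<exists>C. \<forall>x\<in>K. norm (A x) \<le> C * norm x)}"

definition positive_op :: "'a::chilbert_space set \<Rightarrow> ('a \<Rightarrow> 'a) \<Rightarrow> bool" where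
  "positive_op K A \<longleftrightarrow> A \<in> bounded_ops K \<and> (\<forall>x\<in>K. cinner x (A x) \<in> \<real>\<^sub>\<ge>\<^sub>0)"

definition op_adj :: "'a::chilbert_space set \<Rightarrow> ('a \<Rightarrow> 'a) \<Rightarrow> 'a \<Rightarrow> 'a" where
  "op_adj K A = (THE B. B \<in> bounded_ops K \<and> (\<forall>x\<in>K. \<forall>y\<in>K. cinner (B x) y = cinner x (A y)))"

definition op_sqrt :: "'a::chilbert_space set \<Rightarrow> ('a \<Rightarrow> 'a) \<Rightarrow> 'a \<Rightarrow> 'a" where
  "op_sqrt K A = (THE B. positive_op K B \<and> B \<circ> B = A)"

definition op_abs :: "'a::chilbert_space set \<Rightarrow> ('a \<Rightarrow> 'a) \<Rightarrow> 'a \<Rightarrow> 'a" where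
  "op_abs K A = op_sqrt K (op_adj K A \<circ> A)"

definition onb :: "'a::chilbert_space set \<Rightarrow> 'a set \<Rightarrow> bool" where
  "onb K E \<longleftrightarrow> E \<subseteq> K \<and> (\<forall>e\<in>E. \<forall>f\<in>E. cinner e f = (if e = f then 1 else 0)) \<and>
     closure (cspan E) = K"

definition trace_class :: "'a::chilbert_space set \<Rightarrow> ('a \<Rightarrow> 'a) \<Rightarrow> bool" where
  "trace_class K A \<longleftrightarrow> A \<in> bounded_ops K \<and>
     (\<exists>E. onb K E \<and> (\<lambda>e. cinner e (op_abs K A e)) summable_on E)"

text \<open>The trace is independent of the basis for trace-class operators, the only ones to
  which it is meant to be applied.\<close>

definition op_trace :: "'a::chilbert_space set \<Rightarrow> ('a \<Rightarrow> 'a) \<Rightarrow> complex" where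
  "op_trace K A = (\<Sum>\<^sub>\<infinity>e\<in>(SOME E. onb K E). cinner e (A e))"

section \<open>States, metrics and approximate isometries\<close>

definition states :: "'a::chilbert_space set \<Rightarrow> ('a \<Rightarrow> 'a) set" where
  "states K = {\<rho>. positive_op K \<rho> \<and> trace_class K \<rho> \<and> op_trace K \<rho> = 1}"

text \<open>\<^const>\<open>op_trace\<close> is complex-valued; the traces below are of positive operators,
  hence real, and \<^const>\<open>Re\<close> only changes the type.\<close>

definition trace_norm :: "'a::chilbert_space set \<Rightarrow> ('a \<Rightarrow> 'a) \<Rightarrow> real" where
  "trace_norm K X = Re (op_trace K (op_abs K X))"

definition trace_dist :: "'a::chilbert_space set \<Rightarrow> ('a \<Rightarrow> 'a) \<Rightarrow> ('a \<Rightarrow> 'a) \<Rightarrow> real" where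
  "trace_dist K A B = trace_norm K (\<lambda>x. A x - B x)"

definition bures_dist :: "'a::chilbert_space set \<Rightarrow> ('a \<Rightarrow> 'a) \<Rightarrow> ('a \<Rightarrow> 'a) \<Rightarrow> real" where
  "bures_dist K A B = sqrt (Re (op_trace K A) + Re (op_trace K B)
     - 2 * Re (op_trace K (op_sqrt K (op_sqrt K A \<circ> B \<circ> op_sqrt K A))))"

definition eps_isometry ::
  "'a::chilbert_space set \<Rightarrow> (('a \<Rightarrow> 'a) \<Rightarrow> ('a \<Rightarrow> 'a) \<Rightarrow> real) \<Rightarrow> real \<Rightarrow>
   (('a \<Rightarrow> 'a) \<Rightarrow> 'a \<Rightarrow> 'a) \<Rightarrow> bool" where
  "eps_isometry K d \<epsilon> T \<longleftrightarrow> (\<forall>\<rho>\<in>states K. T \<rho> \<in> states K) \<and>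
     (\<forall>\<rho>\<in>states K. \<forall>\<sigma>\<in>states K. \<bar>d (T \<rho>) (T \<sigma>) - d \<rho> \<sigma>\<bar> \<le> \<epsilon>)"

text \<open>Only the values of \<open>U\<close> on \<open>K\<close> matter in the next three definitions.\<close>

definition unitary_on :: "'a::chilbert_space set \<Rightarrow> ('a \<Rightarrow> 'a) \<Rightarrow> bool" where
  "unitary_on K U \<longleftrightarrow> U ` K = K \<and> (\<forall>x\<in>K. \<forall>y\<in>K. U (x + y) = U x + U y) \<and>
     (\<forall>c. \<forall>x\<in>K. U (c *\<^sub>C x) = c *\<^sub>C U x) \<and>
     (\<forall>x\<in>K. \<forall>y\<in>K. cinner (U x) (U y) = cinner x y)"

definition antiunitary_on :: "'a::chilbert_space set \<Rightarrow> ('a \<Rightarrow> 'a) \<Rightarrow> bool" where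
  "antiunitary_on K U \<longleftrightarrow> U ` K = K \<and> (\<forall>x\<in>K. \<forall>y\<in>K. U (x + y) = U x + U y) \<and>
     (\<forall>c. \<forall>x\<in>K. U (c *\<^sub>C x) = cnj c *\<^sub>C U x) \<and>
     (\<forall>x\<in>K. \<forall>y\<in>K. cinner (U x) (U y) = cnj (cinner x y))"

text \<open>\<open>U \<rho> U\<^sup>*\<close>, where \<open>U\<^sup>* = U\<^sup>-\<^sup>1\<close>.\<close>

definition conj_by :: "'a::chilbert_space set \<Rightarrow> ('a \<Rightarrow> 'a) \<Rightarrow> ('a \<Rightarrow> 'a) \<Rightarrow> 'a \<Rightarrow> 'a" where
  "conj_by K U \<rho> = (\<lambda>x. if x \<in> K then U (\<rho> (inv_into K U x)) else 0)"

section \<open>The spaces \<open>\<complex>\<^sup>d\<close> for varying \<open>d\<close>\<close>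

text \<open>To quantify over \<open>d\<close> inside a formula, all the spaces \<open>\<complex>\<^sup>d\<close> are taken in
  one type, the square-summable sequences: \<open>\<complex>\<^sup>d\<close> consists of those vanishing from
  index \<open>d\<close> on.\<close>

typedef ell2 = "{x :: nat \<Rightarrow> complex. summable (\<lambda>i. (cmod (x i))\<^sup>2)}"
  morphisms coord Abs_ell2
  by (rule exI[of _ "\<lambda>_. 0"]) simp

lemma coord_inject_ext: "x = y \<longleftrightarrow> (\<forall>i. coord x i = coord y i)"
  by (metis coord_inject ext)

lemma summable_coord: "summable (\<lambda>i. (cmod (coord x i))\<^sup>2)"
  using coord by auto

lemma coord_Abs: "summable (\<lambda>i. (cmod (f i))\<^sup>2) \<Longrightarrow> coord (Abs_ell2 f) = f"
  by (simp add: Abs_ell2_inverse)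

lemma summable_ell2_add:
  fixes f g :: "nat \<Rightarrow> complex"
  assumes "summable (\<lambda>i. (cmod (f i))\<^sup>2)" "summable (\<lambda>i. (cmod (g i))\<^sup>2)"
  shows "summable (\<lambda>i. (cmod (f i + g i))\<^sup>2)"
proof (rule summable_comparison_test')
  show "summable (\<lambda>i. 2 * (cmod (f i))\<^sup>2 + 2 * (cmod (g i))\<^sup>2)"
    by (intro summable_add summable_mult assms)
  fix i
  have "(cmod (f i + g i))\<^sup>2 \<le> (cmod (f i) + cmod (g i))\<^sup>2"
    by (intro power_mono norm_triangle_ineq) simp
  also have "\<dots> \<le> 2 * (cmod (f i))\<^sup>2 + 2 * (cmod (g i))\<^sup>2"
    using sum_squares_bound[of "cmod (f i)" "cmod (g i)"]
    by (simp add: power2_sum)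
  finally show "norm ((cmod (f i + g i))\<^sup>2) \<le> 2 * (cmod (f i))\<^sup>2 + 2 * (cmod (g i))\<^sup>2"
    by simp
qed

lemma summable_ell2_scale:
  fixes f :: "nat \<Rightarrow> complex"
  shows "summable (\<lambda>i. (cmod (f i))\<^sup>2) \<Longrightarrow> summable (\<lambda>i. (cmod (c * f i))\<^sup>2)"
  by (simp add: norm_mult power_mult_distrib summable_mult)

lemma summable_ell2_inner: "summable (\<lambda>i. cnj (coord x i) * coord y i)"
proof (rule summable_comparison_test')
  show "summable (\<lambda>i. (cmod (coord x i))\<^sup>2 + (cmod (coord y i))\<^sup>2)"
    by (intro summable_add summable_coord)
  fix i
  have "0 \<le> cmod (coord x i) * cmod (coord y i)"
    by simp
  then have "cmod (coord x i) * cmod (coord y i) \<le> (cmod (coord x i))\<^sup>2 + (cmod (coord y i))\<^sup>2"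
    using sum_squares_bound[of "cmod (coord x i)" "cmod (coord y i)"] by linarith
  then show "norm (cnj (coord x i) * coord y i) \<le> (cmod (coord x i))\<^sup>2 + (cmod (coord y i))\<^sup>2"
    by (simp add: norm_mult)
qed

instantiation ell2 :: complex_inner
begin

definition "0 = Abs_ell2 (\<lambda>_. 0)"
definition "x + y = Abs_ell2 (\<lambda>i. coord x i + coord y i)"
definition "- x = Abs_ell2 (\<lambda>i. - coord x i)" for x :: ell2
definition "x - y = x + - y" for x y :: ell2
definition "r *\<^sub>R x = Abs_ell2 (\<lambda>i. complex_of_real r * coord x i)"
definition "c *\<^sub>C x = Abs_ell2 (\<lambda>i. c * coord x i)"
definition "cinner x y = (\<Sum>i. cnj (coord x i) * coord y i)"
definition "inner x y = Re (\<Sum>i. cnj (coord x i) * coord y i)"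
definition "norm x = sqrt (inner x x)" for x :: ell2
definition "sgn x = inverse (norm x) *\<^sub>R x" for x :: ell2
definition "dist x y = norm (x - y)" for x y :: ell2
definition "(uniformity :: (ell2 \<times> ell2) filter) =
  (INF e\<in>{0 <..}. principal {(x, y). dist x y < e})"
definition "open U \<longleftrightarrow> (\<forall>x\<in>U. eventually (\<lambda>(x', y). x' = x \<longrightarrow> y \<in> U) uniformity)"
  for U :: "ell2 set"

lemma coord_simps [simp]:
  "coord 0 i = 0" "coord (x + y) i = coord x i + coord y i" "coord (- x) i = - coord x i"
  "coord (x - y) i = coord x i - coord y i"
  "coord (r *\<^sub>R x) i = complex_of_real r * coord x i" "coord (c *\<^sub>C x) i = c * coord x i"
proof -
  show "coord 0 i = 0" "coord (- x) i = - coord x i"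
    "coord (r *\<^sub>R x) i = complex_of_real r * coord x i" "coord (c *\<^sub>C x) i = c * coord x i"
    using summable_ell2_scale[OF summable_coord]
    by (simp_all add: zero_ell2_def uminus_ell2_def scaleR_ell2_def scaleC_ell2_def
          coord_Abs summable_coord)
  show *: "coord (x + y) i = coord x i + coord y i" for x y
    by (simp add: plus_ell2_def coord_Abs summable_coord summable_ell2_add)
  show "coord (x - y) i = coord x i - coord y i"
    by (simp add: minus_ell2_def * uminus_ell2_def coord_Abs summable_coord)
qed

lemma inner_self_sums: "(\<lambda>i. (cmod (coord x i))\<^sup>2) sums inner x x"
proof -
  have "(\<lambda>i. Re (cnj (coord x i) * coord x i)) sums inner x x"
    unfolding inner_ell2_def by (intro sums_Re summable_sums summable_ell2_inner)
  moreover have "Re (cnj z * z) = (cmod z)\<^sup>2" for z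
    unfolding cmod_power2 by (simp add: power2_eq_square)
  ultimately show ?thesis
    by simp
qed

instance
proof
  fix x y z :: ell2 and r s :: real and c d :: complex
  note [simp] = coord_inject_ext
  show "x + y + z = x + (y + z)" "x + y = y + x" "0 + x = x" "- x + x = 0" "x - y = x + - y"
    "r *\<^sub>R (x + y) = r *\<^sub>R x + r *\<^sub>R y" "(r + s) *\<^sub>R x = r *\<^sub>R x + s *\<^sub>R x"
    "r *\<^sub>R s *\<^sub>R x = (r * s) *\<^sub>R x" "1 *\<^sub>R x = x"
    "c *\<^sub>C (x + y) = c *\<^sub>C x + c *\<^sub>C y" "(c + d) *\<^sub>C x = c *\<^sub>C x + d *\<^sub>C x"
    "c *\<^sub>C d *\<^sub>C x = (c * d) *\<^sub>C x" "complex_of_real r *\<^sub>C x = r *\<^sub>R x"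
    by (simp_all add: algebra_simps)
  show comm: "cinner x y = cnj (cinner y x)" for x y :: ell2
  proof -
    have "cnj (cinner y x) = (\<Sum>i. cnj (cnj (coord y i) * coord x i))"
      unfolding cinner_ell2_def
      by (metis sums_cnj summable_ell2_inner summable_sums sums_unique)
    then show ?thesis
      by (simp add: cinner_ell2_def mult.commute)
  qed
  show addr: "cinner x (y + z) = cinner x y + cinner x z" for x y z :: ell2
    by (simp add: cinner_ell2_def distrib_left suminf_add summable_ell2_inner)
  show scr: "cinner x (c *\<^sub>C y) = c * cinner x y" for x y :: ell2 and c
    by (simp add: cinner_ell2_def mult.left_commute suminf_mult summable_ell2_inner)
  show re: "Re (cinner x y) = inner x y" for x y :: ell2
    by (simp add: cinner_ell2_def inner_ell2_def)
  have inner_sym: "inner x y = inner y x" for x y :: ell2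
    using comm[of x y] re[of x y] re[of y x] by simp
  then show "inner x y = inner y x" .
  have "inner z (x + y) = inner z x + inner z y"
    by (simp flip: re add: addr)
  then show "inner (x + y) z = inner x z + inner y z"
    by (simp only: inner_sym[of _ z])
  have "r *\<^sub>R x = complex_of_real r *\<^sub>C x"
    by simp
  then have "inner y (r *\<^sub>R x) = r * inner y x"
    by (simp only: re[symmetric] scr) simp
  then show "inner (r *\<^sub>R x) y = r * inner x y"
    by (simp only: inner_sym[of _ y])
  show "0 \<le> inner x x"
    by (rule sums_le[OF _ sums_zero inner_self_sums[of x]]) simp
  show "inner x x = 0 \<longleftrightarrow> x = 0"
    using suminf_eq_zero_iff[OF summable_coord[of x]] sums_unique[OF inner_self_sums[of x]]
    by simp
  show "norm x = sqrt (inner x x)" "sgn x = inverse (norm x) *\<^sub>R x" "dist x y = norm (x - y)"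
    by (rule norm_ell2_def sgn_ell2_def dist_ell2_def)+
  show "(uniformity :: (ell2 \<times> ell2) filter) = (INF e\<in>{0 <..}. principal {(x, y). dist x y < e})"
    by (rule uniformity_ell2_def)
  show "open U \<longleftrightarrow> (\<forall>x\<in>U. eventually (\<lambda>(x', y). x' = x \<longrightarrow> y \<in> U) uniformity)" for U :: "ell2 set"
    by (rule open_ell2_def)
qed

end

lemma norm_ell2_sums: "(\<lambda>i. (cmod (coord x i))\<^sup>2) sums (norm x)\<^sup>2"
  using inner_self_sums[of x] by (simp add: power2_norm_eq_inner)

lemma sum_coord_le_norm: "(\<Sum>i<k. (cmod (coord x i))\<^sup>2) \<le> (norm x)\<^sup>2"
  using sum_le_suminf[OF summable_coord, of "{..<k}" x] sums_unique[OF norm_ell2_sums[of x]]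
  by simp

lemma coord_le_norm: "cmod (coord x i) \<le> norm x"
proof -
  have "(cmod (coord x i))\<^sup>2 \<le> (\<Sum>j<Suc i. (cmod (coord x j))\<^sup>2)"
    by (simp add: sum_nonneg)
  also have "\<dots> \<le> (norm x)\<^sup>2"
    by (rule sum_coord_le_norm)
  finally show ?thesis
    by (rule power2_le_imp_le) simp
qed

instance ell2 :: chilbert_space
proof
  fix X :: "nat \<Rightarrow> ell2"
  assume X: "Cauchy X"
  have "Cauchy (\<lambda>n. coord (X n) i)" for i
  proof (rule metric_CauchyI)
    fix e :: real
    assume "0 < e"
    then obtain N where "\<forall>m\<ge>N. \<forall>n\<ge>N. dist (X m) (X n) < e"
      using metric_CauchyD[OF X] by metis
    moreover have "dist (coord (X m) i) (coord (X n) i) \<le> dist (X m) (X n)" for m n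
      using coord_le_norm[of "X m - X n" i] by (simp add: dist_norm)
    ultimately show "\<exists>N. \<forall>m\<ge>N. \<forall>n\<ge>N. dist (coord (X m) i) (coord (X n) i) < e"
      by (meson le_less_trans)
  qed
  then have "\<forall>i. \<exists>l. (\<lambda>n. coord (X n) i) \<longlonglongrightarrow> l"
    by (simp add: Cauchy_convergent convergent_def[symmetric])
  then obtain l where l: "\<And>i. (\<lambda>n. coord (X n) i) \<longlonglongrightarrow> l i"
    by metis
  have bound: "(\<Sum>i<k. (cmod (coord (X m) i - l i))\<^sup>2) \<le> e\<^sup>2"
    if "\<And>n. n \<ge> N \<Longrightarrow> dist (X m) (X n) < e" for N m e k
  proof (rule tendsto_upperbound)
    show "(\<lambda>n. \<Sum>i<k. (cmod (coord (X m) i - coord (X n) i))\<^sup>2)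
        \<longlonglongrightarrow> (\<Sum>i<k. (cmod (coord (X m) i - l i))\<^sup>2)"
      by (intro tendsto_intros l)
    show "eventually (\<lambda>n. (\<Sum>i<k. (cmod (coord (X m) i - coord (X n) i))\<^sup>2) \<le> e\<^sup>2) sequentially"
    proof (rule eventually_sequentiallyI[of N])
      fix n
      assume "N \<le> n"
      then have "(norm (X m - X n))\<^sup>2 \<le> e\<^sup>2"
        using that[of n] by (intro power_mono) (simp_all add: dist_norm)
      then show "(\<Sum>i<k. (cmod (coord (X m) i - coord (X n) i))\<^sup>2) \<le> e\<^sup>2"
        using sum_coord_le_norm[of "X m - X n" k] by simp
    qed
  qed simp
  have summ: "summable (\<lambda>i. (cmod (coord (X m) i - l i))\<^sup>2)"
    if "\<And>n. n \<ge> N \<Longrightarrow> dist (X m) (X n) < e" for N m e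
    using bound[OF that] by (intro summableI_nonneg_bounded[of _ "e\<^sup>2"]) auto
  obtain N0 where N0: "\<forall>m\<ge>N0. \<forall>n\<ge>N0. dist (X m) (X n) < 1"
    using metric_CauchyD[OF X, of 1] by auto
  have "summable (\<lambda>i. (cmod (coord (X N0) i + (- 1) * (coord (X N0) i - l i)))\<^sup>2)"
    using N0 by (intro summable_ell2_add summable_ell2_scale summable_coord summ[of N0 N0 1]) auto
  then have coord_l: "coord (Abs_ell2 l) = l"
    by (simp add: coord_Abs)
  have "X \<longlonglongrightarrow> Abs_ell2 l"
  proof (rule metric_LIMSEQ_I)
    fix e :: real
    assume "0 < e"
    then obtain N where N: "\<forall>m\<ge>N. \<forall>n\<ge>N. dist (X m) (X n) < e / 2"
      using metric_CauchyD[OF X, of "e / 2"] by auto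
    have "dist (X m) (Abs_ell2 l) < e" if "m \<ge> N" for m
    proof -
      have "(norm (X m - Abs_ell2 l))\<^sup>2 = (\<Sum>i. (cmod (coord (X m) i - l i))\<^sup>2)"
        using norm_ell2_sums[of "X m - Abs_ell2 l"] by (simp add: sums_iff coord_l)
      also have "\<dots> \<le> (e / 2)\<^sup>2"
        using N that by (intro suminf_le_const summ[of N m "e / 2"] bound[of N m "e / 2"]) auto
      finally have "norm (X m - Abs_ell2 l) \<le> e / 2"
        by (rule power2_le_imp_le) (use \<open>0 < e\<close> in simp)
      then show ?thesis
        using \<open>0 < e\<close> by (simp add: dist_norm)
    qed
    then show "\<exists>N. \<forall>n\<ge>N. dist (X n) (Abs_ell2 l) < e"
      by blast
  qed
  then show "convergent X"
    by (auto simp: convergent_def)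
qed

definition Cn :: "nat \<Rightarrow> ell2 set" where
  "Cn d = {x. \<forall>i\<ge>d. coord x i = 0}"

lemma cinner_Cn: "x \<in> Cn d \<Longrightarrow> cinner x y = (\<Sum>i<d. cnj (coord x i) * coord y i)"
  unfolding cinner_ell2_def by (rule suminf_finite) (auto simp: Cn_def)

lemma csubspace_Cn: "csubspace (Cn d)"
  by (simp add: complex_vector.subspace_def Cn_def)

lemma closed_Cn: "closed (Cn d)"
proof -
  have "bounded_linear (\<lambda>x. coord x i)" for i
    by (rule bounded_linear_intro[of _ 1])
       (simp_all add: coord_le_norm scaleR_conv_of_real)
  then have "closed {x. coord x i = 0}" for i
    by (intro closed_Collect_eq linear_continuous_on continuous_on_const)
  moreover have "Cn d = (\<Inter>i\<in>{d..}. {x. coord x i = 0})"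
    by (auto simp: Cn_def)
  ultimately show ?thesis
    by auto
qed

end

theory Submission
  imports Defs
begin

text \<open>The maps in question conjugate every state by a unitary that depends on the state. Fix an
  orthonormal family \<open>f\<^sub>0, \<dots>, f\<^bsub>m-1\<^esub>\<close> and call the numbers \<open>a\<^sub>k = \<langle>f\<^sub>k, \<rho> f\<^sub>k\<rangle>\<close> the levels of \<open>\<rho>\<close>. Put
  \<open>\<Theta> \<rho> = W \<rho> W\<^sup>*\<close>, where \<open>W\<close> multiplies \<open>f\<^sub>k\<close> by a phase \<open>e\<^bsup>i\<theta>(a\<^sub>k)\<^esup>\<close> and fixes the orthogonal complement
  of the family; the angle \<open>\<theta>\<close> decreases from \<open>\<pi>\<close> at level \<open>1/(2m)\<close> to \<open>0\<close> at level \<open>1/2\<close>, linearly in the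
  logarithm of the level. Conjugation by \<open>W\<close> preserves the levels, so \<open>\<Theta>\<close> is inverted by the
  conjugate phases.

  \<open>\<Theta>\<close> nearly preserves both metrics because \<open>\<theta>\<close> varies slowly. If \<open>0 < b \<le> a\<close> are the levels of two states
  in direction \<open>f\<^sub>k\<close>, their phases differ by at most \<open>(\<pi> / ln m) (ln a - ln b) \<le> (2 \<pi> / ln m) \<surd>(a/b)\<close>:
  either the levels are comparable and the phases almost agree, or one of the states hardly
  notices \<open>f\<^sub>k\<close>. As the levels of a state sum to at most \<open>1\<close>, the accumulated
  changes of the trace distance and of the fidelity are of order \<open>1 / ln m\<close>
  (\<open>twist_difference\<close>, \<open>rot_trace_dist_le\<close>, \<open>rot_fidelity_le\<close>).

  \<open>\<Theta>\<close> is far from every unitary or antiunitary conjugation because it acts differently at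
  different levels. Let \<open>g\<^sub>0, \<dots>, g\<^bsub>m-1\<^esub>\<close> be a second orthonormal family, orthogonal to the first,
  and \<open>\<phi>\<^sub>k = (g\<^sub>k + f\<^sub>k) / \<surd>2\<close>, \<open>\<psi>\<^sub>k = (g\<^sub>k - f\<^sub>k) / \<surd>2\<close>. The pure state of \<open>\<phi>\<^sub>k\<close> has level
  \<open>1/2\<close> and is fixed, so a symmetry close to \<open>\<Theta>\<close> must nearly fix all the lines spanned by the \<open>\<phi>\<^sub>k\<close>, and then
  keeps at least half of the equal mixture of these states on the span of the \<open>\<phi>\<^sub>k\<close>. But that mixture has levels
  \<open>1/(2m)\<close>, and \<open>\<Theta>\<close> takes it to the mixture of the \<open>\<psi>\<^sub>k\<close> (\<open>trace_dist_far\<close>, \<open>bures_dist_far\<close>). Only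
  \<open>2m\<close> dimensions are involved, so one construction serves all infinite-dimensional spaces
  and the spaces \<open>\<complex>\<^bsup>2m\<^esup>\<close>. Letting \<open>m \<rightarrow> \<infinity>\<close> excludes every modulus \<open>\<omega>\<close>.

  Both metrics are accessible through variational formulas: the trace distance is
  the supremum of \<open>\<Sum>\<^sub>i |\<langle>u\<^sub>i, (\<rho> - \<sigma>) u\<^sub>i\<rangle>|\<close> over finite orthonormal families, the fidelity that of
  \<open>\<Sum>\<^sub>i |\<langle>w\<^sub>i, \<surd>\<sigma> \<surd>\<rho> v\<^sub>i\<rangle>|\<close> over pairs of such families. They follow from the spectral theorem for compact
  self-adjoint operators, as positive operators with summable diagonal are compact, and from the
  uniqueness of positive square roots.\<close>

section \<open>Complex inner products and orthogonal series\<close>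

lemma cinner_add_left: "cinner (x + y) z = cinner x z + cinner y z"
  by (metis cinner_add_right cinner_commute complex_cnj_add)

lemma cinner_scaleC_left: "cinner (c *\<^sub>C x) y = cnj c * cinner x y"
  by (metis cinner_scaleC_right cinner_commute complex_cnj_mult)

lemma cinner_zero [simp]: "cinner x 0 = 0" "cinner 0 x = 0"
  using cinner_add_right[of x 0 0] cinner_add_left[of 0 0 x] by simp_all

lemma cinner_minus_right: "cinner x (- y) = - cinner x y"
  using cinner_add_right[of x y "- y"] by (simp add: add_eq_0_iff)

lemma cinner_minus_left: "cinner (- x) y = - cinner x y"
  using cinner_add_left[of x "- x" y] by (simp add: add_eq_0_iff)

lemma cinner_diff_right: "cinner x (y - z) = cinner x y - cinner x z"
  using cinner_add_right[of x y "- z"] by (simp add: cinner_minus_right)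

lemma cinner_diff_left: "cinner (x - y) z = cinner x z - cinner y z"
  using cinner_add_left[of x "- y" z] by (simp add: cinner_minus_left)

lemma cinner_sum_right: "cinner x (\<Sum>i\<in>I. f i) = (\<Sum>i\<in>I. cinner x (f i))"
  by (induction I rule: infinite_finite_induct) (simp_all add: cinner_add_right)

lemma cinner_sum_left: "cinner (\<Sum>i\<in>I. f i) y = (\<Sum>i\<in>I. cinner (f i) y)"
  by (induction I rule: infinite_finite_induct) (simp_all add: cinner_add_left)

lemma cinner_self: "cinner x x = complex_of_real ((norm x)\<^sup>2)"
proof (rule complex_eqI)
  show "Re (cinner x x) = Re (complex_of_real ((norm x)\<^sup>2))"
    by (simp add: Re_cinner power2_norm_eq_inner)
  have "Im (cinner x x) = - Im (cinner x x)"
    by (metis cinner_commute cnj.simps(2))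
  then show "Im (cinner x x) = Im (complex_of_real ((norm x)\<^sup>2))"
    by simp
qed

lemma scaleR_scaleC: "r *\<^sub>R x = complex_of_real r *\<^sub>C x"
  by (simp add: scaleC_of_real)

lemma cinner_scaleR_right: "cinner x (r *\<^sub>R y) = complex_of_real r * cinner x y"
  by (simp add: scaleR_scaleC cinner_scaleC_right)

lemma cinner_scaleR_left: "cinner (r *\<^sub>R x) y = complex_of_real r * cinner x y"
  by (simp add: scaleR_scaleC cinner_scaleC_left)

lemma mult_cnj_cmod: "c * cnj c = complex_of_real ((cmod c)\<^sup>2)" "cnj c * c = complex_of_real ((cmod c)\<^sup>2)"
  by (simp_all add: complex_mult_cnj cmod_power2 mult.commute)

lemma norm_scaleC: "norm (c *\<^sub>C x) = cmod c * norm (x :: 'a :: complex_inner)"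
proof -
  have "complex_of_real ((norm (c *\<^sub>C x))\<^sup>2) = complex_of_real ((cmod c * norm x)\<^sup>2)"
    unfolding cinner_self[symmetric] cinner_scaleC_left cinner_scaleC_right
    by (simp add: cinner_self mult_cnj_cmod flip: mult.assoc) (simp add: power_mult_distrib)
  then show ?thesis
    unfolding of_real_eq_iff by (simp add: power2_eq_iff_nonneg)
qed

lemma cmod_cinner_le: "cmod (cinner x y) \<le> norm x * norm y"
proof (cases "cinner x y = 0")
  case False
  define c where "c = cnj (cinner x y) / complex_of_real (cmod (cinner x y))"
  have c: "cmod c = 1"
    using False by (simp add: c_def norm_divide)
  have "cinner x (c *\<^sub>C y) = complex_of_real (cmod (cinner x y))"
    using False mult_cnj_cmod(2)[of "cinner x y"]
    by (simp add: cinner_scaleC_right c_def power2_eq_square)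
  then have "cmod (cinner x y) = inner x (c *\<^sub>C y)"
    by (metis Re_cinner Re_complex_of_real)
  also have "\<dots> \<le> norm x * norm (c *\<^sub>C y)"
    by (rule norm_cauchy_schwarz)
  finally show ?thesis
    by (simp add: norm_scaleC c)
qed simp

lemma bounded_linear_cinner_right: "bounded_linear (cinner (x :: 'a :: complex_inner))"
  by (rule bounded_linear_intro[of _ "norm x"])
     (simp_all add: cinner_add_right cinner_scaleR_right scaleR_conv_of_real cmod_cinner_le
        mult.commute[of "norm _" "norm x"])

lemma bounded_linear_cinner_left: "bounded_linear (\<lambda>x. cinner x (y :: 'a :: complex_inner))"
  by (rule bounded_linear_intro[of _ "norm y"])
     (simp_all add: cinner_add_left cinner_scaleR_left scaleR_conv_of_real cmod_cinner_le)


lemma cmod_cinner_commute: "cmod (cinner x y) = cmod (cinner y x)"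
  by (metis cinner_commute complex_mod_cnj)

lemma norm_diff_squared: "(norm (x - y :: 'a :: real_inner))\<^sup>2 = (norm x)\<^sup>2 - 2 * inner x y + (norm y)\<^sup>2"
  by (simp add: power2_norm_eq_inner inner_diff_left inner_diff_right inner_commute)

text \<open>Families rather than sets: the image of a family under an isometry is again indexed by the
  same set.\<close>

definition orthonormal :: "'i set \<Rightarrow> ('i \<Rightarrow> 'a::complex_inner) \<Rightarrow> bool" where
  "orthonormal I u \<longleftrightarrow> (\<forall>i\<in>I. \<forall>j\<in>I. cinner (u i) (u j) = (if i = j then 1 else 0))"

lemma orthonormal_norm: "orthonormal I u \<Longrightarrow> i \<in> I \<Longrightarrow> norm (u i) = 1"
  using cinner_self[of "u i"] by (auto simp: orthonormal_def power2_eq_1_iff simp del: of_real_power)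
    (metis norm_ge_zero not_one_le_zero neg_0_le_iff_le order.trans zero_le_one)

lemma orthonormal_subset: "orthonormal I u \<Longrightarrow> J \<subseteq> I \<Longrightarrow> orthonormal J u"
  unfolding orthonormal_def by blast

lemma orthonormal_image: "orthonormal I u \<Longrightarrow> orthonormal (u ` I) (\<lambda>e. e)"
  by (auto simp: orthonormal_def) (metis one_neq_zero)

lemma orthonormal_inj_on: "orthonormal I u \<Longrightarrow> inj_on u I"
  unfolding inj_on_def orthonormal_def by (metis one_neq_zero)

lemma cinner_orthonormal_sum:
  assumes "orthonormal I u" "finite I" "j \<in> I"
  shows "cinner (u j) (\<Sum>i\<in>I. c i *\<^sub>C u i) = c j"
proof -
  have "cinner (u j) (\<Sum>i\<in>I. c i *\<^sub>C u i) = (\<Sum>i\<in>I. if j = i then c i else 0)"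
    using assms unfolding cinner_sum_right cinner_scaleC_right orthonormal_def
    by (intro sum.cong refl) auto
  then show ?thesis
    using assms by simp
qed

lemma norm_orthonormal_sum:
  assumes "orthonormal I u" "finite I"
  shows "(norm (\<Sum>i\<in>I. c i *\<^sub>C u i))\<^sup>2 = (\<Sum>i\<in>I. (cmod (c i))\<^sup>2)"
proof -
  have "complex_of_real ((norm (\<Sum>i\<in>I. c i *\<^sub>C u i))\<^sup>2)
      = (\<Sum>j\<in>I. cnj (c j) * cinner (u j) (\<Sum>i\<in>I. c i *\<^sub>C u i))"
    by (simp only: cinner_self[symmetric] cinner_sum_left cinner_scaleC_left)
  also have "\<dots> = (\<Sum>j\<in>I. complex_of_real ((cmod (c j))\<^sup>2))"
    by (intro sum.cong refl) (simp only: cinner_orthonormal_sum[OF assms] mult_cnj_cmod)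
  finally show ?thesis
    by (simp only: of_real_sum[symmetric] of_real_eq_iff)
qed

lemma bessel_finite:
  assumes "orthonormal I u" "finite I"
  shows "(\<Sum>i\<in>I. (cmod (cinner (u i) x))\<^sup>2) \<le> (norm x)\<^sup>2"
proof -
  define p where "p = (\<Sum>i\<in>I. cinner (u i) x *\<^sub>C u i)"
  have p: "(norm p)\<^sup>2 = (\<Sum>i\<in>I. (cmod (cinner (u i) x))\<^sup>2)"
    unfolding p_def by (rule norm_orthonormal_sum[OF assms])
  have "cinner x p = (\<Sum>i\<in>I. complex_of_real ((cmod (cinner (u i) x))\<^sup>2))"
    unfolding p_def cinner_sum_right cinner_scaleC_right
    by (intro sum.cong refl) (metis cinner_commute mult_cnj_cmod(1))
  then have "inner x p = (norm p)\<^sup>2"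
    by (simp add: p flip: Re_cinner of_real_power of_real_sum)
  then have "(norm (x - p))\<^sup>2 = (norm x)\<^sup>2 - (norm p)\<^sup>2"
    by (simp add: norm_diff_squared)
  then show ?thesis
    using p zero_le_power2[of "norm (x - p)"] by linarith
qed

lemma bessel_summable:
  assumes "orthonormal I u"
  shows "(\<lambda>i. (cmod (cinner (u i) x))\<^sup>2) summable_on I"
  by (rule nonneg_bounded_partial_sums_imp_summable_on[where C = "(norm x)\<^sup>2"])
     (auto intro!: eventually_finite_subsets_at_top_weakI bessel_finite orthonormal_subset[OF assms])

lemma sum_mult_le_sqrt:
  fixes f g :: "'i \<Rightarrow> real"
  shows "(\<Sum>i\<in>I. f i * g i) \<le> sqrt (\<Sum>i\<in>I. (f i)\<^sup>2) * sqrt (\<Sum>i\<in>I. (g i)\<^sup>2)"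
proof -
  have "(\<Sum>i\<in>I. f i * g i) \<le> (\<Sum>i\<in>I. \<bar>f i\<bar> * \<bar>g i\<bar>)"
    by (intro sum_mono) (metis abs_ge_self abs_mult)
  also have "\<dots> \<le> L2_set f I * L2_set g I"
    by (rule L2_set_mult_ineq)
  finally show ?thesis
    by (simp add: L2_set_def)
qed

text \<open>The rank-one operator \<open>|a\<rangle>\<langle>b|\<close> has trace norm \<open>\<parallel>a\<parallel> \<parallel>b\<parallel>\<close>.\<close>

lemma sum_rank_one_le:
  assumes v: "orthonormal I v" and w: "orthonormal I w" and "finite I"
  shows "(\<Sum>i\<in>I. cmod (cinner (w i) a) * cmod (cinner b (v i))) \<le> norm a * norm b"
proof -
  have "(\<Sum>i\<in>I. cmod (cinner (w i) a) * cmod (cinner b (v i)))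
      \<le> sqrt (\<Sum>i\<in>I. (cmod (cinner (w i) a))\<^sup>2) * sqrt (\<Sum>i\<in>I. (cmod (cinner (v i) b))\<^sup>2)"
    unfolding cmod_cinner_commute[of b] by (rule sum_mult_le_sqrt)
  also have "\<dots> \<le> sqrt ((norm a)\<^sup>2) * sqrt ((norm b)\<^sup>2)"
    by (intro mult_mono real_sqrt_le_mono bessel_finite v w \<open>finite I\<close>) (auto simp: sum_nonneg)
  finally show ?thesis
    by simp
qed

lemma finite_tail_small:
  fixes g :: "'i \<Rightarrow> real"
  assumes "g summable_on I" "0 < \<epsilon>" "\<And>i. i \<in> I \<Longrightarrow> 0 \<le> g i"
  shows "\<exists>F0. finite F0 \<and> F0 \<subseteq> I \<and> (\<forall>F. finite F \<and> F \<subseteq> I - F0 \<longrightarrow> sum g F \<le> \<epsilon>)"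
proof -
  obtain s where s: "(g has_sum s) I"
    using assms(1) by (auto simp: summable_on_def)
  obtain F0 where F0: "finite F0" "F0 \<subseteq> I" "dist (sum g F0) s \<le> \<epsilon>"
    using has_sum_finite_approximation[OF s assms(2)] by blast
  have "sum g F \<le> \<epsilon>" if "finite F" "F \<subseteq> I - F0" for F
  proof -
    have "sum g F + sum g F0 = sum g (F \<union> F0)"
      using that F0 by (intro sum.union_disjoint[symmetric]) auto
    also have "\<dots> \<le> s"
      by (rule finite_sum_le_has_sum[OF s]) (use that F0 assms(3) in auto)
    finally show ?thesis
      using F0(3) by (simp add: dist_real_def)
  qed
  then show ?thesis
    using F0 by blast
qed

text \<open>Cauchy's criterion for unordered sums.\<close>

lemma summable_on_small_tails:
  fixes f :: "'i \<Rightarrow> 'a::{real_normed_vector, complete_space}"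
  assumes small: "\<And>\<epsilon>. 0 < \<epsilon> \<Longrightarrow> \<exists>F0. finite F0 \<and> F0 \<subseteq> I \<and> (\<forall>F. finite F \<and> F \<subseteq> I - F0 \<longrightarrow> norm (sum f F) \<le> \<epsilon>)"
  shows "f summable_on I"
proof -
  have "\<exists>P. eventually P (finite_subsets_at_top I) \<and>
          (\<forall>F F'. P F \<and> P F' \<longrightarrow> dist (sum f F) (sum f F') < e)" if "e > 0" for e
  proof -
    have "0 < e / 3"
      using that by simp
    from small[OF this] obtain F0 where
      "finite F0 \<and> F0 \<subseteq> I \<and> (\<forall>F. finite F \<and> F \<subseteq> I - F0 \<longrightarrow> norm (sum f F) \<le> e / 3)" ..
    then have F0: "finite F0" "F0 \<subseteq> I"
      and *: "\<And>F. finite F \<Longrightarrow> F \<subseteq> I - F0 \<Longrightarrow> norm (sum f F) \<le> e / 3"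
      by blast+
    define P where "P F \<longleftrightarrow> finite F \<and> F0 \<subseteq> F \<and> F \<subseteq> I" for F
    have "eventually P (finite_subsets_at_top I)"
      using F0 by (auto simp: P_def eventually_finite_subsets_at_top)
    moreover have "dist (sum f F) (sum f F') < e" if "P F" "P F'" for F F'
    proof -
      have "sum f F = sum f (F - F0) + sum f F0" "sum f F' = sum f (F' - F0) + sum f F0"
        using that F0 by (auto simp: P_def intro!: sum.subset_diff)
      then have "dist (sum f F) (sum f F') = norm (sum f (F - F0) - sum f (F' - F0))"
        by (simp add: dist_norm)
      also have "\<dots> \<le> norm (sum f (F - F0)) + norm (sum f (F' - F0))"
        by (rule norm_triangle_ineq4)
      also have "\<dots> \<le> e / 3 + e / 3"
        using that by (intro add_mono *) (auto simp: P_def)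
      finally show ?thesis
        using \<open>e > 0\<close> by simp
    qed
    ultimately show ?thesis
      by blast
  qed
  then have "cauchy_filter (filtermap (sum f) (finite_subsets_at_top I))"
    by (simp add: cauchy_filter_metric_filtermap)
  moreover have "complete (UNIV :: 'a set)"
    by (meson Cauchy_convergent UNIV_I complete_def convergent_def)
  ultimately obtain l where "(sum f \<longlongrightarrow> l) (finite_subsets_at_top I)"
    using complete_uniform[where S = UNIV] by (force simp add: filterlim_def)
  then show ?thesis
    using summable_on_def has_sum_def by blast
qed

text \<open>By Pythagoras the tails of an orthogonal series are controlled by those of the series
  of squared coefficients.\<close>

lemma orthogonal_series_summable:
  fixes u :: "'i \<Rightarrow> 'a::chilbert_space"
  assumes u: "orthonormal I u" and c: "(\<lambda>i. (cmod (c i))\<^sup>2) summable_on I"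
  shows "(\<lambda>i. c i *\<^sub>C u i) summable_on I"
proof (rule summable_on_small_tails)
  fix \<epsilon> :: real
  assume "0 < \<epsilon>"
  then obtain F0 where F0: "finite F0" "F0 \<subseteq> I"
    and *: "\<And>F. finite F \<Longrightarrow> F \<subseteq> I - F0 \<Longrightarrow> (\<Sum>i\<in>F. (cmod (c i))\<^sup>2) \<le> \<epsilon>\<^sup>2"
    using finite_tail_small[OF c, of "\<epsilon>\<^sup>2"] by auto
  have "norm (\<Sum>i\<in>F. c i *\<^sub>C u i) \<le> \<epsilon>" if "finite F" "F \<subseteq> I - F0" for F
  proof (rule power2_le_imp_le)
    have "orthonormal F u"
      using u that(2) by (auto intro: orthonormal_subset)
    then show "(norm (\<Sum>i\<in>F. c i *\<^sub>C u i))\<^sup>2 \<le> \<epsilon>\<^sup>2"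
      using *[OF that] that(1) by (simp add: norm_orthonormal_sum)
  qed (use \<open>0 < \<epsilon>\<close> in simp)
  then show "\<exists>F0. finite F0 \<and> F0 \<subseteq> I \<and> (\<forall>F. finite F \<and> F \<subseteq> I - F0 \<longrightarrow> norm (\<Sum>i\<in>F. c i *\<^sub>C u i) \<le> \<epsilon>)"
    using F0 by blast
qed

lemma norm_has_sum_orthogonal:
  fixes u :: "'i \<Rightarrow> 'a::chilbert_space"
  assumes u: "orthonormal I u" and s: "((\<lambda>i. c i *\<^sub>C u i) has_sum x) I"
  shows "\<And>i. i \<in> I \<Longrightarrow> cinner (u i) x = c i" "((\<lambda>i. (cmod (c i))\<^sup>2) has_sum (norm x)\<^sup>2) I"
proof -
  show *: "cinner (u j) x = c j" if "j \<in> I" for j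
  proof -
    have "((\<lambda>i. cinner (u j) (c i *\<^sub>C u i)) has_sum cinner (u j) x) I"
      using has_sum_bounded_linear[OF bounded_linear_cinner_right s] .
    moreover have "((\<lambda>i. cinner (u j) (c i *\<^sub>C u i)) has_sum c j) I"
      by (rule has_sum_finite_neutralI[of "{j}"])
         (use u that in \<open>auto simp: orthonormal_def cinner_scaleC_right\<close>)
    ultimately show ?thesis
      by (rule has_sum_unique)
  qed
  have "((\<lambda>i. Re (cinner (c i *\<^sub>C u i) x)) has_sum Re (cinner x x)) I"
    using has_sum_Re[OF has_sum_bounded_linear[OF bounded_linear_cinner_left s]] .
  moreover have "Re (cinner (c i *\<^sub>C u i) x) = (cmod (c i))\<^sup>2" if "i \<in> I" for i
    by (simp add: cinner_scaleC_left * that mult_cnj_cmod flip: of_real_power)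
  ultimately show "((\<lambda>i. (cmod (c i))\<^sup>2) has_sum (norm x)\<^sup>2) I"
    unfolding cinner_self Re_complex_of_real by (simp cong: has_sum_cong)
qed

lemma has_sum_sum:
  fixes f :: "'i \<Rightarrow> 'b \<Rightarrow> 'c::topological_comm_monoid_add"
  assumes "\<And>i. i \<in> I \<Longrightarrow> (f i has_sum s i) A"
  shows "((\<lambda>x. \<Sum>i\<in>I. f i x) has_sum (\<Sum>i\<in>I. s i)) A"
  using assms by (induction I rule: infinite_finite_induct) (auto intro!: has_sum_add)

text \<open>Tonelli for iterated unordered sums.\<close>

lemma has_sum_swap_nonneg:
  fixes f :: "'i \<Rightarrow> 'j \<Rightarrow> real"
  assumes "\<And>x. x \<in> A \<Longrightarrow> ((\<lambda>y. f x y) has_sum r x) B"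
    and "\<And>y. y \<in> B \<Longrightarrow> ((\<lambda>x. f x y) has_sum c y) A"
    and "(r has_sum s) A" and "\<And>x y. x \<in> A \<Longrightarrow> y \<in> B \<Longrightarrow> 0 \<le> f x y"
  shows "(c has_sum s) B"
proof -
  let ?g = "\<lambda>(x, y). f x y"
  have "?g summable_on A \<times> B"
    using assms(1,3,4) by (intro summable_on_SigmaI[where g = r]) (auto simp: summable_on_def)
  then have "(?g has_sum s) (A \<times> B)"
    using assms(1,3) by (intro has_sum_SigmaI[where g = r]) auto
  then have "((\<lambda>(y, x). f x y) has_sum s) (B \<times> A)"
    by (subst (asm) has_sum_swap) simp
  then show ?thesis
    by (rule has_sum_SigmaD) (use assms(2) in auto)
qed

section \<open>Orthonormal bases\<close>

text \<open>For a self-adjoint operator the quadratic form \<open>\<langle>x, A x\<rangle>\<close> is real.\<close>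

abbreviation quad :: "('a::complex_inner \<Rightarrow> 'a) \<Rightarrow> 'a \<Rightarrow> real" where
  "quad A x \<equiv> Re (cinner x (A x))"

definition selfadj :: "'a::chilbert_space set \<Rightarrow> ('a \<Rightarrow> 'a) \<Rightarrow> bool" where
  "selfadj K A \<longleftrightarrow> A \<in> bounded_ops K \<and> (\<forall>x\<in>K. \<forall>y\<in>K. cinner (A x) y = cinner x (A y))"

locale hilbert_subspace =
  fixes K :: "'a::chilbert_space set"
  assumes subspace: "csubspace K" and closed: "closed K"
begin

lemma zero_mem [simp]: "0 \<in> K"
  using subspace by (rule complex_vector.subspace_0)

lemma add_mem: "x \<in> K \<Longrightarrow> y \<in> K \<Longrightarrow> x + y \<in> K"
  using subspace by (rule complex_vector.subspace_add)

lemma diff_mem: "x \<in> K \<Longrightarrow> y \<in> K \<Longrightarrow> x - y \<in> K"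
  using subspace by (rule complex_vector.subspace_diff)

lemma scaleC_mem: "x \<in> K \<Longrightarrow> c *\<^sub>C x \<in> K"
  using subspace by (rule complex_vector.subspace_scale)

lemma scaleR_mem: "x \<in> K \<Longrightarrow> c *\<^sub>R x \<in> K"
  by (simp add: scaleR_scaleC scaleC_mem)

lemma sum_mem: "(\<And>i. i \<in> I \<Longrightarrow> f i \<in> K) \<Longrightarrow> sum f I \<in> K"
  using subspace by (rule complex_vector.subspace_sum)

lemma has_sum_mem:
  assumes "(f has_sum x) I" "\<And>i. i \<in> I \<Longrightarrow> f i \<in> K"
  shows "x \<in> K"
proof (rule Lim_in_closed_set[OF closed])
  show "eventually (\<lambda>F. sum f F \<in> K) (finite_subsets_at_top I)"
    using assms(2) by (intro eventually_finite_subsets_at_top_weakI sum_mem) blast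
  show "(sum f \<longlongrightarrow> x) (finite_subsets_at_top I)"
    using assms(1) by (simp add: has_sum_def)
qed simp

lemma onb_orthonormal: "onb K E \<Longrightarrow> orthonormal E (\<lambda>e. e)"
  by (simp add: onb_def orthonormal_def)

lemma onb_mem: "onb K E \<Longrightarrow> e \<in> E \<Longrightarrow> e \<in> K"
  by (auto simp: onb_def)

lemma orthogonal_projection_exists:
  assumes "E \<subseteq> K" and on: "orthonormal E (\<lambda>e. e)" and "x \<in> K"
  shows "\<exists>p. ((\<lambda>e. cinner e x *\<^sub>C e) has_sum p) E \<and> p \<in> K \<and> (\<forall>e\<in>E. cinner e (x - p) = 0)"
proof -
  obtain p where p: "((\<lambda>e. cinner e x *\<^sub>C e) has_sum p) E"
    using orthogonal_series_summable[OF on bessel_summable[OF on]] by (auto simp: summable_on_def)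
  moreover have "p \<in> K"
    using p by (rule has_sum_mem) (use assms(1) in \<open>auto intro: scaleC_mem\<close>)
  moreover have "cinner e (x - p) = 0" if "e \<in> E" for e
    using norm_has_sum_orthogonal(1)[OF on p that] by (simp add: cinner_diff_right)
  ultimately show ?thesis
    by blast
qed

lemma onb_expansion:
  assumes E: "onb K E" and x: "x \<in> K"
  shows "((\<lambda>e. cinner e x *\<^sub>C e) has_sum x) E"
proof -
  obtain p where p: "((\<lambda>e. cinner e x *\<^sub>C e) has_sum p) E" "p \<in> K"
    and ortho: "\<forall>e\<in>E. cinner e (x - p) = 0"
    using orthogonal_projection_exists[OF _ onb_orthonormal[OF E] x] onb_mem[OF E] by blast
  define y where "y = x - p"
  have "y \<in> K"
    using x p(2) by (simp add: y_def diff_mem)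
  let ?Z = "{z. cinner y z = 0}"
  have "E \<subseteq> ?Z"
    using ortho unfolding y_def[symmetric]
    by (metis (mono_tags, lifting) cinner_commute complex_cnj_zero mem_Collect_eq subsetI)
  moreover have "csubspace ?Z"
    by (auto simp: complex_vector.subspace_def cinner_add_right cinner_scaleC_right)
  ultimately have "cspan E \<subseteq> ?Z"
    by (rule complex_vector.span_minimal)
  moreover have "closed ?Z"
    by (intro closed_Collect_eq linear_continuous_on bounded_linear_cinner_right continuous_on_const)
  ultimately have "closure (cspan E) \<subseteq> ?Z"
    by (rule closure_minimal)
  then have "cinner y y = 0"
    using \<open>y \<in> K\<close> E by (auto simp: onb_def)
  then have "x = p"
    by (simp add: cinner_self y_def)
  then show ?thesis
    using p(1) by simp
qed

lemma onbI:
  assumes "E \<subseteq> K" and on: "orthonormal E (\<lambda>e. e)"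
    and total: "\<And>x. x \<in> K \<Longrightarrow> (\<And>e. e \<in> E \<Longrightarrow> cinner e x = 0) \<Longrightarrow> x = 0"
  shows "onb K E"
proof -
  have "K \<subseteq> closure (cspan E)"
  proof
    fix x
    assume x: "x \<in> K"
    obtain p where p: "((\<lambda>e. cinner e x *\<^sub>C e) has_sum p) E" "p \<in> K" "\<forall>e\<in>E. cinner e (x - p) = 0"
      using orthogonal_projection_exists[OF assms(1) on x] by blast
    then have "x - p = 0"
      using x by (intro total) (auto simp: diff_mem)
    moreover have "p \<in> closure (cspan E)"
    proof (rule Lim_in_closed_set[OF closed_closure])
      have "sum (\<lambda>e. cinner e x *\<^sub>C e) F \<in> cspan E" if "F \<subseteq> E" for F
        using that by (intro complex_vector.span_sum complex_vector.span_scale complex_vector.span_base) auto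
      then show "eventually (\<lambda>F. sum (\<lambda>e. cinner e x *\<^sub>C e) F \<in> closure (cspan E)) (finite_subsets_at_top E)"
        using closure_subset by (intro eventually_finite_subsets_at_top_weakI) blast
      show "(sum (\<lambda>e. cinner e x *\<^sub>C e) \<longlongrightarrow> p) (finite_subsets_at_top E)"
        using p(1) by (simp add: has_sum_def)
    qed simp
    ultimately show "x \<in> closure (cspan E)"
      by simp
  qed
  moreover have "closure (cspan E) \<subseteq> K"
    using assms(1) by (intro closure_minimal closed complex_vector.span_minimal subspace)
  ultimately show ?thesis
    using assms(1) on by (auto simp: onb_def orthonormal_def)
qed

lemma onb_parseval:
  assumes "onb K E" "y \<in> K"
  shows "((\<lambda>e. cinner x e * cinner e y) has_sum cinner x y) E"
  using has_sum_bounded_linear[OF bounded_linear_cinner_right[of x] onb_expansion[OF assms]]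
  by (simp add: cinner_scaleC_right mult.commute[of "cinner x _"])

lemma onb_parseval_norm:
  assumes "onb K E" "x \<in> K"
  shows "((\<lambda>e. (cmod (cinner e x))\<^sup>2) has_sum (norm x)\<^sup>2) E"
  using norm_has_sum_orthogonal(2)[OF onb_orthonormal onb_expansion] assms by blast

lemma onb_eqI:
  assumes E: "onb K E" and "x \<in> K" "y \<in> K" "\<And>e. e \<in> E \<Longrightarrow> cinner e x = cinner e y"
  shows "x = y"
proof -
  have "((\<lambda>e. cinner e x *\<^sub>C e) has_sum y) E"
    using onb_expansion[OF E \<open>y \<in> K\<close>] assms(4) by (simp cong: has_sum_cong)
  then show ?thesis
    using has_sum_unique onb_expansion[OF E \<open>x \<in> K\<close>] by blast
qed

text \<open>Zorn's lemma, for bases consisting of vectors with a given property. With the trivial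
  property it extends orthonormal sets to bases; with the property of being an eigenvector
  it is the induction step of the spectral theorem.\<close>

lemma onb_extend:
  assumes E0: "E0 \<subseteq> K" "orthonormal E0 (\<lambda>e. e)" "\<And>e. e \<in> E0 \<Longrightarrow> P e"
    and step: "\<And>F x. \<lbrakk>F \<subseteq> K; orthonormal F (\<lambda>e. e); \<And>e. e \<in> F \<Longrightarrow> P e; x \<in> K; x \<noteq> 0;
        \<And>e. e \<in> F \<Longrightarrow> cinner e x = 0\<rbrakk>
      \<Longrightarrow> \<exists>y\<in>K. norm y = 1 \<and> (\<forall>e\<in>F. cinner e y = 0) \<and> P y"
  shows "\<exists>E. onb K E \<and> E0 \<subseteq> E \<and> (\<forall>e\<in>E. P e)"
proof -
  define \<A> where "\<A> = {F. E0 \<subseteq> F \<and> F \<subseteq> K \<and> orthonormal F (\<lambda>e. e) \<and> (\<forall>e\<in>F. P e)}"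
  have "\<exists>M\<in>\<A>. \<forall>X\<in>\<A>. M \<subseteq> X \<longrightarrow> X = M"
  proof (rule subset_Zorn_nonempty)
    show "\<A> \<noteq> {}"
      using E0 by (auto simp: \<A>_def)
    fix \<C>
    assume \<C>: "\<C> \<noteq> {}" "subset.chain \<A> \<C>"
    have "cinner e f = (if e = f then 1 else 0)" if "F \<in> \<C>" "e \<in> F" "G \<in> \<C>" "f \<in> G" for e f F G
    proof -
      have "F \<in> \<A>" "G \<in> \<A>" "F \<subseteq> G \<or> G \<subseteq> F"
        using \<C>(2) that by (auto simp: subset_chain_def)
      then show ?thesis
        using that by (auto simp: \<A>_def orthonormal_def)
    qed
    then have "orthonormal (\<Union>\<C>) (\<lambda>e. e)"
      unfolding orthonormal_def by blast
    moreover obtain F where "F \<in> \<C>"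
      using \<C>(1) by blast
    ultimately show "\<Union>\<C> \<in> \<A>"
      using \<C>(2) unfolding \<A>_def subset_chain_def by blast
  qed
  then obtain E where "E \<in> \<A>" and max: "\<forall>X\<in>\<A>. E \<subseteq> X \<longrightarrow> X = E"
    by blast
  then have E: "E0 \<subseteq> E" "E \<subseteq> K" "orthonormal E (\<lambda>e. e)" "\<And>e. e \<in> E \<Longrightarrow> P e"
    by (auto simp: \<A>_def)
  have "onb K E"
  proof (rule onbI[OF E(2,3)])
    fix x
    assume x: "x \<in> K" "\<And>e. e \<in> E \<Longrightarrow> cinner e x = 0"
    show "x = 0"
    proof (rule ccontr)
      assume "x \<noteq> 0"
      then obtain y where y: "y \<in> K" "norm y = 1" "\<forall>e\<in>E. cinner e y = 0" "P y"
        using step[OF E(2,3,4)] x by blast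
      have "\<forall>e\<in>E. cinner y e = 0"
        using y(3) by (metis cinner_commute complex_cnj_zero)
      moreover have "cinner y y = 1"
        using y(2) by (simp add: cinner_self)
      ultimately have "orthonormal (insert y E) (\<lambda>e. e)"
        using E(3) y(3) by (auto simp: orthonormal_def)
      then have "insert y E \<in> \<A>"
        using E y by (auto simp: \<A>_def)
      then have "y \<in> E"
        using max by blast
      then show False
        using y(3) \<open>cinner y y = 1\<close> by auto
    qed
  qed
  then show ?thesis
    using E by blast
qed


lemma onb_extend_orthonormal:
  assumes "E0 \<subseteq> K" "orthonormal E0 (\<lambda>e. e)"
  shows "\<exists>E. onb K E \<and> E0 \<subseteq> E"
proof -
  have "\<exists>E. onb K E \<and> E0 \<subseteq> E \<and> (\<forall>e\<in>E. True)"
  proof (rule onb_extend[OF assms])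
    fix F x
    assume "x \<in> K" "x \<noteq> 0" "\<And>e. e \<in> F \<Longrightarrow> cinner e x = 0"
    then show "\<exists>y\<in>K. norm y = 1 \<and> (\<forall>e\<in>F. cinner e y = 0) \<and> True"
      by (intro bexI[of _ "(1 / norm x) *\<^sub>R x"]) (auto simp: cinner_scaleR_right scaleR_mem)
  qed simp
  then show ?thesis
    by simp
qed

lemma onb_exists: "\<exists>E. onb K E"
  using onb_extend_orthonormal[of "{}"] by (auto simp: orthonormal_def)

section \<open>Self-adjoint and positive operators\<close>

lemma opD:
  assumes "A \<in> bounded_ops K"
  shows "x \<in> K \<Longrightarrow> A x \<in> K" "x \<notin> K \<Longrightarrow> A x = 0"
    "x \<in> K \<Longrightarrow> y \<in> K \<Longrightarrow> A (x + y) = A x + A y"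
    "x \<in> K \<Longrightarrow> A (c *\<^sub>C x) = c *\<^sub>C A x"
  using assms by (auto simp: bounded_ops_def)

lemma op_scaleR: "A \<in> bounded_ops K \<Longrightarrow> x \<in> K \<Longrightarrow> A (r *\<^sub>R x) = r *\<^sub>R A x"
  by (simp add: scaleR_scaleC opD)

lemma op_zero: "A \<in> bounded_ops K \<Longrightarrow> A 0 = 0"
  using op_scaleR[of A 0 0] by simp

lemma op_diff: "A \<in> bounded_ops K \<Longrightarrow> x \<in> K \<Longrightarrow> y \<in> K \<Longrightarrow> A (x - y) = A x - A y"
  using opD(3)[of A "x - y" y] by (simp add: diff_mem algebra_simps)

lemma op_sum:
  assumes "A \<in> bounded_ops K" "\<And>i. i \<in> I \<Longrightarrow> f i \<in> K"
  shows "A (\<Sum>i\<in>I. f i) = (\<Sum>i\<in>I. A (f i))"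
  using assms(2)
  by (induction I rule: infinite_finite_induct) (auto simp: op_zero[OF assms(1)] opD[OF assms(1)] sum_mem)

lemma op_mem: "A \<in> bounded_ops K \<Longrightarrow> A x \<in> K"
  by (cases "x \<in> K") (simp_all add: opD)

lemma op_bound:
  assumes "A \<in> bounded_ops K"
  obtains C where "0 < C" "\<And>x. x \<in> K \<Longrightarrow> norm (A x) \<le> C * norm x"
proof -
  obtain C where C: "\<forall>x\<in>K. norm (A x) \<le> C * norm x"
    using assms by (auto simp: bounded_ops_def)
  have "norm (A x) \<le> max C 1 * norm x" if "x \<in> K" for x
    using C that by (meson mult_right_mono max.cobounded1 norm_ge_zero order.trans)
  then show ?thesis
    using that[of "max C 1"] by auto
qed

lemma selfadjD:
  assumes "selfadj K A"
  shows "A \<in> bounded_ops K" "x \<in> K \<Longrightarrow> y \<in> K \<Longrightarrow> cinner (A x) y = cinner x (A y)"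
  using assms by (auto simp: selfadj_def)

text \<open>By self-adjointness the coordinate \<open>\<langle>e, A x\<rangle> = \<langle>A e, x\<rangle>\<close> is determined by \<open>A e\<close>.\<close>

lemma op_eqI:
  assumes E: "onb K E" and A: "selfadj K A" and B: "selfadj K B"
    and eq: "\<And>e. e \<in> E \<Longrightarrow> A e = B e"
  shows "A = B"
proof
  fix x
  show "A x = B x"
  proof (cases "x \<in> K")
    case True
    have "cinner e (A x) = cinner e (B x)" if "e \<in> E" for e
      using selfadjD(2)[OF A onb_mem[OF E that] True] selfadjD(2)[OF B onb_mem[OF E that] True]
        eq[OF that] by simp
    with True show ?thesis
      using selfadjD(1)[OF A] selfadjD(1)[OF B] by (intro onb_eqI[OF E]) (auto simp: opD)
  qed (use selfadjD[OF A] selfadjD[OF B] in \<open>simp add: opD\<close>)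
qed

lemma comp_bounded:
  assumes "A \<in> bounded_ops K" "B \<in> bounded_ops K"
  shows "A \<circ> B \<in> bounded_ops K"
proof -
  obtain C D where C: "0 < C" "\<And>x. x \<in> K \<Longrightarrow> norm (A x) \<le> C * norm x"
    and D: "0 < D" "\<And>x. x \<in> K \<Longrightarrow> norm (B x) \<le> D * norm x"
    using op_bound assms by metis
  have "norm (A (B x)) \<le> (C * D) * norm x" if "x \<in> K" for x
  proof -
    have "norm (A (B x)) \<le> C * norm (B x)"
      using C opD(1)[OF assms(2) that] by blast
    also have "\<dots> \<le> C * (D * norm x)"
      using C D that by (intro mult_left_mono) auto
    finally show ?thesis
      by (simp add: mult.assoc)
  qed
  then show ?thesis
    using opD[OF assms(1)] opD[OF assms(2)] op_zero[OF assms(1)] by (auto simp: bounded_ops_def)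
qed

lemma selfadj_diff:
  assumes A: "selfadj K A" and B: "selfadj K B"
  shows "selfadj K (\<lambda>x. A x - B x)"
proof -
  note bA = selfadjD(1)[OF A] and bB = selfadjD(1)[OF B]
  obtain C D where C: "0 < C" "\<And>x. x \<in> K \<Longrightarrow> norm (A x) \<le> C * norm x"
    and D: "0 < D" "\<And>x. x \<in> K \<Longrightarrow> norm (B x) \<le> D * norm x"
    using op_bound bA bB by metis
  have "norm (A x - B x) \<le> (C + D) * norm x" if "x \<in> K" for x
    using C(2)[OF that] D(2)[OF that] norm_triangle_ineq4[of "A x" "B x"] by (simp add: distrib_right)
  then have "(\<lambda>x. A x - B x) \<in> bounded_ops K"
    using opD[OF bA] opD[OF bB]
    by (auto simp: bounded_ops_def diff_mem complex_vector.scale_right_diff_distrib)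
  then show ?thesis
    using selfadjD(2)[OF A] selfadjD(2)[OF B]
    by (auto simp: selfadj_def cinner_diff_left cinner_diff_right)
qed

lemma selfadj_Im_zero: "selfadj K A \<Longrightarrow> x \<in> K \<Longrightarrow> Im (cinner x (A x)) = 0"
  by (metis selfadjD(2) cinner_commute cnj.simps(2) neg_equal_zero)

lemma selfadj_cinner_real: "selfadj K A \<Longrightarrow> x \<in> K \<Longrightarrow> cinner x (A x) = complex_of_real (quad A x)"
  by (simp add: complex_eq_iff selfadj_Im_zero)

text \<open>Polarization: a complex quadratic form with real values is Hermitian.\<close>

lemma positive_selfadj:
  assumes "positive_op K A"
  shows "selfadj K A"
proof -
  have A: "A \<in> bounded_ops K" and real: "\<And>x. x \<in> K \<Longrightarrow> Im (cinner x (A x)) = 0"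
    using assms by (auto simp: positive_op_def complex_nonneg_Reals_iff)
  have "cinner (A x) y = cinner x (A y)" if "x \<in> K" "y \<in> K" for x y
  proof -
    have "Im (cinner x (A y)) + Im (cinner y (A x)) = 0"
      using real[of "x + y"] real[of x] real[of y] that
      by (simp add: add_mem opD[OF A] cinner_add_left cinner_add_right)
    moreover have "Re (cinner x (A y)) - Re (cinner y (A x)) = 0"
      using real[of "x + \<i> *\<^sub>C y"] real[of x] real[of y] that
      by (simp add: add_mem scaleC_mem opD[OF A] cinner_add_left cinner_add_right
          cinner_scaleC_left cinner_scaleC_right)
    ultimately have "cinner x (A y) = cnj (cinner y (A x))"
      by (simp add: complex_eq_iff)
    then show ?thesis
      by (metis cinner_commute)
  qed
  then show ?thesis
    using A by (simp add: selfadj_def)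
qed

lemma positive_opI:
  assumes "selfadj K A" "\<And>x. x \<in> K \<Longrightarrow> 0 \<le> quad A x"
  shows "positive_op K A"
  using assms selfadjD(1)[OF assms(1)] selfadj_Im_zero[OF assms(1)]
  by (auto simp: positive_op_def complex_nonneg_Reals_iff)

lemma positive_op_nonneg: "positive_op K A \<Longrightarrow> x \<in> K \<Longrightarrow> 0 \<le> quad A x"
  by (auto simp: positive_op_def complex_nonneg_Reals_iff)

lemma positive_op_bounded: "positive_op K A \<Longrightarrow> A \<in> bounded_ops K"
  by (simp add: positive_op_def)

lemma positive_cauchy_schwarz:
  assumes "positive_op K A" "x \<in> K" "y \<in> K"
  shows "(cmod (cinner x (A y)))\<^sup>2 \<le> quad A x * quad A y"
proof -
  note bA = positive_op_bounded[OF assms(1)] and sA = positive_selfadj[OF assms(1)]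
  define z where "z = cinner x (A y)"
  have zc: "cinner y (A x) = cnj z"
    using selfadjD(2)[OF sA assms(3,2)] unfolding z_def by (metis cinner_commute)
  have ineq: "0 \<le> quad A x + 2 * t * (cmod z)\<^sup>2 + t\<^sup>2 * (cmod z)\<^sup>2 * quad A y" for t :: real
  proof -
    define c where "c = complex_of_real t * cnj z"
    have "0 \<le> quad A (x + c *\<^sub>C y)"
      using assms by (intro positive_op_nonneg) (auto intro: add_mem scaleC_mem)
    also have "cinner (x + c *\<^sub>C y) (A (x + c *\<^sub>C y))
        = cinner x (A x) + c * z + cnj c * cnj z + (cnj c * c) * cinner y (A y)"
      using assms by (simp add: opD[OF bA] scaleC_mem cinner_add_left cinner_add_right
          cinner_scaleC_left cinner_scaleC_right zc algebra_simps flip: z_def)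
    also have "c * z = complex_of_real (t * (cmod z)\<^sup>2)"
      by (simp add: c_def mult_cnj_cmod mult.assoc)
    also have "cnj c * cnj z = complex_of_real (t * (cmod z)\<^sup>2)"
      by (simp add: c_def mult_cnj_cmod mult.assoc)
    also have "cnj c * c = complex_of_real (t\<^sup>2 * (cmod z)\<^sup>2)"
      unfolding mult_cnj_cmod by (simp add: c_def norm_mult power_mult_distrib)
    finally show ?thesis
      by simp
  qed
  have y0: "0 \<le> quad A y" and x0: "0 \<le> quad A x"
    using assms by (auto intro: positive_op_nonneg)
  show ?thesis
  proof (cases "quad A y = 0")
    case True
    have "z = 0"
    proof (rule ccontr)
      assume "z \<noteq> 0"
      then have "2 * (- (quad A x + 1) / (2 * (cmod z)\<^sup>2)) * (cmod z)\<^sup>2 = - (quad A x + 1)"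
        by simp
      then show False
        using ineq[of "- (quad A x + 1) / (2 * (cmod z)\<^sup>2)"] True by simp
    qed
    then show ?thesis
      using x0 y0 by (simp flip: z_def)
  next
    case False
    define b where "b = quad A y"
    have b: "b > 0"
      using False y0 by (simp add: b_def)
    have "0 \<le> quad A x + 2 * (- 1 / b) * (cmod z)\<^sup>2 + (- 1 / b)\<^sup>2 * (cmod z)\<^sup>2 * b"
      using ineq[of "- 1 / b"] by (simp add: b_def)
    also have "\<dots> = quad A x - (cmod z)\<^sup>2 / b"
      using b by (simp add: power2_eq_square field_simps)
    finally show ?thesis
      using b by (simp add: field_simps flip: b_def z_def)
  qed
qed

text \<open>The Cauchy--Schwarz inequality of the form of \<open>A\<close>, for the vectors \<open>A x\<close> and \<open>x\<close>.\<close>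

lemma positive_op_norm_le:
  assumes A: "positive_op K A" and C: "\<And>x. x \<in> K \<Longrightarrow> norm (A x) \<le> C * norm x" and x: "x \<in> K"
  shows "(norm (A x))\<^sup>2 \<le> C * quad A x"
proof (cases "A x = 0")
  case False
  note bA = positive_op_bounded[OF A]
  have Ax: "A x \<in> K"
    using x by (rule opD(1)[OF bA])
  have "(norm (A x))\<^sup>2 * (norm (A x))\<^sup>2 = (cmod (cinner (A x) (A x)))\<^sup>2"
    by (simp add: cinner_self power2_eq_square norm_mult)
  also have "\<dots> \<le> quad A (A x) * quad A x"
    by (rule positive_cauchy_schwarz[OF A Ax x])
  also have "\<dots> \<le> (C * (norm (A x))\<^sup>2) * quad A x"
  proof (rule mult_right_mono)
    have "quad A (A x) \<le> norm (A x) * norm (A (A x))"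
      using cmod_cinner_le complex_Re_le_cmod order.trans by blast
    also have "\<dots> \<le> norm (A x) * (C * norm (A x))"
      using C[OF Ax] by (intro mult_left_mono) auto
    finally show "quad A (A x) \<le> C * (norm (A x))\<^sup>2"
      by (simp add: power2_eq_square mult_ac)
  qed (use positive_op_nonneg[OF A x] in simp)
  finally have "(norm (A x))\<^sup>2 * (norm (A x))\<^sup>2 \<le> (norm (A x))\<^sup>2 * (C * quad A x)"
    by (simp add: mult_ac)
  then show ?thesis
    by (rule mult_left_le_imp_le) (use False in simp)
next
  case True
  then show ?thesis
    by simp
qed

text \<open>Unit vectors on which a self-adjoint operator \<open>D\<close> nearly attains its norm \<open>\<mu>\<close> are
  approximate eigenvectors of \<open>D\<^sup>2\<close>, since
  \<open>\<parallel>D\<^sup>2x - \<mu>\<^sup>2x\<parallel>\<^sup>2 \<le> \<mu>\<^sup>2 (\<mu>\<^sup>2 - \<parallel>Dx\<parallel>\<^sup>2)\<close>. Both the uniqueness of positive square roots and the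
  existence of eigenvectors of compact operators rest on this.\<close>

lemma approximate_eigenvectors:
  assumes D: "selfadj K D" and M: "csubspace M" "M \<subseteq> K" "\<And>x. x \<in> M \<Longrightarrow> D x \<in> M"
  obtains \<mu> x where "0 \<le> \<mu>" "\<And>y. y \<in> M \<Longrightarrow> norm (D y) \<le> \<mu> * norm y"
    "\<And>n::nat. x n \<in> M" "\<And>n. norm (x n) \<le> 1" "(\<lambda>n. norm (D (x n))) \<longlonglongrightarrow> \<mu>"
    "(\<lambda>n. D (D (x n)) - \<mu>\<^sup>2 *\<^sub>R x n) \<longlonglongrightarrow> 0"
proof -
  note bD = selfadjD(1)[OF D]
  have scaleR_M: "r *\<^sub>R y \<in> M" if "y \<in> M" for r y
    using complex_vector.subspace_scale[OF M(1) that] by (simp add: scaleR_scaleC)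
  obtain C where C: "0 < C" "\<And>x. x \<in> K \<Longrightarrow> norm (D x) \<le> C * norm x"
    using op_bound[OF bD] by metis
  define S where "S = {norm (D x) | x. x \<in> M \<and> norm x \<le> 1}"
  define \<mu> where "\<mu> = Sup S"
  have "norm (D x) \<le> C" if "x \<in> M" "norm x \<le> 1" for x
  proof -
    have "norm (D x) \<le> C * norm x"
      using C(2) that(1) M(2) by blast
    also have "\<dots> \<le> C * 1"
      using C(1) that(2) by (intro mult_left_mono) auto
    finally show ?thesis
      by simp
  qed
  then have bdd: "bdd_above S"
    by (auto simp: S_def intro!: bdd_aboveI[of _ C])
  have "0 \<in> M"
    using M(1) by (rule complex_vector.subspace_0)
  then have "0 \<in> S"
    using op_zero[OF bD] by (auto simp: S_def intro!: exI[of _ 0])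
  have \<mu>0: "0 \<le> \<mu>"
    unfolding \<mu>_def by (rule cSup_upper[OF \<open>0 \<in> S\<close> bdd])
  have \<mu>: "norm (D y) \<le> \<mu> * norm y" if y: "y \<in> M" for y
  proof (cases "y = 0")
    case False
    have "norm (D ((1 / norm y) *\<^sub>R y)) \<in> S"
      using False scaleR_M[OF y] by (auto simp: S_def intro!: exI[of _ "(1 / norm y) *\<^sub>R y"])
    then have "norm (D ((1 / norm y) *\<^sub>R y)) \<le> \<mu>"
      unfolding \<mu>_def using bdd by (rule cSup_upper)
    moreover have "y \<in> K"
      using y M(2) by blast
    ultimately show ?thesis
      using False by (simp add: op_scaleR[OF bD] field_simps)
  qed (simp add: op_zero[OF bD])
  have "\<exists>x. x \<in> M \<and> norm x \<le> 1 \<and> \<mu> - 1 / real (Suc n) < norm (D x)" for n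
  proof -
    have "\<mu> - 1 / real (Suc n) < Sup S"
      by (simp add: \<mu>_def)
    then show ?thesis
      using \<open>0 \<in> S\<close> bdd by (subst (asm) less_cSup_iff) (auto simp: S_def)
  qed
  then obtain x where x: "\<And>n. x n \<in> M" "\<And>n. norm (x n) \<le> 1"
    "\<And>n. \<mu> - 1 / real (Suc n) < norm (D (x n))"
    by metis
  have xK: "x n \<in> K" for n
    using x(1) M(2) by blast
  have le: "norm (D (x n)) \<le> \<mu>" for n
  proof -
    have "norm (D (x n)) \<le> \<mu> * norm (x n)"
      using \<mu> x(1) by blast
    also have "\<dots> \<le> \<mu> * 1"
      using x(2) \<mu>0 by (intro mult_left_mono)
    finally show ?thesis
      by simp
  qed
  have lim: "(\<lambda>n. norm (D (x n))) \<longlonglongrightarrow> \<mu>"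
  proof (rule tendsto_sandwich[OF _ _ _ tendsto_const])
    show "(\<lambda>n. \<mu> - 1 / real (Suc n)) \<longlonglongrightarrow> \<mu>"
      using tendsto_diff[OF tendsto_const LIMSEQ_inverse_real_of_nat, of \<mu>] by (simp add: inverse_eq_divide)
  qed (use x(3) le in \<open>auto intro!: always_eventually less_imp_le\<close>)
  have bound: "(norm (D (D (x n)) - \<mu>\<^sup>2 *\<^sub>R x n))\<^sup>2 \<le> \<mu>\<^sup>2 * (\<mu>\<^sup>2 - (norm (D (x n)))\<^sup>2)" for n
  proof -
    have "cinner (D (D (x n))) (x n) = cinner (D (x n)) (D (x n))"
      using selfadjD(2)[OF D opD(1)[OF bD xK[of n]] xK[of n]] .
    then have inner: "inner (D (D (x n))) (x n) = (norm (D (x n)))\<^sup>2"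
      by (simp add: cinner_self flip: Re_cinner of_real_power)
    have "norm (D (D (x n))) \<le> \<mu> * norm (D (x n))"
      using \<mu> M(3) x(1) by blast
    then have 1: "(norm (D (D (x n))))\<^sup>2 \<le> \<mu>\<^sup>2 * (norm (D (x n)))\<^sup>2"
      by (metis norm_ge_zero power_mono power_mult_distrib)
    have 2: "(norm (\<mu>\<^sup>2 *\<^sub>R x n))\<^sup>2 \<le> \<mu>\<^sup>2 * \<mu>\<^sup>2"
      using x(2)[of n] \<mu>0 mult_left_mono[of "(norm (x n))\<^sup>2" 1 "\<mu>\<^sup>2 * \<mu>\<^sup>2"]
      by (simp add: power2_eq_square mult_le_one mult_ac)
    show ?thesis
      unfolding norm_diff_squared using 1 2 by (simp add: inner algebra_simps)
  qed
  have "(\<lambda>n. (norm (D (D (x n)) - \<mu>\<^sup>2 *\<^sub>R x n))\<^sup>2) \<longlonglongrightarrow> 0"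
  proof (rule tendsto_sandwich[OF _ _ tendsto_const])
    have "(\<lambda>n. \<mu>\<^sup>2 * (\<mu>\<^sup>2 - (norm (D (x n)))\<^sup>2)) \<longlonglongrightarrow> \<mu>\<^sup>2 * (\<mu>\<^sup>2 - \<mu>\<^sup>2)"
      by (intro tendsto_intros lim)
    then show "(\<lambda>n. \<mu>\<^sup>2 * (\<mu>\<^sup>2 - (norm (D (x n)))\<^sup>2)) \<longlonglongrightarrow> 0"
      by simp
  qed (use bound in auto)
  then have "(\<lambda>n. sqrt ((norm (D (D (x n)) - \<mu>\<^sup>2 *\<^sub>R x n))\<^sup>2)) \<longlonglongrightarrow> sqrt 0"
    by (rule tendsto_real_sqrt)
  then have "(\<lambda>n. D (D (x n)) - \<mu>\<^sup>2 *\<^sub>R x n) \<longlonglongrightarrow> 0"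
    by (simp add: tendsto_norm_zero_iff)
  then show ?thesis
    using that \<mu>0 \<mu> x(1,2) lim by blast
qed

text \<open>If \<open>B\<^sup>2 = C\<^sup>2\<close> and \<open>D = B - C\<close>, then \<open>D B = - C D\<close> and hence \<open>D\<^sup>2 B = - D C D \<le> 0\<close>, and likewise
  \<open>D\<^sup>2 C \<le> 0\<close>. On approximate eigenvectors of \<open>D\<^sup>2\<close> with eigenvalue \<open>\<mu>\<^sup>2\<close> this forces both
  positive operators, and so \<open>D\<close>, to be small, whence \<open>\<mu> = 0\<close>.\<close>

lemma positive_sqrt_unique:
  assumes B: "positive_op K B" and C: "positive_op K C" and eq: "B \<circ> B = C \<circ> C"
  shows "B = C"
proof -
  note sB = positive_selfadj[OF B] and sC = positive_selfadj[OF C]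
  note bB = selfadjD(1)[OF sB] and bC = selfadjD(1)[OF sC]
  define D where "D = (\<lambda>x. B x - C x)"
  have sD: "selfadj K D"
    unfolding D_def by (rule selfadj_diff[OF sB sC])
  note bD = selfadjD(1)[OF sD]
  have BB: "B (B x) = C (C x)" for x
    using fun_cong[OF eq, of x] by simp
  have DB: "D (B x) = - C (D x)" and DC: "D (C x) = - B (D x)" if "x \<in> K" for x
    unfolding D_def op_diff[OF bC opD(1)[OF bB that] opD(1)[OF bC that]]
      op_diff[OF bB opD(1)[OF bB that] opD(1)[OF bC that]] by (simp_all add: BB)
  obtain \<mu> x where \<mu>: "0 \<le> \<mu>" "\<And>y. y \<in> K \<Longrightarrow> norm (D y) \<le> \<mu> * norm y"
    and x: "\<And>n::nat. x n \<in> K" "\<And>n. norm (x n) \<le> 1"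
    and lim: "(\<lambda>n. norm (D (x n))) \<longlonglongrightarrow> \<mu>" "(\<lambda>n. D (D (x n)) - \<mu>\<^sup>2 *\<^sub>R x n) \<longlonglongrightarrow> 0"
    using approximate_eigenvectors[OF sD subspace order.refl opD(1)[OF bD]] by blast
  define r where "r n = D (D (x n)) - \<mu>\<^sup>2 *\<^sub>R x n" for n
  have key: "\<mu>\<^sup>2 * (norm (P (x n)))\<^sup>2 \<le> b\<^sup>2 * norm (r n)"
    if P: "positive_op K P" and Q: "positive_op K Q" and DP: "\<And>x. x \<in> K \<Longrightarrow> D (P x) = - Q (D x)"
      and b: "0 < b" "\<And>x. x \<in> K \<Longrightarrow> norm (P x) \<le> b * norm x" for P Q b n
  proof -
    note sP = positive_selfadj[OF P]
    note bP = selfadjD(1)[OF sP]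
    have Px: "P (x n) \<in> K" and Dx: "D (x n) \<in> K"
      using x(1) opD(1)[OF bP] opD(1)[OF bD] by auto
    have "cinner (D (D (x n))) (P (x n)) = cinner (D (x n)) (D (P (x n)))"
      using selfadjD(2)[OF sD Dx Px] .
    also have "\<dots> = - cinner (D (x n)) (Q (D (x n)))"
      using DP[OF x(1)] by (simp add: cinner_minus_right)
    finally have "Re (cinner (D (D (x n))) (P (x n))) \<le> 0"
      using positive_op_nonneg[OF Q Dx] by simp
    moreover have "D (D (x n)) = r n + \<mu>\<^sup>2 *\<^sub>R x n"
      by (simp add: r_def)
    ultimately have "\<mu>\<^sup>2 * quad P (x n) \<le> - Re (cinner (r n) (P (x n)))"
      by (simp add: cinner_add_left cinner_scaleR_left)
    also have "\<dots> \<le> cmod (cinner (r n) (P (x n)))"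
      using abs_Re_le_cmod[of "cinner (r n) (P (x n))"] by linarith
    also have "\<dots> \<le> norm (r n) * norm (P (x n))"
      by (rule cmod_cinner_le)
    also have "\<dots> \<le> norm (r n) * b"
    proof (rule mult_left_mono)
      have "norm (P (x n)) \<le> b * norm (x n)"
        using b(2) x(1) by blast
      also have "\<dots> \<le> b * 1"
        using b(1) x(2) by (intro mult_left_mono) auto
      finally show "norm (P (x n)) \<le> b"
        by simp
    qed simp
    finally have 1: "\<mu>\<^sup>2 * quad P (x n) \<le> norm (r n) * b" .
    have "\<mu>\<^sup>2 * (norm (P (x n)))\<^sup>2 \<le> \<mu>\<^sup>2 * (b * quad P (x n))"
      using positive_op_norm_le[OF P b(2) x(1)] by (intro mult_left_mono) auto
    also have "\<dots> \<le> b * (norm (r n) * b)"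
      using mult_left_mono[OF 1, of b] b(1) by (simp add: mult_ac)
    finally show ?thesis
      by (simp add: power2_eq_square mult_ac)
  qed
  obtain b where b: "0 < b" "\<And>x. x \<in> K \<Longrightarrow> norm (B x) \<le> b * norm x"
    using op_bound[OF bB] by metis
  obtain c where c: "0 < c" "\<And>x. x \<in> K \<Longrightarrow> norm (C x) \<le> c * norm x"
    using op_bound[OF bC] by metis
  have "\<mu>\<^sup>2 * (norm (D (x n)))\<^sup>2 \<le> 2 * (b\<^sup>2 + c\<^sup>2) * norm (r n)" for n
  proof -
    have "(norm (D (x n)))\<^sup>2 \<le> (norm (B (x n)) + norm (C (x n)))\<^sup>2"
      unfolding D_def by (intro power_mono norm_triangle_ineq4) simp
    also have "\<dots> \<le> 2 * (norm (B (x n)))\<^sup>2 + 2 * (norm (C (x n)))\<^sup>2"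
      using sum_squares_bound[of "norm (B (x n))" "norm (C (x n))"] by (simp add: power2_sum)
    finally have "\<mu>\<^sup>2 * (norm (D (x n)))\<^sup>2 \<le> \<mu>\<^sup>2 * (2 * (norm (B (x n)))\<^sup>2 + 2 * (norm (C (x n)))\<^sup>2)"
      by (rule mult_left_mono) simp
    also have "\<dots> \<le> 2 * (b\<^sup>2 * norm (r n)) + 2 * (c\<^sup>2 * norm (r n))"
      using key[OF B C DB b, of n] key[OF C B DC c, of n] by (simp add: distrib_left)
    finally show ?thesis
      by (simp add: algebra_simps)
  qed
  moreover have "(\<lambda>n. \<mu>\<^sup>2 * (norm (D (x n)))\<^sup>2) \<longlonglongrightarrow> \<mu>\<^sup>2 * \<mu>\<^sup>2"
    by (intro tendsto_intros lim)
  moreover have "(\<lambda>n. 2 * (b\<^sup>2 + c\<^sup>2) * norm (r n)) \<longlonglongrightarrow> 2 * (b\<^sup>2 + c\<^sup>2) * 0"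
    using tendsto_norm_zero[OF lim(2)] by (intro tendsto_intros) (simp add: r_def)
  ultimately have "\<mu>\<^sup>2 * \<mu>\<^sup>2 \<le> 2 * (b\<^sup>2 + c\<^sup>2) * 0"
    by (intro tendsto_le[OF trivial_limit_sequentially]) auto
  then have "\<mu> = 0"
    by (simp add: mult_le_0_iff)
  then have "D y = 0" if "y \<in> K" for y
    using \<mu>(2)[OF that] by simp
  then show ?thesis
    unfolding D_def by (intro ext) (metis eq_iff_diff_eq_0 opD(2)[OF bB] opD(2)[OF bC])
qed

text \<open>Since \<^const>\<open>op_sqrt\<close>, \<^const>\<open>op_adj\<close> and \<^const>\<open>op_abs\<close> are definite descriptions, they are evaluated by
  exhibiting an operator with the defining property.\<close>

lemma op_sqrt_eqI: "positive_op K B \<Longrightarrow> B \<circ> B = A \<Longrightarrow> op_sqrt K A = B"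
  unfolding op_sqrt_def by (rule the_equality) (auto intro: positive_sqrt_unique)

lemma op_adj_selfadj:
  assumes A: "selfadj K A"
  shows "op_adj K A = A"
  unfolding op_adj_def
proof (rule the_equality)
  show "A \<in> bounded_ops K \<and> (\<forall>x\<in>K. \<forall>y\<in>K. cinner (A x) y = cinner x (A y))"
    using A by (simp add: selfadj_def)
  fix B
  assume B: "B \<in> bounded_ops K \<and> (\<forall>x\<in>K. \<forall>y\<in>K. cinner (B x) y = cinner x (A y))"
  show "B = A"
  proof
    fix x
    show "B x = A x"
    proof (cases "x \<in> K")
      case True
      have "B x - A x \<in> K"
        using B selfadjD(1)[OF A] op_mem diff_mem by blast
      then have "cinner (B x - A x) (B x - A x) = 0"
        using B True selfadjD(2)[OF A] by (subst cinner_diff_left) auto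
      then show ?thesis
        by (simp add: cinner_self)
    qed (use B selfadjD(1)[OF A] in \<open>simp add: opD\<close>)
  qed
qed

lemma op_abs_eqI: "selfadj K X \<Longrightarrow> positive_op K B \<Longrightarrow> B \<circ> B = X \<circ> X \<Longrightarrow> op_abs K X = B"
  by (simp add: op_abs_def op_adj_selfadj op_sqrt_eqI)

end

section \<open>The spectral theorem for compact self-adjoint operators\<close>

text \<open>Sequential compactness is used because it passes to differences at once.\<close>

definition compact_op :: "'a::chilbert_space set \<Rightarrow> ('a \<Rightarrow> 'a) \<Rightarrow> bool" where
  "compact_op K A \<longleftrightarrow> (\<forall>x :: nat \<Rightarrow> 'a. (\<forall>n. x n \<in> K \<and> norm (x n) \<le> 1) \<longrightarrow>
     (\<exists>r l. strict_mono r \<and> (\<lambda>n. A (x (r n))) \<longlonglongrightarrow> l))"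

text \<open>The sum is required for all bases, so that the choice of basis in \<^const>\<open>op_trace\<close> is irrelevant.
  Lemma \<open>has_traceI\<close> reduces the condition to a single basis.\<close>

definition has_trace :: "'a::chilbert_space set \<Rightarrow> ('a \<Rightarrow> 'a) \<Rightarrow> real \<Rightarrow> bool" where
  "has_trace K A t \<longleftrightarrow> (\<forall>E. onb K E \<longrightarrow> ((\<lambda>e. quad A e) has_sum t) E)"

lemma compact_op_diff:
  assumes A: "compact_op K A" and B: "compact_op K B"
  shows "compact_op K (\<lambda>x. A x - B x)"
  unfolding compact_op_def
proof (intro allI impI)
  fix x :: "nat \<Rightarrow> 'a"
  assume x: "\<forall>n. x n \<in> K \<and> norm (x n) \<le> 1"
  then obtain r l where r: "strict_mono r" and l: "(\<lambda>n. A (x (r n))) \<longlonglongrightarrow> l"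
    using A unfolding compact_op_def by blast
  have "\<forall>n. (x \<circ> r) n \<in> K \<and> norm ((x \<circ> r) n) \<le> 1"
    using x by simp
  then obtain s m where s: "strict_mono s" and m: "(\<lambda>n. B ((x \<circ> r) (s n))) \<longlonglongrightarrow> m"
    using B unfolding compact_op_def by blast
  have "(\<lambda>n. A (x (r (s n)))) \<longlonglongrightarrow> l"
    using LIMSEQ_subseq_LIMSEQ[OF l s] by (simp add: o_def)
  then have "(\<lambda>n. A (x ((r \<circ> s) n)) - B (x ((r \<circ> s) n))) \<longlonglongrightarrow> l - m"
    using tendsto_diff m by force
  then show "\<exists>r l. strict_mono r \<and> (\<lambda>n. A (x (r n)) - B (x (r n))) \<longlonglongrightarrow> l"
    using strict_mono_o[OF r s] by blast
qed

lemma bounded_linear_scaleC_left: "bounded_linear (\<lambda>c. c *\<^sub>C (v :: 'a :: complex_inner))"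
  by (rule bounded_linear_intro[of _ "norm v"])
     (simp_all add: scaleC_add_left scaleR_scaleC scaleC_scaleC norm_scaleC scaleR_conv_of_real)

lemma compact_combinations:
  fixes v :: "'i \<Rightarrow> 'a::complex_inner"
  assumes "finite F"
  shows "compact {\<Sum>f\<in>F. c f *\<^sub>C v f | c. \<forall>f\<in>F. cmod (c f) \<le> 1}"
  using assms
proof (induction F rule: finite_induct)
  case (insert f F)
  let ?S = "{\<Sum>f\<in>F. c f *\<^sub>C v f | c. \<forall>f\<in>F. cmod (c f) \<le> 1}"
  let ?T = "(\<lambda>c. c *\<^sub>C v f) ` cball 0 1"
  have "compact ?T"
    by (intro compact_continuous_image linear_continuous_on bounded_linear_scaleC_left compact_cball)
  then have "compact {x + y | x y. x \<in> ?T \<and> y \<in> ?S}"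
    using insert.IH by (rule compact_sums)
  also have "{x + y | x y. x \<in> ?T \<and> y \<in> ?S}
      = {\<Sum>f\<in>insert f F. c f *\<^sub>C v f | c. \<forall>f\<in>insert f F. cmod (c f) \<le> 1}" (is "?L = ?R")
  proof (intro set_eqI iffI)
    fix z
    assume "z \<in> ?L"
    then obtain a c where z: "z = a *\<^sub>C v f + (\<Sum>f\<in>F. c f *\<^sub>C v f)" "cmod a \<le> 1" "\<forall>f\<in>F. cmod (c f) \<le> 1"
      by auto
    have "(\<Sum>g\<in>insert f F. (c(f := a)) g *\<^sub>C v g) = z"
      using insert.hyps z(1) by (simp, intro sum.cong) auto
    then show "z \<in> ?R"
      using z(2,3) by (intro CollectI exI[of _ "c(f := a)"]) auto
  next
    fix z
    assume "z \<in> ?R"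
    then obtain c where c: "z = (\<Sum>f\<in>insert f F. c f *\<^sub>C v f)" "\<forall>f\<in>insert f F. cmod (c f) \<le> 1"
      by blast
    have "z = c f *\<^sub>C v f + (\<Sum>f\<in>F. c f *\<^sub>C v f)"
      using c(1) insert.hyps by simp
    then show "z \<in> ?L"
      using c(2) by (intro CollectI exI[of _ "c f *\<^sub>C v f"] exI[of _ "\<Sum>f\<in>F. c f *\<^sub>C v f"]) auto
  qed
  finally show ?case .
qed simp

context hilbert_subspace
begin

text \<open>In \<open>\<parallel>A x\<parallel>\<^sup>2 = \<Sum>\<^sub>e \<langle>A x, A e\<rangle> \<langle>e, x\<rangle>\<close> only the basis vectors outside \<open>F\<close> contribute if \<open>x\<close> is orthogonal
  to \<open>F\<close>, and there \<open>\<Sum>\<^sub>e \<parallel>A e\<parallel>\<^sup>2\<close> is small.\<close>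

lemma hilbert_schmidt_tail:
  assumes A: "selfadj K A" and E: "onb K E"
    and summable: "(\<lambda>e. (norm (A e))\<^sup>2) summable_on E" and \<delta>: "0 < \<delta>"
  shows "\<exists>F. finite F \<and> F \<subseteq> E \<and> (\<forall>x\<in>K. (\<forall>f\<in>F. cinner f x = 0) \<longrightarrow> norm (A x) \<le> \<delta> * norm x)"
proof -
  note bA = selfadjD(1)[OF A]
  have "0 < \<delta>\<^sup>2"
    using \<delta> by simp
  from finite_tail_small[OF summable this zero_le_power2] obtain F
    where F: "finite F" "F \<subseteq> E" and tail: "\<forall>G. finite G \<and> G \<subseteq> E - F \<longrightarrow> (\<Sum>e\<in>G. (norm (A e))\<^sup>2) \<le> \<delta>\<^sup>2"
    by auto
  have "norm (A x) \<le> \<delta> * norm x" if x: "x \<in> K" and ortho: "\<forall>f\<in>F. cinner f x = 0" for x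
  proof -
    have "((\<lambda>e. Re (cinner (A (A x)) e * cinner e x)) has_sum (norm (A x))\<^sup>2) E"
      using has_sum_Re[OF onb_parseval[OF E x, of "A (A x)"]] selfadjD(2)[OF A op_mem[OF bA] x]
      by (simp add: cinner_self del: of_real_power)
    then have "(norm (A x))\<^sup>2 \<le> norm (A x) * (\<delta> * norm x)"
    proof (rule has_sum_le_finite_sums)
      fix G
      assume G: "finite G" "G \<subseteq> E"
      have "(\<Sum>e\<in>G. Re (cinner (A (A x)) e * cinner e x)) = (\<Sum>e\<in>G - F. Re (cinner (A (A x)) e * cinner e x))"
        using G ortho by (intro sum.mono_neutral_right) auto
      also have "\<dots> \<le> (\<Sum>e\<in>G - F. norm (A x) * (norm (A e) * cmod (cinner e x)))"
      proof (intro sum_mono)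
        fix e
        assume "e \<in> G - F"
        then have "cinner (A (A x)) e = cinner (A x) (A e)"
          using G by (intro selfadjD(2)[OF A op_mem[OF bA] onb_mem[OF E]]) auto
        then have "Re (cinner (A (A x)) e * cinner e x) \<le> cmod (cinner (A x) (A e)) * cmod (cinner e x)"
          by (metis complex_Re_le_cmod norm_mult)
        also have "\<dots> \<le> (norm (A x) * norm (A e)) * cmod (cinner e x)"
          by (intro mult_right_mono cmod_cinner_le) simp
        finally show "Re (cinner (A (A x)) e * cinner e x) \<le> norm (A x) * (norm (A e) * cmod (cinner e x))"
          by (simp add: mult.assoc)
      qed
      also have "\<dots> \<le> norm (A x) * (sqrt (\<Sum>e\<in>G - F. (norm (A e))\<^sup>2) * sqrt (\<Sum>e\<in>G - F. (cmod (cinner e x))\<^sup>2))"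
        unfolding sum_distrib_left[symmetric] by (intro mult_left_mono sum_mult_le_sqrt) simp
      also have "\<dots> \<le> norm (A x) * (sqrt (\<delta>\<^sup>2) * sqrt ((norm x)\<^sup>2))"
      proof (intro mult_left_mono mult_mono real_sqrt_le_mono)
        show "(\<Sum>e\<in>G - F. (norm (A e))\<^sup>2) \<le> \<delta>\<^sup>2"
          using tail G by (metis Diff_mono finite_Diff order_refl)
        show "(\<Sum>e\<in>G - F. (cmod (cinner e x))\<^sup>2) \<le> (norm x)\<^sup>2"
          using G by (intro bessel_finite orthonormal_subset[OF onb_orthonormal[OF E]]) auto
      qed (auto simp: sum_nonneg)
      finally show "(\<Sum>e\<in>G. Re (cinner (A (A x)) e * cinner e x)) \<le> norm (A x) * (\<delta> * norm x)"
        using \<delta> by simp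
    qed
    then show ?thesis
      using \<delta> by (cases "A x = 0") (simp_all add: power2_eq_square)
  qed
  then show ?thesis
    using F by blast
qed

text \<open>Since \<open>\<parallel>A e\<parallel>\<^sup>2 \<le> C \<langle>e, A e\<rangle>\<close>, the operator is Hilbert--Schmidt. Up to an error \<open>\<epsilon>\<close> the image of the unit
  ball lies in the compact set of combinations of the \<open>A f\<close>, \<open>f \<in> F\<close>, with coefficients at most \<open>1\<close>;
  hence it is totally bounded.\<close>

lemma summable_diagonal_compact:
  assumes A: "positive_op K A" and E: "onb K E"
    and summable: "(\<lambda>e. quad A e) summable_on E"
  shows "compact_op K A"
proof -
  note bA = positive_op_bounded[OF A]
  obtain C where C: "\<And>x. x \<in> K \<Longrightarrow> norm (A x) \<le> C * norm x"
    using op_bound[OF bA] by metis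
  have square_summable: "(\<lambda>e. (norm (A e))\<^sup>2) summable_on E"
    using summable_on_cmult_right[OF summable, of C]
    by (rule summable_on_comparison_test) (auto intro: positive_op_norm_le[OF A C] onb_mem[OF E])
  define S where "S = A ` {x \<in> K. norm x \<le> 1}"
  have "\<exists>k. finite k \<and> closure S \<subseteq> (\<Union>x\<in>k. ball x \<epsilon>)" if \<epsilon>: "0 < \<epsilon>" for \<epsilon>
  proof -
    have "0 < \<epsilon> / 3"
      using \<epsilon> by simp
    from hilbert_schmidt_tail[OF positive_selfadj[OF A] E square_summable this] obtain F
      where F: "finite F" "F \<subseteq> E"
        and tail: "\<forall>x\<in>K. (\<forall>f\<in>F. cinner f x = 0) \<longrightarrow> norm (A x) \<le> \<epsilon> / 3 * norm x"
      by blast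
    let ?C = "{\<Sum>f\<in>F. c f *\<^sub>C A f | c. \<forall>f\<in>F. cmod (c f) \<le> 1}"
    have "\<forall>e>0. \<exists>k. finite k \<and> ?C \<subseteq> (\<Union>x\<in>k. ball x e)"
      using compact_combinations[OF F(1), of A] unfolding compact_eq_totally_bounded by (rule conjunct2)
    from this[rule_format, OF \<open>0 < \<epsilon> / 3\<close>]
    obtain k where "finite k \<and> ?C \<subseteq> (\<Union>x\<in>k. ball x (\<epsilon> / 3))" ..
    then have k: "finite k" "?C \<subseteq> (\<Union>x\<in>k. ball x (\<epsilon> / 3))"
      by simp_all
    have onF: "orthonormal F (\<lambda>e. e)"
      using orthonormal_subset[OF onb_orthonormal[OF E] F(2)] .
    have FK: "f \<in> K" if "f \<in> F" for f
      using that F(2) onb_mem[OF E] by blast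
    have "\<exists>c\<in>k. dist c s \<le> \<epsilon> / 3 + \<epsilon> / 3" if "s \<in> S" for s
    proof -
      obtain x where x: "x \<in> K" "norm x \<le> 1" "s = A x"
        using \<open>s \<in> S\<close> by (auto simp: S_def)
      define p where "p = (\<Sum>f\<in>F. cinner f x *\<^sub>C f)"
      have p: "p \<in> K"
        unfolding p_def by (rule sum_mem, rule scaleC_mem, rule FK)
      have ortho: "\<forall>f\<in>F. cinner f (x - p) = 0"
        using cinner_orthonormal_sum[OF onF F(1)] by (simp add: p_def cinner_diff_right)
      have "(norm p)\<^sup>2 = (\<Sum>f\<in>F. (cmod (cinner f x))\<^sup>2)"
        unfolding p_def by (rule norm_orthonormal_sum[OF onF F(1)])
      have "cinner p (x - p) = 0"
        using ortho by (subst p_def) (simp add: cinner_sum_left cinner_scaleC_left)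
      then have "inner p (x - p) = 0"
        by (simp flip: Re_cinner)
      then have "(norm (x - p))\<^sup>2 \<le> (norm x)\<^sup>2"
        by (simp add: norm_diff_squared inner_diff_right inner_commute power2_norm_eq_inner)
      then have "norm (x - p) \<le> norm x"
        by (rule power2_le_imp_le) simp
      then have np: "norm (x - p) \<le> 1"
        using x(2) by simp
      have "norm (A (x - p)) \<le> \<epsilon> / 3 * norm (x - p)"
        using tail ortho diff_mem[OF x(1) p] by blast
      also have "\<dots> \<le> \<epsilon> / 3 * 1"
        using np \<epsilon> by (intro mult_left_mono) auto
      finally have 1: "dist (A p) s \<le> \<epsilon> / 3"
        by (simp add: x(3) dist_norm op_diff[OF bA x(1) p] norm_minus_commute)
      have "A p = (\<Sum>f\<in>F. cinner f x *\<^sub>C A f)"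
        unfolding p_def by (subst op_sum[OF bA]) (auto simp: opD(4)[OF bA] FK intro!: sum.cong scaleC_mem)
      moreover have "cmod (cinner f x) \<le> 1" if "f \<in> F" for f
        using cmod_cinner_le[of f x] orthonormal_norm[OF onF that] x(2) by simp
      ultimately have "A p \<in> ?C"
        by (auto intro!: exI[of _ "\<lambda>f. cinner f x"])
      then obtain c where "c \<in> k" "dist c (A p) < \<epsilon> / 3"
        using k(2) by auto
      then show ?thesis
        using 1 dist_triangle[of c s "A p"] by (intro bexI[of _ c]) auto
    qed
    then have "S \<subseteq> (\<Union>c\<in>k. cball c (\<epsilon> / 3 + \<epsilon> / 3))"
      by (auto simp: subset_iff)
    moreover have "closed (\<Union>c\<in>k. cball c (\<epsilon> / 3 + \<epsilon> / 3))"
      using k(1) by (intro closed_UN) auto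
    ultimately have "closure S \<subseteq> (\<Union>c\<in>k. cball c (\<epsilon> / 3 + \<epsilon> / 3))"
      by (rule closure_minimal)
    also have "\<dots> \<subseteq> (\<Union>c\<in>k. ball c \<epsilon>)"
      using \<epsilon> by (intro UN_mono) auto
    finally show ?thesis
      using k(1) by blast
  qed
  moreover have "complete (closure S)"
    by (simp add: complete_eq_closed)
  ultimately have comp: "compact (closure S)"
    by (simp add: compact_eq_totally_bounded)
  show ?thesis
    unfolding compact_op_def
  proof (intro allI impI)
    fix x :: "nat \<Rightarrow> 'a"
    assume "\<forall>n. x n \<in> K \<and> norm (x n) \<le> 1"
    then have "\<forall>n. A (x n) \<in> closure S"
      using closure_subset[of S] by (auto simp: S_def)
    then obtain l r where "strict_mono r" "((\<lambda>n. A (x n)) \<circ> r) \<longlonglongrightarrow> l"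
      using comp unfolding compact_def by metis
    then show "\<exists>r l. strict_mono r \<and> (\<lambda>n. A (x (r n))) \<longlonglongrightarrow> l"
      by (auto simp: o_def)
  qed
qed

lemma op_tendsto:
  assumes "A \<in> bounded_ops K" "x \<longlonglongrightarrow> l" "\<And>n. x n \<in> K" "l \<in> K"
  shows "(\<lambda>n. A (x n)) \<longlonglongrightarrow> A l"
proof -
  obtain C where C: "0 < C" "\<And>x. x \<in> K \<Longrightarrow> norm (A x) \<le> C * norm x"
    using op_bound[OF assms(1)] by metis
  have "(\<lambda>n. A (x n) - A l) \<longlonglongrightarrow> 0"
  proof (rule Lim_null_comparison)
    show "\<forall>\<^sub>F n in sequentially. norm (A (x n) - A l) \<le> C * norm (x n - l)"
      using C(2) assms by (auto simp: diff_mem simp flip: op_diff)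
    have "(\<lambda>n. C * norm (x n - l)) \<longlonglongrightarrow> C * norm (l - l)"
      by (intro tendsto_intros assms)
    then show "(\<lambda>n. C * norm (x n - l)) \<longlonglongrightarrow> 0"
      by simp
  qed
  then show ?thesis
    by (simp add: LIM_zero_iff)
qed

text \<open>Compactness turns approximate eigenvectors of \<open>X\<^sup>2\<close> into a limit \<open>y\<close> with \<open>X\<^sup>2 y = \<mu>\<^sup>2 y\<close>. From
  \<open>(X - \<mu>) (X + \<mu>) y = 0\<close> either \<open>y\<close> or \<open>(X + \<mu>) y\<close> is an eigenvector of \<open>X\<close>.\<close>

lemma eigenvector_exists:
  assumes X: "selfadj K X" and comp: "compact_op K X"
    and M: "csubspace M" "M \<subseteq> K" "closed M" "\<And>x. x \<in> M \<Longrightarrow> X x \<in> M"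
    and v: "v \<in> M" "v \<noteq> 0"
  shows "\<exists>y\<in>M. norm y = 1 \<and> (\<exists>l. X y = l *\<^sub>R y)"
proof -
  note bX = selfadjD(1)[OF X]
  have scaleR_M: "r *\<^sub>R y \<in> M" if "y \<in> M" for r y
    using complex_vector.subspace_scale[OF M(1) that] by (simp add: scaleR_scaleC)
  have normalize: ?thesis if "y \<in> M" "y \<noteq> 0" "X y = l *\<^sub>R y" for y l
  proof (intro bexI[of _ "(1 / norm y) *\<^sub>R y"] conjI exI[of _ l])
    show "X ((1 / norm y) *\<^sub>R y) = l *\<^sub>R (1 / norm y) *\<^sub>R y"
      using that M(2) by (subst op_scaleR[OF bX]) auto
  qed (use that in \<open>auto intro: scaleR_M\<close>)
  obtain \<mu> x where \<mu>: "0 \<le> \<mu>" "\<And>y. y \<in> M \<Longrightarrow> norm (X y) \<le> \<mu> * norm y"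
    and x: "\<And>n::nat. x n \<in> M" "\<And>n. norm (x n) \<le> 1"
    and lim: "(\<lambda>n. norm (X (x n))) \<longlonglongrightarrow> \<mu>" "(\<lambda>n. X (X (x n)) - \<mu>\<^sup>2 *\<^sub>R x n) \<longlonglongrightarrow> 0"
    using approximate_eigenvectors[OF X M(1,2,4)] by blast
  show ?thesis
  proof (cases "\<mu> = 0")
    case True
    then have "X v = 0 *\<^sub>R v"
      using \<mu>(2)[OF v(1)] by simp
    then show ?thesis
      using normalize v by blast
  next
    case False
    have "\<forall>n. x n \<in> K \<and> norm (x n) \<le> 1"
      using x M(2) by blast
    then obtain r l where r: "strict_mono r" and l: "(\<lambda>n. X (x (r n))) \<longlonglongrightarrow> l"
      using comp unfolding compact_op_def by blast
    have lM: "l \<in> M"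
      using M(4)[OF x(1)] by (intro closed_sequentially[OF M(3) _ l]) simp
    have XX: "(\<lambda>n. X (X (x (r n)))) \<longlonglongrightarrow> X l"
      by (rule op_tendsto[OF bX l]) (use lM M(2,4) x(1) in auto)
    define y where "y = (1 / \<mu>\<^sup>2) *\<^sub>R X l"
    have yM: "y \<in> M"
      using lM by (simp add: y_def scaleR_M M(4))
    have "(\<lambda>n. X (X (x (r n))) - \<mu>\<^sup>2 *\<^sub>R x (r n)) \<longlonglongrightarrow> 0"
      using LIMSEQ_subseq_LIMSEQ[OF lim(2) r] by (simp add: o_def)
    then have "(\<lambda>n. (1 / \<mu>\<^sup>2) *\<^sub>R (X (X (x (r n))) - (X (X (x (r n))) - \<mu>\<^sup>2 *\<^sub>R x (r n)))) \<longlonglongrightarrow> (1 / \<mu>\<^sup>2) *\<^sub>R (X l - 0)"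
      by (intro tendsto_intros XX)
    then have xy: "(\<lambda>n. x (r n)) \<longlonglongrightarrow> y"
      using False by (simp add: y_def)
    have Xy: "(\<lambda>n. X (x (r n))) \<longlonglongrightarrow> X y"
      by (rule op_tendsto[OF bX xy]) (use yM M(2) x(1) in auto)
    have "l = X y"
      using LIMSEQ_unique[OF l Xy] .
    then have XXy: "X (X y) = \<mu>\<^sup>2 *\<^sub>R y"
      using False by (simp add: y_def)
    have "norm (X y) = \<mu>"
      using LIMSEQ_unique[OF tendsto_norm[OF Xy]] LIMSEQ_subseq_LIMSEQ[OF lim(1) r] by (simp add: o_def)
    then have "y \<noteq> 0"
      using False op_zero[OF bX] by auto
    define z where "z = X y + \<mu> *\<^sub>R y"
    have zM: "z \<in> M"
      using yM by (simp add: z_def M(4) scaleR_M complex_vector.subspace_add[OF M(1)])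
    have yK: "y \<in> K"
      using yM M(2) by blast
    have Xz: "X z = \<mu> *\<^sub>R z"
      using yK by (simp add: z_def opD[OF bX] scaleR_mem op_scaleR[OF bX] XXy power2_eq_square algebra_simps)
    show ?thesis
    proof (cases "z = 0")
      case True
      then have "X y = (- \<mu>) *\<^sub>R y"
        by (simp add: z_def add_eq_0_iff2)
      then show ?thesis
        using normalize yM \<open>y \<noteq> 0\<close> by blast
    next
      case False
      then show ?thesis
        using normalize zM Xz by blast
    qed
  qed
qed

text \<open>The orthogonal complement of a set of eigenvectors is invariant, so it contains another
  eigenvector unless it is trivial.\<close>

lemma spectral_basis:
  assumes X: "selfadj K X" and comp: "compact_op K X"
  shows "\<exists>E l. onb K E \<and> (\<forall>e\<in>E. X e = l e *\<^sub>R e)"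
proof -
  note bX = selfadjD(1)[OF X]
  have "\<exists>E. onb K E \<and> {} \<subseteq> E \<and> (\<forall>e\<in>E. \<exists>l. X e = l *\<^sub>R e)"
  proof (rule onb_extend)
    fix F x
    assume F: "F \<subseteq> K" "orthonormal F (\<lambda>e. e)" "\<And>e. e \<in> F \<Longrightarrow> \<exists>l. X e = l *\<^sub>R e"
      and x: "x \<in> K" "x \<noteq> 0" "\<And>e. e \<in> F \<Longrightarrow> cinner e x = 0"
    define M where "M = K \<inter> (\<Inter>e\<in>F. {x. cinner e x = 0})"
    have "\<exists>y\<in>M. norm y = 1 \<and> (\<exists>l. X y = l *\<^sub>R y)"
    proof (rule eigenvector_exists[OF X comp])
      show "csubspace M"
        by (auto simp: complex_vector.subspace_def M_def add_mem scaleC_mem cinner_add_right cinner_scaleC_right)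
      show "closed M"
        unfolding M_def
        by (intro closed_Int closed closed_INT ballI closed_Collect_eq linear_continuous_on
            bounded_linear_cinner_right continuous_on_const)
      show "X y \<in> M" if "y \<in> M" for y
      proof -
        have y: "y \<in> K" "\<And>e. e \<in> F \<Longrightarrow> cinner e y = 0"
          using that by (auto simp: M_def)
        have "cinner e (X y) = 0" if "e \<in> F" for e
        proof -
          obtain l where "X e = l *\<^sub>R e"
            using F(3)[OF \<open>e \<in> F\<close>] by blast
          then show ?thesis
            using selfadjD(2)[OF X _ y(1), of e] F(1) that y(2)[OF that]
            by (auto simp: cinner_scaleR_left)
        qed
        then show ?thesis
          using y(1) by (simp add: M_def opD(1)[OF bX])
      qed
      show "x \<in> M"
        using x by (simp add: M_def)
    qed (use x in \<open>auto simp: M_def\<close>)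
    then show "\<exists>y\<in>K. norm y = 1 \<and> (\<forall>e\<in>F. cinner e y = 0) \<and> (\<exists>l. X y = l *\<^sub>R y)"
      by (auto simp: M_def)
  qed (auto simp: orthonormal_def)
  then show ?thesis
    by metis
qed

section \<open>Diagonal operators and traces\<close>

lemma diag_op_exists:
  assumes E: "onb K E" and g: "\<And>e. e \<in> E \<Longrightarrow> 0 \<le> g e" "\<And>e. e \<in> E \<Longrightarrow> g e \<le> C"
  shows "\<exists>B. positive_op K B \<and> (\<forall>e\<in>E. B e = g e *\<^sub>R e)"
proof -
  note on = onb_orthonormal[OF E]
  define c where "c x e = complex_of_real (g e) * cinner e x" for x e
  define B where "B x = (if x \<in> K then \<Sum>\<^sub>\<infinity>e\<in>E. c x e *\<^sub>C e else 0)" for x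
  have c_le: "(cmod (c x e))\<^sup>2 \<le> C\<^sup>2 * (cmod (cinner e x))\<^sup>2" if "e \<in> E" for x e
    using g[OF that] by (auto simp: c_def norm_mult power_mult_distrib intro!: mult_right_mono power_mono)
  have "(\<lambda>e. (cmod (c x e))\<^sup>2) summable_on E" if "x \<in> K" for x
  proof (rule summable_on_comparison_test)
    show "(\<lambda>e. C\<^sup>2 * (cmod (cinner e x))\<^sup>2) summable_on E"
      using bessel_summable[OF on] by (intro summable_on_cmult_right)
  qed (use c_le in auto)
  then have hs: "((\<lambda>e. c x e *\<^sub>C e) has_sum B x) E" if "x \<in> K" for x
    using orthogonal_series_summable[OF on] that by (auto simp: B_def intro: has_sum_infsum)
  have BK: "B x \<in> K" if "x \<in> K" for x
    using hs[OF that] by (rule has_sum_mem) (auto intro: scaleC_mem onb_mem[OF E])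
  have coef: "cinner e (B x) = complex_of_real (g e) * cinner e x" if "x \<in> K" "e \<in> E" for x e
    using norm_has_sum_orthogonal(1)[OF on hs[OF that(1)] that(2)] by (simp add: c_def)
  have "norm (B x) \<le> \<bar>C\<bar> * norm x" if "x \<in> K" for x
  proof (rule power2_le_imp_le)
    have "(norm (B x))\<^sup>2 \<le> C\<^sup>2 * (norm x)\<^sup>2"
      using norm_has_sum_orthogonal(2)[OF on hs[OF that]]
        has_sum_cmult_right[OF onb_parseval_norm[OF E that], of "C\<^sup>2"] c_le by (rule has_sum_mono)
    then show "(norm (B x))\<^sup>2 \<le> (\<bar>C\<bar> * norm x)\<^sup>2"
      by (simp add: power_mult_distrib)
  qed simp
  moreover have "B (x + y) = B x + B y" if "x \<in> K" "y \<in> K" for x y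
    using that by (intro onb_eqI[OF E]) (auto simp: add_mem BK coef cinner_add_right distrib_left)
  moreover have "B (a *\<^sub>C x) = a *\<^sub>C B x" if "x \<in> K" for a x
    using that by (intro onb_eqI[OF E]) (auto simp: scaleC_mem BK coef cinner_scaleC_right)
  ultimately have bB: "B \<in> bounded_ops K"
    using BK by (auto simp: bounded_ops_def B_def)
  have "cinner (B x) y = cinner x (B y)" if "x \<in> K" "y \<in> K" for x y
  proof (rule has_sum_unique)
    show "((\<lambda>e. cinner (B x) e * cinner e y) has_sum cinner (B x) y) E"
      by (rule onb_parseval[OF E that(2)])
    have eq: "cinner (B x) e * cinner e y = cinner x e * cinner e (B y)" if "e \<in> E" for e
    proof -
      have "cinner (B x) e = cnj (cinner e (B x))"
        by (rule cinner_commute)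
      also have "\<dots> = complex_of_real (g e) * cinner x e"
        using coef[OF \<open>x \<in> K\<close> that] by (simp flip: cinner_commute[of x e])
      finally show ?thesis
        using coef[OF \<open>y \<in> K\<close> that] by simp
    qed
    show "((\<lambda>e. cinner (B x) e * cinner e y) has_sum cinner x (B y)) E"
      using onb_parseval[OF E BK[OF that(2)], of x] eq by (simp cong: has_sum_cong)
  qed
  then have sB: "selfadj K B"
    using bB by (simp add: selfadj_def)
  have "positive_op K B"
  proof (rule positive_opI[OF sB])
    fix x
    assume x: "x \<in> K"
    have "((\<lambda>e. Re (cinner x e * cinner e (B x))) has_sum quad B x) E"
      by (intro has_sum_Re onb_parseval[OF E BK[OF x]])
    then show "0 \<le> quad B x"
    proof (rule has_sum_nonneg)
      fix e
      assume e: "e \<in> E"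
      have "cinner x e * cinner e (B x) = complex_of_real (g e) * (cnj (cinner e x) * cinner e x)"
        using coef[OF x e] by (simp flip: cinner_commute[of x e])
      then show "0 \<le> Re (cinner x e * cinner e (B x))"
        using g(1)[OF e] by (simp add: mult_cnj_cmod del: of_real_power)
    qed
  qed
  moreover have "B e = g e *\<^sub>R e" if e: "e \<in> E" for e
  proof (rule onb_eqI[OF E])
    fix f
    assume f: "f \<in> E"
    show "cinner f (B e) = cinner f (g e *\<^sub>R e)"
      using coef[OF onb_mem[OF E e] f] on e f by (auto simp: cinner_scaleR_right orthonormal_def)
  qed (use onb_mem[OF E e] in \<open>auto simp: BK scaleR_mem\<close>)
  ultimately show ?thesis
    by blast
qed

lemma selfadj_square: "selfadj K A \<Longrightarrow> selfadj K (A \<circ> A)"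
  using comp_bounded by (auto simp: selfadj_def opD)

lemma diag_form:
  assumes G: "onb K G" and X: "selfadj K X" and l: "\<And>g. g \<in> G \<Longrightarrow> X g = l g *\<^sub>R g" and x: "x \<in> K"
  shows "((\<lambda>g. l g * (cmod (cinner g x))\<^sup>2) has_sum quad X x) G"
proof -
  have "Re (cinner x g * cinner g (X x)) = l g * (cmod (cinner g x))\<^sup>2" if "g \<in> G" for g
  proof -
    have "cinner g (X x) = complex_of_real (l g) * cinner g x"
      using selfadjD(2)[OF X onb_mem[OF G that] x] l[OF that] by (simp add: cinner_scaleR_left)
    moreover have "cinner x g = cnj (cinner g x)"
      by (rule cinner_commute)
    ultimately have "cinner x g * cinner g (X x) = complex_of_real (l g) * (cnj (cinner g x) * cinner g x)"
      by simp
    then show ?thesis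
      by (simp add: mult_cnj_cmod del: of_real_power)
  qed
  then show ?thesis
    using has_sum_Re[OF onb_parseval[OF G opD(1)[OF selfadjD(1)[OF X] x], of x]]
    by (simp cong: has_sum_cong)
qed

lemma eigenvalue_quad:
  assumes "onb K G" "g \<in> G" "A g = r *\<^sub>R g"
  shows "quad A g = r"
  using assms orthonormal_norm[OF onb_orthonormal] by (simp add: cinner_scaleR_right cinner_self)

text \<open>The sums are the two iterated sums of \<open>l g |\<langle>g, e\<rangle>|\<^sup>2\<close>.\<close>

lemma diag_trace:
  assumes G: "onb K G" and B: "positive_op K B" and l: "\<And>g. g \<in> G \<Longrightarrow> B g = l g *\<^sub>R g" and E: "onb K E"
  shows "((\<lambda>e. quad B e) has_sum s) E \<longleftrightarrow> (l has_sum s) G"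
proof -

  have nonneg: "0 \<le> l g * (cmod (cinner g e))\<^sup>2" if "g \<in> G" for g e
    using eigenvalue_quad[of G g B "l g", OF G that l[OF that]] positive_op_nonneg[OF B onb_mem[OF G that]] by simp
  have rows: "((\<lambda>e. l g * (cmod (cinner g e))\<^sup>2) has_sum l g) E" if "g \<in> G" for g
    using has_sum_cmult_right[OF onb_parseval_norm[OF E onb_mem[OF G that]], of "l g"]
      orthonormal_norm[OF onb_orthonormal[OF G] that]
    by (simp add: cmod_cinner_commute[of g])
  have cols: "((\<lambda>g. l g * (cmod (cinner g e))\<^sup>2) has_sum quad B e) G" if "e \<in> E" for e
    using diag_form[OF G positive_selfadj[OF B] l onb_mem[OF E that]] .
  show ?thesis
  proof
    assume "((\<lambda>e. quad B e) has_sum s) E"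
    then show "(l has_sum s) G"
      using nonneg by (intro has_sum_swap_nonneg[OF cols rows]) auto
  next
    assume "(l has_sum s) G"
    then show "((\<lambda>e. quad B e) has_sum s) E"
      using nonneg by (intro has_sum_swap_nonneg[OF rows cols]) auto
  qed
qed

lemma has_trace_diag:
  assumes "onb K G" "positive_op K B" "\<And>g. g \<in> G \<Longrightarrow> B g = l g *\<^sub>R g" "(l has_sum s) G"
  shows "has_trace K B s"
  using diag_trace[OF assms(1-3)] assms(4) by (simp add: has_trace_def)

text \<open>A summable diagonal in one basis makes the operator compact; its eigenbasis then mediates
  between any two bases.\<close>

lemma has_traceI:
  assumes A: "positive_op K A" and E: "onb K E" and t: "((\<lambda>e. quad A e) has_sum t) E"
  shows "has_trace K A t"
proof -
  have "compact_op K A"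
    using summable_diagonal_compact[OF A E] t by (auto simp: summable_on_def)
  then obtain G l where G: "onb K G" "\<And>g. g \<in> G \<Longrightarrow> A g = l g *\<^sub>R g"
    using spectral_basis[OF positive_selfadj[OF A]] by blast
  then have "(l has_sum t) G"
    using diag_trace[OF G(1) A G(2) E] t by blast
  then show ?thesis
    using has_trace_diag[OF G(1) A G(2)] by blast
qed

lemma has_traceD: "has_trace K A t \<Longrightarrow> onb K E \<Longrightarrow> ((\<lambda>e. quad A e) has_sum t) E"
  by (simp add: has_trace_def)

lemma has_trace_compact: "positive_op K A \<Longrightarrow> has_trace K A t \<Longrightarrow> compact_op K A"
  by (metis has_traceD onb_exists summable_diagonal_compact summable_on_def)

lemma op_trace_eq:
  assumes A: "selfadj K A" and t: "has_trace K A t"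
  shows "op_trace K A = complex_of_real t"
proof -
  define E where "E = (SOME E. onb K E)"
  have E: "onb K E"
    unfolding E_def using onb_exists by (rule someI_ex)
  have "((\<lambda>e. complex_of_real (quad A e)) has_sum complex_of_real t) E"
    using has_traceD[OF t E] by (rule has_sum_of_real)
  moreover have "complex_of_real (quad A e) = cinner e (A e)" if "e \<in> E" for e
    using selfadj_cinner_real[OF A onb_mem[OF E that]] by simp
  ultimately have "((\<lambda>e. cinner e (A e)) has_sum complex_of_real t) E"
    by (simp cong: has_sum_cong)
  then show ?thesis
    unfolding op_trace_def E_def[symmetric] by (rule infsumI)
qed

text \<open>A positive operator is its own absolute value.\<close>

lemma states_iff: "\<rho> \<in> states K \<longleftrightarrow> positive_op K \<rho> \<and> has_trace K \<rho> 1"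
proof
  assume \<rho>: "\<rho> \<in> states K"
  then have pos: "positive_op K \<rho>" and tr: "op_trace K \<rho> = 1"
    by (auto simp: states_def)
  have "op_abs K \<rho> = \<rho>"
    using op_abs_eqI[OF positive_selfadj[OF pos] pos] by simp
  then obtain E where E: "onb K E" "(\<lambda>e. cinner e (\<rho> e)) summable_on E"
    using \<rho> by (auto simp: states_def trace_class_def)
  then obtain t where "((\<lambda>e. quad \<rho> e) has_sum t) E"
    using summable_on_Re by (auto simp: summable_on_def)
  then have t: "has_trace K \<rho> t"
    by (rule has_traceI[OF pos E(1)])
  then show "positive_op K \<rho> \<and> has_trace K \<rho> 1"
    using op_trace_eq[OF positive_selfadj[OF pos] t] tr pos by simp
next
  assume "positive_op K \<rho> \<and> has_trace K \<rho> 1"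
  then have pos: "positive_op K \<rho>" and t: "has_trace K \<rho> 1"
    by auto
  obtain E where E: "onb K E"
    using onb_exists by blast
  have "op_abs K \<rho> = \<rho>"
    using op_abs_eqI[OF positive_selfadj[OF pos] pos] by simp
  moreover have "((\<lambda>e. complex_of_real (quad \<rho> e)) has_sum complex_of_real 1) E"
    using has_traceD[OF t E] by (rule has_sum_of_real)
  then have "((\<lambda>e. cinner e (\<rho> e)) has_sum 1) E"
    unfolding of_real_1 selfadj_cinner_real[OF positive_selfadj[OF pos] onb_mem[OF E], symmetric]
    by (rule has_sum_cong[THEN iffD1, rotated])
      (use selfadj_cinner_real[OF positive_selfadj[OF pos] onb_mem[OF E]] in simp)
  ultimately have "trace_class K \<rho>"
    using E positive_op_bounded[OF pos] by (auto simp: trace_class_def summable_on_def)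
  then show "\<rho> \<in> states K"
    using pos op_trace_eq[OF positive_selfadj[OF pos] t] by (simp add: states_def)
qed

lemma op_sqrt_exists:
  assumes A: "positive_op K A" and t: "has_trace K A t"
  shows "\<exists>B G l. positive_op K B \<and> B \<circ> B = A \<and> onb K G \<and>
    (\<forall>g\<in>G. 0 \<le> l g \<and> B g = sqrt (l g) *\<^sub>R g \<and> A g = l g *\<^sub>R g)"
proof -
  obtain G l where G: "onb K G" and l: "\<And>g. g \<in> G \<Longrightarrow> A g = l g *\<^sub>R g"
    using spectral_basis[OF positive_selfadj[OF A] has_trace_compact[OF A t]] by blast
  have l0: "0 \<le> l g" if "g \<in> G" for g
    using eigenvalue_quad[of G g A "l g", OF G that l[OF that]] positive_op_nonneg[OF A onb_mem[OF G that]] by simp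
  have "(l has_sum t) G"
    using diag_trace[OF G A l G] has_traceD[OF t G] by blast
  then have "l g \<le> t" if "g \<in> G" for g
    using finite_sum_le_has_sum[OF \<open>(l has_sum t) G\<close>, of "{g}"] l0 that by auto
  then obtain B where B: "positive_op K B" "\<And>g. g \<in> G \<Longrightarrow> B g = sqrt (l g) *\<^sub>R g"
    using diag_op_exists[OF G, of "\<lambda>g. sqrt (l g)" "sqrt t"] l0 by auto
  have "B \<circ> B = A"
  proof (rule op_eqI[OF G selfadj_square[OF positive_selfadj[OF B(1)]] positive_selfadj[OF A]])
    fix g
    assume g: "g \<in> G"
    show "(B \<circ> B) g = A g"
      using g l0[OF g] by (simp add: B(2) l op_scaleR[OF positive_op_bounded[OF B(1)] onb_mem[OF G g]])
  qed
  then show ?thesis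
    using B G l l0 by blast
qed

lemma op_sqrt:
  assumes A: "positive_op K A" and t: "has_trace K A t"
  shows "positive_op K (op_sqrt K A)" "op_sqrt K A \<circ> op_sqrt K A = A"
proof -
  obtain B where "positive_op K B" "B \<circ> B = A"
    using op_sqrt_exists[OF assms] by blast
  moreover from this have "op_sqrt K A = B"
    by (rule op_sqrt_eqI)
  ultimately show "positive_op K (op_sqrt K A)" "op_sqrt K A \<circ> op_sqrt K A = A"
    by simp_all
qed

lemma norm_op_sqrt:
  assumes A: "positive_op K A" and t: "has_trace K A t" and x: "x \<in> K"
  shows "(norm (op_sqrt K A x))\<^sup>2 = quad A x"
proof -
  note B = op_sqrt[OF A t]
  have "cinner (op_sqrt K A x) (op_sqrt K A x) = cinner x (op_sqrt K A (op_sqrt K A x))"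
    using selfadjD[OF positive_selfadj[OF B(1)]] x by (simp add: opD)
  also have "\<dots> = cinner x (A x)"
    using fun_cong[OF B(2), of x] by simp
  finally show ?thesis
    unfolding cinner_self by (metis Re_complex_of_real)
qed

end

section \<open>The trace distance\<close>

context hilbert_subspace
begin

text \<open>\<open>|A - C|\<close> dominates the form of \<open>A - C\<close>, with equality on an eigenbasis. The trace distance
  is therefore the supremum of \<open>\<Sum>\<^sub>e |\<langle>e, (A - C) e\<rangle>|\<close> over finite orthonormal families.\<close>

lemma trace_dist_dominating:
  assumes A: "positive_op K A" "has_trace K A a" and C: "positive_op K C" "has_trace K C c"
  shows "\<exists>B G. positive_op K B \<and> has_trace K B (trace_dist K A C) \<and> onb K G \<and>
    (\<forall>x\<in>K. \<bar>quad A x - quad C x\<bar> \<le> quad B x) \<and>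
    (\<forall>g\<in>G. \<bar>quad A g - quad C g\<bar> = quad B g)"
proof -
  define X where "X = (\<lambda>x. A x - C x)"
  have sX: "selfadj K X"
    unfolding X_def by (rule selfadj_diff[OF positive_selfadj[OF A(1)] positive_selfadj[OF C(1)]])
  have "compact_op K X"
    unfolding X_def by (intro compact_op_diff has_trace_compact[OF A] has_trace_compact[OF C])
  then obtain G l where G: "onb K G" and l: "\<And>g. g \<in> G \<Longrightarrow> X g = l g *\<^sub>R g"
    using spectral_basis[OF sX] by blast
  have form: "quad X x = quad A x - quad C x" for x
    by (simp add: X_def cinner_diff_right)
  have l_eq: "l g = quad A g - quad C g" if "g \<in> G" for g
    using eigenvalue_quad[of G g X "l g", OF G that l[OF that]] form by simp
  have "(\<lambda>g. \<bar>l g\<bar>) summable_on G"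
  proof (rule summable_on_comparison_test)
    show "(\<lambda>g. quad A g + quad C g) summable_on G"
      using has_traceD[OF A(2) G] has_traceD[OF C(2) G] by (intro summable_on_add) (auto simp: summable_on_def)
    fix g
    assume "g \<in> G"
    then show "\<bar>l g\<bar> \<le> quad A g + quad C g"
      using l_eq positive_op_nonneg[OF A(1) onb_mem[OF G]] positive_op_nonneg[OF C(1) onb_mem[OF G]]
      by (simp add: abs_le_iff)
  qed auto
  then obtain s where s: "((\<lambda>g. \<bar>l g\<bar>) has_sum s) G"
    by (auto simp: summable_on_def)
  then have "\<bar>l g\<bar> \<le> s" if "g \<in> G" for g
    using finite_sum_le_has_sum[OF s, of "{g}"] that by auto
  then obtain B where B: "positive_op K B" and Bg: "\<And>g. g \<in> G \<Longrightarrow> B g = \<bar>l g\<bar> *\<^sub>R g"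
    using diag_op_exists[OF G, of "\<lambda>g. \<bar>l g\<bar>" s] by auto
  note sB = positive_selfadj[OF B]
  have "B \<circ> B = X \<circ> X"
  proof (rule op_eqI[OF G selfadj_square[OF sB] selfadj_square[OF sX]])
    fix g
    assume g: "g \<in> G"
    then show "(B \<circ> B) g = (X \<circ> X) g"
      by (simp add: Bg l op_scaleR[OF selfadjD(1)[OF sB] onb_mem[OF G g]]
          op_scaleR[OF selfadjD(1)[OF sX] onb_mem[OF G g]])
  qed
  then have abs: "op_abs K X = B"
    by (rule op_abs_eqI[OF sX B])
  have trB: "has_trace K B s"
    by (rule has_trace_diag[OF G B Bg s])
  have dist: "trace_dist K A C = s"
    using op_trace_eq[OF sB trB] abs by (simp add: trace_dist_def trace_norm_def X_def)
  have "\<bar>quad X x\<bar> \<le> quad B x" if x: "x \<in> K" for x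
  proof -
    note hX = diag_form[OF G sX l x] and hB = diag_form[OF G sB Bg x]
    have "quad X x \<le> quad B x"
      by (rule has_sum_mono[OF hX hB]) (auto intro!: mult_right_mono)
    moreover have "- quad B x \<le> quad X x"
    proof (rule has_sum_mono[OF has_sum_uminusI[OF hB] hX])
      fix g
      have "- \<bar>l g\<bar> * (cmod (cinner g x))\<^sup>2 \<le> l g * (cmod (cinner g x))\<^sup>2"
        by (intro mult_right_mono) auto
      then show "- (\<bar>l g\<bar> * (cmod (cinner g x))\<^sup>2) \<le> l g * (cmod (cinner g x))\<^sup>2"
        by simp
    qed
    ultimately show ?thesis
      by (simp add: abs_le_iff)
  qed
  moreover have "\<bar>quad X g\<bar> = quad B g" if "g \<in> G" for g
    using eigenvalue_quad[of G g X, OF G that l[OF that]] eigenvalue_quad[of G g B, OF G that Bg[OF that]]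
    by simp
  ultimately show ?thesis
    using B trB dist G unfolding form by blast
qed

lemma has_trace_family_le:
  assumes B: "positive_op K B" "has_trace K B t"
    and u: "orthonormal I u" "finite I" "\<And>i. i \<in> I \<Longrightarrow> u i \<in> K"
  shows "(\<Sum>i\<in>I. quad B (u i)) \<le> t"
proof -
  obtain E where E: "onb K E" "u ` I \<subseteq> E"
    using onb_extend_orthonormal[of "u ` I"] u orthonormal_image by blast
  have "(\<Sum>e\<in>u ` I. quad B e) \<le> t"
    using E u(2) positive_op_nonneg[OF B(1) onb_mem[OF E(1)]]
    by (intro finite_sum_le_has_sum[OF has_traceD[OF B(2) E(1)]]) auto
  then show ?thesis
    by (simp add: sum.reindex[OF orthonormal_inj_on[OF u(1)]] o_def)
qed

lemma trace_dist_family_ge: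
  assumes A: "positive_op K A" "has_trace K A a" and C: "positive_op K C" "has_trace K C c"
    and u: "orthonormal I u" "finite I" "\<And>i. i \<in> I \<Longrightarrow> u i \<in> K"
  shows "(\<Sum>i\<in>I. \<bar>quad A (u i) - quad C (u i)\<bar>) \<le> trace_dist K A C"
proof -
  obtain B where B: "positive_op K B" "has_trace K B (trace_dist K A C)"
    and dom: "\<And>x. x \<in> K \<Longrightarrow> \<bar>quad A x - quad C x\<bar> \<le> quad B x"
    using trace_dist_dominating[OF A C] by blast
  have "(\<Sum>i\<in>I. \<bar>quad A (u i) - quad C (u i)\<bar>)
      \<le> (\<Sum>i\<in>I. quad B (u i))"
    by (intro sum_mono dom u(3))
  also have "\<dots> \<le> trace_dist K A C"
    by (rule has_trace_family_le[OF B u])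
  finally show ?thesis .
qed

lemma trace_dist_leI:
  assumes A: "positive_op K A" "has_trace K A a" and C: "positive_op K C" "has_trace K C c"
    and le: "\<And>F. \<lbrakk>finite F; F \<subseteq> K; orthonormal F (\<lambda>e. e)\<rbrakk>
      \<Longrightarrow> (\<Sum>e\<in>F. \<bar>quad A e - quad C e\<bar>) \<le> t"
  shows "trace_dist K A C \<le> t"
proof -
  obtain B G where B: "positive_op K B" "has_trace K B (trace_dist K A C)" and G: "onb K G"
    and eq: "\<And>g. g \<in> G \<Longrightarrow> \<bar>quad A g - quad C g\<bar> = quad B g"
    using trace_dist_dominating[OF A C] by blast
  show ?thesis
  proof (rule has_sum_le_finite_sums[OF has_traceD[OF B(2) G]])
    fix F
    assume F: "finite F" "F \<subseteq> G"
    then have "(\<Sum>e\<in>F. quad B e) = (\<Sum>e\<in>F. \<bar>quad A e - quad C e\<bar>)"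
      using eq by (intro sum.cong) auto
    also have "\<dots> \<le> t"
      using F onb_mem[OF G] by (intro le orthonormal_subset[OF onb_orthonormal[OF G] F(2)]) auto
    finally show "(\<Sum>e\<in>F. quad B e) \<le> t" .
  qed
qed

text \<open>In a basis extending the \<open>q\<^sub>i\<close>, the diagonal entries of \<open>\<rho> - \<sigma>\<close> sum to \<open>0\<close>. Those at the \<open>q\<^sub>i\<close> sum to
  the difference in parentheses, and the remaining ones to its negative.\<close>

lemma trace_dist_supported_ge:
  assumes \<rho>: "\<rho> \<in> states K" and \<sigma>: "\<sigma> \<in> states K"
    and q: "orthonormal I q" "finite I" "\<And>i. i \<in> I \<Longrightarrow> q i \<in> K"
    and supp: "(\<Sum>i\<in>I. quad \<rho> (q i)) = 1"
  shows "2 * (1 - (\<Sum>i\<in>I. quad \<sigma> (q i))) \<le> trace_dist K \<rho> \<sigma>"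
proof -
  note \<rho>' = \<rho>[unfolded states_iff, THEN conjunct1] \<rho>[unfolded states_iff, THEN conjunct2]
  note \<sigma>' = \<sigma>[unfolded states_iff, THEN conjunct1] \<sigma>[unfolded states_iff, THEN conjunct2]
  obtain B where B: "positive_op K B" "has_trace K B (trace_dist K \<rho> \<sigma>)"
    and dom: "\<And>x. x \<in> K \<Longrightarrow> \<bar>quad \<rho> x - quad \<sigma> x\<bar> \<le> quad B x"
    using trace_dist_dominating[OF \<rho>' \<sigma>'] by blast
  obtain E where E: "onb K E" "q ` I \<subseteq> E"
    using onb_extend_orthonormal[of "q ` I"] q orthonormal_image by blast
  define d where "d e = quad \<rho> e - quad \<sigma> e" for e
  define s where "s = (\<Sum>i\<in>I. quad \<sigma> (q i))"
  have "(\<Sum>e\<in>q ` I. d e) = 1 - s"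
    using supp by (simp add: sum.reindex[OF orthonormal_inj_on[OF q(1)]] o_def d_def sum_subtractf s_def)
  then have h1: "((\<lambda>e. if e \<in> q ` I then d e else 0) has_sum (1 - s)) E"
    using E(2) q(2) by (intro has_sum_finite_neutralI[of "q ` I"]) auto
  have "((\<lambda>e. quad \<sigma> e + - quad \<rho> e) has_sum 1 + - 1) E"
    by (intro has_sum_add has_sum_uminusI has_traceD[OF _ E(1)] \<rho>'(2) \<sigma>'(2))
  then have h2: "((\<lambda>e. - d e) has_sum 0) E"
    by (simp add: d_def)
  have "((\<lambda>e. - d e + 2 * (if e \<in> q ` I then d e else 0)) has_sum 0 + 2 * (1 - s)) E"
    by (intro has_sum_add h2 has_sum_cmult_right h1)
  moreover have "- d e + 2 * (if e \<in> q ` I then d e else 0) \<le> quad B e" if "e \<in> E" for e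
    using dom[OF onb_mem[OF E(1) that]] by (simp add: d_def abs_le_iff)
  ultimately have "0 + 2 * (1 - s) \<le> trace_dist K \<rho> \<sigma>"
    by (rule has_sum_mono[OF _ has_traceD[OF B(2) E(1)]])
  then show ?thesis
    by (simp add: s_def)
qed

section \<open>Fidelity and the Bures distance\<close>

text \<open>The convention without a square: for pure states this is \<open>|\<langle>\<phi>, \<psi>\<rangle>|\<close>.\<close>

definition fidelity :: "('a \<Rightarrow> 'a) \<Rightarrow> ('a \<Rightarrow> 'a) \<Rightarrow> real" where
  "fidelity A C = Re (op_trace K (op_sqrt K (op_sqrt K A \<circ> C \<circ> op_sqrt K A)))"

lemma bures_dist_states:
  assumes "\<rho> \<in> states K" "\<sigma> \<in> states K"
  shows "bures_dist K \<rho> \<sigma> = sqrt (2 - 2 * fidelity \<rho> \<sigma>)"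
  using assms by (simp add: bures_dist_def fidelity_def states_def)

lemma sqrt_product_adj:
  assumes "positive_op K R" "positive_op K S" "x \<in> K" "y \<in> K"
  shows "cinner (S (R x)) y = cinner x (R (S y))"
  using assms selfadjD[OF positive_selfadj[OF assms(1)]] selfadjD[OF positive_selfadj[OF assms(2)]]
  by (simp add: opD)

text \<open>The Cauchy--Schwarz inequality for the Hilbert--Schmidt operators \<open>\<surd>C\<close> and \<open>\<surd>A\<close>. It bounds the sum
  of the singular values of \<open>\<surd>C \<surd>A\<close>.\<close>

lemma sqrt_product_family_le:
  assumes A: "positive_op K A" "has_trace K A a" and C: "positive_op K C" "has_trace K C c"
    and v: "orthonormal I v" "\<And>i. i \<in> I \<Longrightarrow> v i \<in> K"
    and w: "orthonormal I w" "\<And>i. i \<in> I \<Longrightarrow> w i \<in> K" and fin: "finite I"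
  shows "(\<Sum>i\<in>I. cmod (cinner (w i) (op_sqrt K C (op_sqrt K A (v i))))) \<le> sqrt c * sqrt a"
proof -
  define R where "R = op_sqrt K A"
  define S where "S = op_sqrt K C"
  have bR: "R \<in> bounded_ops K" and sS: "selfadj K S"
    unfolding R_def S_def
    by (rule positive_op_bounded[OF op_sqrt(1)[OF A]] positive_selfadj[OF op_sqrt(1)[OF C]])+
  have "(\<Sum>i\<in>I. cmod (cinner (w i) (S (R (v i))))) \<le> (\<Sum>i\<in>I. norm (S (w i)) * norm (R (v i)))"
  proof (intro sum_mono)
    fix i
    assume i: "i \<in> I"
    show "cmod (cinner (w i) (S (R (v i)))) \<le> norm (S (w i)) * norm (R (v i))"
      using cmod_cinner_le[of "S (w i)" "R (v i)"] selfadjD(2)[OF sS w(2)[OF i] op_mem[OF bR]] by simp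
  qed
  also have "\<dots> \<le> sqrt (\<Sum>i\<in>I. (norm (S (w i)))\<^sup>2) * sqrt (\<Sum>i\<in>I. (norm (R (v i)))\<^sup>2)"
    by (rule sum_mult_le_sqrt)
  also have "(\<Sum>i\<in>I. (norm (S (w i)))\<^sup>2) = (\<Sum>i\<in>I. quad C (w i))"
    unfolding S_def by (intro sum.cong refl norm_op_sqrt[OF C] w(2))
  also have "(\<Sum>i\<in>I. (norm (R (v i)))\<^sup>2) = (\<Sum>i\<in>I. quad A (v i))"
    unfolding R_def by (intro sum.cong refl norm_op_sqrt[OF A] v(2))
  also have "sqrt (\<Sum>i\<in>I. quad C (w i)) * sqrt (\<Sum>i\<in>I. quad A (v i)) \<le> sqrt c * sqrt a"
    using positive_op_nonneg[OF A(1) v(2)] has_trace_family_le[OF C w(1) fin] w(2)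
      has_trace_family_le[of C c "{}" w] has_trace_family_le[OF A v(1) fin v(2)] C
    by (intro mult_mono real_sqrt_le_mono) (auto intro!: sum_nonneg simp: orthonormal_def)
  finally show ?thesis
    by (simp add: R_def S_def)
qed

text \<open>The fidelity is the trace norm of \<open>\<surd>C \<surd>A\<close>, the sum of its singular values \<open>l g\<close>. The eigenvectors \<open>g\<close> of
  \<open>(\<surd>C \<surd>A)\<^sup>* (\<surd>C \<surd>A) = \<surd>A C \<surd>A\<close> and the normalized vectors \<open>u g\<close> of \<open>\<surd>C \<surd>A g\<close> form the singular value
  decomposition. With it, \<open>fidelity_family_ge\<close> and \<open>fidelity_leI\<close> express the fidelity as the supremum of
  \<open>\<Sum>\<^sub>i |\<langle>w\<^sub>i, \<surd>C \<surd>A v\<^sub>i\<rangle>|\<close> over pairs of finite orthonormal families.\<close>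

lemma fidelity_svd:
  assumes A: "positive_op K A" "has_trace K A a" and C: "positive_op K C" "has_trace K C c"
  shows "\<exists>G u l. onb K G \<and> (\<forall>g\<in>G. 0 \<le> l g \<and> u g \<in> K \<and> op_sqrt K C (op_sqrt K A g) = l g *\<^sub>R u g) \<and>
    orthonormal {g \<in> G. l g > 0} u \<and> (\<forall>g\<in>G. norm (u g) \<le> 1) \<and> (l has_sum fidelity A C) G"
proof -
  define R where "R = op_sqrt K A"
  define S where "S = op_sqrt K C"
  have R: "positive_op K R" and RR: "R \<circ> R = A" and S: "positive_op K S" and SS: "S \<circ> S = C"
    using op_sqrt[OF A] op_sqrt[OF C] by (auto simp: R_def S_def)
  note sR = positive_selfadj[OF R] and sS = positive_selfadj[OF S]
  note bR = positive_op_bounded[OF R] and bS = positive_op_bounded[OF S] and bC = positive_op_bounded[OF C(1)]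
  have SSx: "S (S x) = C x" for x
    using fun_cong[OF SS, of x] by simp
  define M where "M = R \<circ> C \<circ> R"
  have bM: "M \<in> bounded_ops K"
    unfolding M_def by (intro comp_bounded bR bC)
  have M_form: "cinner x (M y) = cinner (S (R x)) (S (R y))" if "x \<in> K" "y \<in> K" for x y
  proof -
    have "cinner x (M y) = cinner (R x) (C (R y))"
      unfolding M_def o_def by (rule selfadjD(2)[OF sR, symmetric]) (use that in \<open>auto intro: op_mem[OF bC]\<close>)
    also have "\<dots> = cinner (R x) (S (S (R y)))"
      by (simp add: SSx)
    also have "\<dots> = cinner (S (R x)) (S (R y))"
      by (rule selfadjD(2)[OF sS, symmetric]) (intro op_mem bR bS)+
    finally show ?thesis .
  qed
  have sM: "selfadj K M"
    using bM M_form by (auto simp: selfadj_def) (metis M_form cinner_commute)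
  have M: "positive_op K M"
    by (rule positive_opI[OF sM]) (simp add: M_form cinner_self del: of_real_power)
  obtain E where E: "onb K E"
    using onb_exists by blast
  obtain b where b: "0 < b" "\<And>x. x \<in> K \<Longrightarrow> norm (S x) \<le> b * norm x"
    using op_bound[OF bS] by metis
  have "(\<lambda>e. quad M e) summable_on E"
  proof (rule summable_on_comparison_test)
    show "(\<lambda>e. b\<^sup>2 * quad A e) summable_on E"
      using has_traceD[OF A(2) E] by (intro summable_on_cmult_right) (auto simp: summable_on_def)
    fix e
    assume "e \<in> E"
    then have e: "e \<in> K"
      by (rule onb_mem[OF E])
    have "(norm (S (R e)))\<^sup>2 \<le> (b * norm (R e))\<^sup>2"
      using b op_mem[OF bR] by (intro power_mono) auto
    also have "\<dots> = b\<^sup>2 * quad A e"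
      using norm_op_sqrt[OF A e] by (simp add: R_def power_mult_distrib)
    finally show "quad M e \<le> b\<^sup>2 * quad A e"
      unfolding M_form[OF e e] cinner_self Re_complex_of_real .
    show "0 \<le> quad M e"
      by (rule positive_op_nonneg[OF M e])
  qed
  then obtain t where "((\<lambda>e. quad M e) has_sum t) E"
    by (auto simp: summable_on_def)
  then have trM: "has_trace K M t"
    by (rule has_traceI[OF M E])
  obtain B G l where B: "positive_op K B" "B \<circ> B = M" and G: "onb K G"
    and l: "\<And>g. g \<in> G \<Longrightarrow> 0 \<le> l g" and Bg: "\<And>g. g \<in> G \<Longrightarrow> B g = sqrt (l g) *\<^sub>R g"
    and Mg: "\<And>g. g \<in> G \<Longrightarrow> M g = l g *\<^sub>R g"
    using op_sqrt_exists[OF M trM] by blast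
  note on = onb_orthonormal[OF G]
  define k where "k g = sqrt (l g)" for g
  \<comment> \<open>If \<open>k g = 0\<close> this is \<open>0\<close>, by the convention for division by zero.\<close>
  define u where "u g = (1 / k g) *\<^sub>R S (R g)" for g
  have uK: "u g \<in> K" for g
    unfolding u_def by (intro scaleR_mem op_mem bS)
  have SRg: "cinner (S (R g)) (S (R h)) = (if g = h then complex_of_real ((k g)\<^sup>2) else 0)"
    if "g \<in> G" "h \<in> G" for g h
    using that on l[of g] unfolding M_form[OF onb_mem[OF G] onb_mem[OF G], OF that, symmetric] Mg[OF that(2)]
    by (auto simp: orthonormal_def cinner_scaleR_right k_def simp flip: of_real_power)
  have normSR: "norm (S (R g)) = k g" if "g \<in> G" for g
  proof -
    have "(norm (S (R g)))\<^sup>2 = (k g)\<^sup>2"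
      using SRg[OF that that] unfolding cinner_self by (simp del: of_real_power)
    then show ?thesis
      by (rule power2_eq_imp_eq) (use l[OF that] in \<open>simp_all add: k_def\<close>)
  qed
  have SR_u: "S (R g) = k g *\<^sub>R u g" if "g \<in> G" for g
  proof (cases "k g = 0")
    case True
    then have "S (R g) = 0"
      using normSR[OF that] by simp
    then show ?thesis
      using True by simp
  qed (simp add: u_def)
  have u_on: "orthonormal {g \<in> G. k g > 0} u"
    by (auto simp: orthonormal_def u_def cinner_scaleR_left cinner_scaleR_right SRg power2_eq_square)
  have u_le: "norm (u g) \<le> 1" if "g \<in> G" for g
    using normSR[OF that] l[OF that] by (cases "k g = 0") (auto simp: u_def k_def)
  have "k summable_on G"
  proof (rule nonneg_bounded_partial_sums_imp_summable_on[where C = "sqrt c * sqrt a"])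
    show "\<forall>\<^sub>F F in finite_subsets_at_top G. sum k F \<le> sqrt c * sqrt a"
    proof (rule eventually_finite_subsets_at_top_weakI)
      fix F
      assume F: "finite F" "F \<subseteq> G"
      define F' where "F' = {g \<in> F. k g > 0}"
      have F': "finite F'" "F' \<subseteq> G" "\<And>g. g \<in> F' \<Longrightarrow> k g > 0"
        using F by (auto simp: F'_def)
      have uF: "orthonormal F' u"
        using F' by (intro orthonormal_subset[OF u_on]) auto
      have gF: "orthonormal F' (\<lambda>g. g)"
        by (rule orthonormal_subset[OF on F'(2)])
      have "sum k F = sum k F'"
        unfolding F'_def using F l by (intro sum.mono_neutral_right) (auto simp: k_def subset_iff less_le)
      also have "\<dots> = (\<Sum>g\<in>F'. cmod (cinner (u g) (S (R g))))"
      proof (intro sum.cong refl)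
        fix g
        assume g: "g \<in> F'"
        then have "g \<in> G" "0 < k g"
          using F' by blast+
        then show "k g = cmod (cinner (u g) (S (R g)))"
          using uF g by (simp add: SR_u cinner_scaleR_right orthonormal_def)
      qed
      also have "\<dots> \<le> sqrt c * sqrt a"
        unfolding R_def S_def using F' onb_mem[OF G] uK
        by (intro sqrt_product_family_le[OF A C gF _ uF]) auto
      finally show "sum k F \<le> sqrt c * sqrt a" .
    qed
  qed (use l in \<open>auto simp: k_def\<close>)
  then obtain s where s: "(k has_sum s) G"
    by (auto simp: summable_on_def)
  have trB: "has_trace K B s"
    by (rule has_trace_diag[OF G B(1) _ s]) (simp add: Bg k_def)
  have "op_sqrt K M = B"
    by (rule op_sqrt_eqI[OF B])
  then have "fidelity A C = s"
    using op_trace_eq[OF positive_selfadj[OF B(1)] trB] by (simp add: fidelity_def M_def R_def)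
  then show ?thesis
    using G l uK SR_u u_on u_le s
    by (intro exI[of _ G] exI[of _ u] exI[of _ k]) (auto simp: k_def R_def S_def)
qed

text \<open>In the singular value expansion of the left-hand side each singular value has a weight of at
  most \<open>1\<close>, by \<open>sum_rank_one_le\<close>.\<close>

lemma fidelity_family_ge:
  assumes A: "positive_op K A" "has_trace K A a" and C: "positive_op K C" "has_trace K C c"
    and v: "orthonormal I v" "\<And>i. i \<in> I \<Longrightarrow> v i \<in> K"
    and w: "orthonormal I w" "\<And>i. i \<in> I \<Longrightarrow> w i \<in> K" and fin: "finite I"
  shows "(\<Sum>i\<in>I. cmod (cinner (w i) (op_sqrt K C (op_sqrt K A (v i))))) \<le> fidelity A C"
proof -
  define R where "R = op_sqrt K A"
  define S where "S = op_sqrt K C"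
  have R: "positive_op K R" and S: "positive_op K S"
    using op_sqrt[OF A] op_sqrt[OF C] by (auto simp: R_def S_def)
  note bR = positive_op_bounded[OF R] and bS = positive_op_bounded[OF S]
  obtain G u l where G: "onb K G" and l: "\<And>g. g \<in> G \<Longrightarrow> 0 \<le> l g" and u: "\<And>g. g \<in> G \<Longrightarrow> norm (u g) \<le> 1"
    and SR: "\<And>g. g \<in> G \<Longrightarrow> S (R g) = l g *\<^sub>R u g" and hs: "(l has_sum fidelity A C) G"
    using fidelity_svd[OF A C] unfolding R_def S_def by blast
  define z where "z i = cinner (w i) (S (R (v i)))" for i
  \<comment> \<open>Unimodular factors that make the numbers \<open>z i\<close> nonnegative, so that the sum becomes linear in them.\<close>
  define \<theta> where "\<theta> i = (if z i = 0 then 1 else cnj (z i) / complex_of_real (cmod (z i)))" for i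
  have \<theta>: "cmod (\<theta> i) = 1" "Re (\<theta> i * z i) = cmod (z i)" for i
  proof -
    have "\<theta> i * z i = complex_of_real (cmod (z i))"
      using mult_cnj_cmod(2)[of "z i"] by (auto simp: \<theta>_def power2_eq_square)
    then show "Re (\<theta> i * z i) = cmod (z i)"
      by simp
  qed (auto simp: \<theta>_def norm_divide)
  have hz: "((\<lambda>g. complex_of_real (l g) * (cinner (w i) (u g) * cinner g (v i))) has_sum z i) G" if i: "i \<in> I" for i
  proof -
    have z: "cinner (R (S (w i))) (v i) = z i"
      unfolding z_def by (rule sqrt_product_adj[OF S R w(2)[OF i] v(2)[OF i]])
    have "((\<lambda>g. cinner (R (S (w i))) g * cinner g (v i)) has_sum z i) G"
      using onb_parseval[OF G v(2)[OF i]] unfolding z[symmetric] .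
    moreover have "cinner (R (S (w i))) g = complex_of_real (l g) * cinner (w i) (u g)" if "g \<in> G" for g
      using sqrt_product_adj[OF S R w(2)[OF i] onb_mem[OF G that]] SR[OF that] by (simp add: cinner_scaleR_right)
    ultimately show ?thesis
      by (simp add: mult.assoc cong: has_sum_cong)
  qed
  have "((\<lambda>g. \<Sum>i\<in>I. Re (\<theta> i * (complex_of_real (l g) * (cinner (w i) (u g) * cinner g (v i)))))
      has_sum (\<Sum>i\<in>I. Re (\<theta> i * z i))) G"
    by (intro has_sum_sum has_sum_Re has_sum_cmult_right hz)
  moreover have "(\<Sum>i\<in>I. Re (\<theta> i * (complex_of_real (l g) * (cinner (w i) (u g) * cinner g (v i))))) \<le> l g"
    if g: "g \<in> G" for g
  proof -
    have "(\<Sum>i\<in>I. Re (\<theta> i * (complex_of_real (l g) * (cinner (w i) (u g) * cinner g (v i)))))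
        \<le> (\<Sum>i\<in>I. l g * (cmod (cinner (w i) (u g)) * cmod (cinner g (v i))))"
    proof (intro sum_mono)
      fix i
      have "Re (\<theta> i * (complex_of_real (l g) * (cinner (w i) (u g) * cinner g (v i))))
          \<le> cmod (\<theta> i * (complex_of_real (l g) * (cinner (w i) (u g) * cinner g (v i))))"
        by (rule complex_Re_le_cmod)
      then show "Re (\<theta> i * (complex_of_real (l g) * (cinner (w i) (u g) * cinner g (v i))))
          \<le> l g * (cmod (cinner (w i) (u g)) * cmod (cinner g (v i)))"
        using l[OF g] by (simp add: norm_mult \<theta>)
    qed
    also have "\<dots> = l g * (\<Sum>i\<in>I. cmod (cinner (w i) (u g)) * cmod (cinner g (v i)))"
      by (simp add: sum_distrib_left)
    also have "\<dots> \<le> l g * (norm (u g) * norm g)"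
      by (intro mult_left_mono sum_rank_one_le v w fin l g)
    also have "\<dots> \<le> l g * (1 * 1)"
      using l[OF g] u[OF g] orthonormal_norm[OF onb_orthonormal[OF G] g]
      by (intro mult_left_mono) auto
    finally show ?thesis
      by simp
  qed
  ultimately have "(\<Sum>i\<in>I. Re (\<theta> i * z i)) \<le> fidelity A C"
    by (rule has_sum_mono[OF _ hs])
  then show ?thesis
    unfolding \<theta>(2) by (simp add: z_def R_def S_def)
qed

lemma fidelity_leI:
  assumes A: "positive_op K A" "has_trace K A a" and C: "positive_op K C" "has_trace K C c"
    and le: "\<And>F v w. \<lbrakk>finite F; orthonormal F v; orthonormal F w;
        \<And>g. g \<in> F \<Longrightarrow> v g \<in> K; \<And>g. g \<in> F \<Longrightarrow> w g \<in> K\<rbrakk>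
      \<Longrightarrow> (\<Sum>g\<in>(F :: 'a set). cmod (cinner (w g) (op_sqrt K C (op_sqrt K A (v g))))) \<le> t"
  shows "fidelity A C \<le> t"
proof -
  obtain G u l where G: "onb K G" and l: "\<And>g. g \<in> G \<Longrightarrow> 0 \<le> l g" and u: "orthonormal {g \<in> G. l g > 0} u"
    and uK: "\<And>g. g \<in> G \<Longrightarrow> u g \<in> K"
    and SR: "\<And>g. g \<in> G \<Longrightarrow> op_sqrt K C (op_sqrt K A g) = l g *\<^sub>R u g" and hs: "(l has_sum fidelity A C) G"
    using fidelity_svd[OF A C] by blast
  show ?thesis
  proof (rule has_sum_le_finite_sums[OF hs])
    fix F
    assume F: "finite F" "F \<subseteq> G"
    define F' where "F' = {g \<in> F. l g > 0}"
    have F': "finite F'" "F' \<subseteq> G" "F' \<subseteq> {g \<in> G. l g > 0}"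
      using F by (auto simp: F'_def)
    have uF: "orthonormal F' u"
      by (rule orthonormal_subset[OF u F'(3)])
    have "sum l F = sum l F'"
      unfolding F'_def using F l by (intro sum.mono_neutral_right) (auto simp: subset_iff not_less order_antisym)
    also have "\<dots> = (\<Sum>g\<in>F'. cmod (cinner (u g) (op_sqrt K C (op_sqrt K A g))))"
    proof (intro sum.cong refl)
      fix g
      assume g: "g \<in> F'"
      then have "op_sqrt K C (op_sqrt K A g) = l g *\<^sub>R u g" "0 \<le> l g"
        using F' SR l by blast+
      then show "l g = cmod (cinner (u g) (op_sqrt K C (op_sqrt K A g)))"
        using uF g by (simp add: cinner_scaleR_right orthonormal_def)
    qed
    also have "\<dots> \<le> t"
      using F' uK onb_mem[OF G] by (intro le uF orthonormal_subset[OF onb_orthonormal[OF G] F'(2)]) auto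
    finally show "sum l F \<le> t" .
  qed
qed

text \<open>As the \<open>q\<^sub>i\<close> exhaust the trace of \<open>\<rho>\<close>, all other vectors of a basis extending them are annihilated by
  \<open>\<surd>\<rho>\<close>. Hence \<open>\<surd>\<sigma> \<surd>\<rho>\<close> is the finite sum of the rank-one operators \<open>|\<surd>\<sigma> q\<^sub>i\<rangle>\<langle>\<surd>\<rho> q\<^sub>i|\<close>.\<close>

lemma fidelity_supported_le:
  assumes \<rho>: "\<rho> \<in> states K" and \<sigma>: "\<sigma> \<in> states K"
    and q: "orthonormal I q" "finite I" "\<And>i. i \<in> I \<Longrightarrow> q i \<in> K"
    and supp: "(\<Sum>i\<in>I. quad \<rho> (q i)) = 1"
  shows "fidelity \<rho> \<sigma> \<le> sqrt (\<Sum>i\<in>I. quad \<sigma> (q i))"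
proof -
  have \<rho>': "positive_op K \<rho>" "has_trace K \<rho> 1" and \<sigma>': "positive_op K \<sigma>" "has_trace K \<sigma> 1"
    using \<rho> \<sigma> by (auto simp: states_iff)
  define R where "R = op_sqrt K \<rho>"
  define S where "S = op_sqrt K \<sigma>"
  have R: "positive_op K R" and S: "positive_op K S"
    using op_sqrt[OF \<rho>'] op_sqrt[OF \<sigma>'] by (auto simp: R_def S_def)
  note sR = positive_selfadj[OF R] and sS = positive_selfadj[OF S]
  note bR = positive_op_bounded[OF R] and bS = positive_op_bounded[OF S]
  obtain E where E: "onb K E" "q ` I \<subseteq> E"
    using onb_extend_orthonormal[of "q ` I"] q orthonormal_image by blast
  have "R e = 0" if e: "e \<in> E - q ` I" for e
  proof -
    have "(\<Sum>f\<in>insert e (q ` I). quad \<rho> f) \<le> 1"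
      using E q(2) e positive_op_nonneg[OF \<rho>'(1) onb_mem[OF E(1)]]
      by (intro finite_sum_le_has_sum[OF has_traceD[OF \<rho>'(2) E(1)]]) auto
    then have "quad \<rho> e \<le> 0"
      using e q(2) supp by (simp add: sum.reindex[OF orthonormal_inj_on[OF q(1)]] o_def)
    then have "(norm (R e))\<^sup>2 \<le> 0"
      using norm_op_sqrt[OF \<rho>' onb_mem[OF E(1)], of e] e by (simp add: R_def)
    then show ?thesis
      by simp
  qed
  then have expand: "cinner w (S (R v)) = (\<Sum>i\<in>I. cinner w (S (q i)) * cinner (R (q i)) v)"
    if "w \<in> K" "v \<in> K" for v w
  proof -
    have "((\<lambda>e. cinner (S w) e * cinner e (R v)) has_sum cinner w (S (R v))) E"
      using onb_parseval[OF E(1) op_mem[OF bR], of "S w"]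
      unfolding selfadjD(2)[OF sS that(1) op_mem[OF bR]] .
    moreover have "cinner (S w) e * cinner e (R v) = cinner w (S e) * cinner (R e) v" if "e \<in> E" for e
      using selfadjD(2)[OF sS \<open>w \<in> K\<close> onb_mem[OF E(1) that]] selfadjD(2)[OF sR onb_mem[OF E(1) that] \<open>v \<in> K\<close>]
      by simp
    ultimately have "((\<lambda>e. cinner w (S e) * cinner (R e) v) has_sum cinner w (S (R v))) E"
      by (simp cong: has_sum_cong)
    moreover have "((\<lambda>e. cinner w (S e) * cinner (R e) v) has_sum
        (\<Sum>e\<in>q ` I. cinner w (S e) * cinner (R e) v)) E"
      using \<open>\<And>e. e \<in> E - q ` I \<Longrightarrow> R e = 0\<close> E(2) q(2)
      by (intro has_sum_finite_neutralI[of "q ` I"]) auto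
    ultimately have "cinner w (S (R v)) = (\<Sum>e\<in>q ` I. cinner w (S e) * cinner (R e) v)"
      by (rule has_sum_unique)
    then show ?thesis
      by (simp add: sum.reindex[OF orthonormal_inj_on[OF q(1)]] o_def)
  qed
  show ?thesis
  proof (rule fidelity_leI[OF \<rho>' \<sigma>'], fold R_def S_def)
    fix F and v w :: "'a \<Rightarrow> 'a"
    assume F: "finite F" and v: "orthonormal F v" "\<And>g. g \<in> F \<Longrightarrow> v g \<in> K"
      and w: "orthonormal F w" "\<And>g. g \<in> F \<Longrightarrow> w g \<in> K"
    have "(\<Sum>g\<in>F. cmod (cinner (w g) (S (R (v g)))))
        \<le> (\<Sum>g\<in>F. \<Sum>i\<in>I. cmod (cinner (w g) (S (q i))) * cmod (cinner (R (q i)) (v g)))"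
      using v w by (intro sum_mono) (auto simp: expand intro!: sum_norm_le[OF eq_refl] norm_mult)
    also have "\<dots> = (\<Sum>i\<in>I. \<Sum>g\<in>F. cmod (cinner (w g) (S (q i))) * cmod (cinner (R (q i)) (v g)))"
      by (rule sum.swap)
    also have "\<dots> \<le> (\<Sum>i\<in>I. norm (S (q i)) * norm (R (q i)))"
      by (intro sum_mono sum_rank_one_le v w F)
    also have "\<dots> \<le> sqrt (\<Sum>i\<in>I. (norm (S (q i)))\<^sup>2) * sqrt (\<Sum>i\<in>I. (norm (R (q i)))\<^sup>2)"
      by (rule sum_mult_le_sqrt)
    also have "(\<Sum>i\<in>I. (norm (R (q i)))\<^sup>2) = 1"
      unfolding R_def supp[symmetric] by (intro sum.cong refl norm_op_sqrt[OF \<rho>'] q(3))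
    also have "(\<Sum>i\<in>I. (norm (S (q i)))\<^sup>2) = (\<Sum>i\<in>I. quad \<sigma> (q i))"
      unfolding S_def by (intro sum.cong refl norm_op_sqrt[OF \<sigma>'] q(3))
    finally show "(\<Sum>g\<in>F. cmod (cinner (w g) (S (R (v g))))) \<le> sqrt (\<Sum>i\<in>I. quad \<sigma> (q i))"
      by simp
  qed
qed

lemma fidelity_le_1: "\<rho> \<in> states K \<Longrightarrow> \<sigma> \<in> states K \<Longrightarrow> fidelity \<rho> \<sigma> \<le> 1"
  using sqrt_product_family_le[of \<rho> 1 \<sigma> 1] by (intro fidelity_leI[of \<rho> 1 \<sigma> 1]) (auto simp: states_iff)

end

section \<open>Conjugation by unitaries and antiunitaries\<close>

text \<open>Unitaries and antiunitaries are treated together: \<open>s\<close> is the identity or complex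
  conjugation.\<close>

definition symmetry_via :: "'a::chilbert_space set \<Rightarrow> (complex \<Rightarrow> complex) \<Rightarrow> ('a \<Rightarrow> 'a) \<Rightarrow> bool" where
  "symmetry_via K s U \<longleftrightarrow> (s = (\<lambda>c. c) \<or> s = cnj) \<and> U ` K = K \<and> (\<forall>x\<in>K. \<forall>y\<in>K. U (x + y) = U x + U y) \<and>
     (\<forall>c. \<forall>x\<in>K. U (c *\<^sub>C x) = s c *\<^sub>C U x) \<and> (\<forall>x\<in>K. \<forall>y\<in>K. cinner (U x) (U y) = s (cinner x y))"

lemma symmetry_via_iff: "unitary_on K U \<or> antiunitary_on K U \<longleftrightarrow> (\<exists>s. symmetry_via K s U)"
  unfolding unitary_on_def antiunitary_on_def symmetry_via_def by auto

context hilbert_subspace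
begin

context
  fixes s U
  assumes U: "symmetry_via K s U"
begin

lemma sym_s: "s (s c) = c" "Re (s c) = Re c" "cmod (s c) = cmod c" "s 0 = 0" "s 1 = 1" "s c \<in> \<real>\<^sub>\<ge>\<^sub>0 \<longleftrightarrow> c \<in> \<real>\<^sub>\<ge>\<^sub>0"
  using U by (auto simp: symmetry_via_def complex_nonneg_Reals_iff)

lemma sym_image: "U ` K = K"
  and sym_add: "x \<in> K \<Longrightarrow> y \<in> K \<Longrightarrow> U (x + y) = U x + U y"
  and sym_scaleC: "x \<in> K \<Longrightarrow> U (c *\<^sub>C x) = s c *\<^sub>C U x"
  and sym_cinner: "x \<in> K \<Longrightarrow> y \<in> K \<Longrightarrow> cinner (U x) (U y) = s (cinner x y)"
  using U by (auto simp: symmetry_via_def)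

lemma sym_mem: "x \<in> K \<Longrightarrow> U x \<in> K"
  using sym_image by blast

lemma sym_inner: "x \<in> K \<Longrightarrow> y \<in> K \<Longrightarrow> inner (U x) (U y) = inner x y"
  by (metis Re_cinner sym_cinner sym_s(2))

lemma sym_norm: "x \<in> K \<Longrightarrow> norm (U x) = norm x"
  by (simp add: norm_eq_sqrt_inner sym_inner)

lemma sym_inj: "inj_on U K"
proof (rule inj_onI)
  fix x y
  assume xy: "x \<in> K" "y \<in> K"
  have "(norm (x - y))\<^sup>2 = (norm (U x - U y))\<^sup>2"
    using xy by (simp only: norm_diff_squared sym_inner sym_norm)
  then show "x = y" if "U x = U y"
    using that by simp
qed

abbreviation V where "V \<equiv> inv_into K U"

lemma sym_inv_mem: "x \<in> K \<Longrightarrow> V x \<in> K"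
  using sym_image inv_into_into by metis

lemma sym_inv: "x \<in> K \<Longrightarrow> U (V x) = x"
  using sym_image f_inv_into_f by metis

lemma sym_inv': "x \<in> K \<Longrightarrow> V (U x) = x"
  using sym_inj by simp

lemma sym_inv_add: "x \<in> K \<Longrightarrow> y \<in> K \<Longrightarrow> V (x + y) = V x + V y"
  by (metis add_mem sym_add sym_inv sym_inv' sym_inv_mem)

lemma sym_inv_scaleC: "x \<in> K \<Longrightarrow> V (c *\<^sub>C x) = s c *\<^sub>C V x"
  by (metis scaleC_mem sym_scaleC sym_inv sym_inv' sym_inv_mem sym_s(1))

lemma sym_inv_norm: "x \<in> K \<Longrightarrow> norm (V x) = norm x"
  by (metis sym_norm sym_inv sym_inv_mem)

lemma conj_by_apply: "x \<in> K \<Longrightarrow> conj_by K U A x = U (A (V x))"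
  by (simp add: conj_by_def)

lemma conj_by_bounded:
  assumes A: "A \<in> bounded_ops K"
  shows "conj_by K U A \<in> bounded_ops K"
proof -
  obtain C where C: "0 < C" "\<And>x. x \<in> K \<Longrightarrow> norm (A x) \<le> C * norm x"
    using op_bound[OF A] by metis
  have "norm (U (A (V x))) \<le> C * norm x" if "x \<in> K" for x
    using C(2)[OF sym_inv_mem[OF that]] that by (simp add: sym_norm op_mem[OF A] sym_inv_norm)
  moreover have "U (A (V (x + y))) = U (A (V x)) + U (A (V y))" if "x \<in> K" "y \<in> K" for x y
    using that by (simp add: sym_inv_add opD(3)[OF A] sym_inv_mem sym_add op_mem[OF A])
  moreover have "U (A (V (c *\<^sub>C x))) = c *\<^sub>C U (A (V x))" if "x \<in> K" for x c
    using that by (simp add: sym_inv_scaleC opD(4)[OF A] sym_inv_mem sym_scaleC op_mem[OF A] sym_s)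
  ultimately show ?thesis
    unfolding bounded_ops_def by (auto simp: conj_by_def add_mem scaleC_mem sym_mem op_mem[OF A])
qed

lemma conj_by_cinner:
  assumes A: "A \<in> bounded_ops K" and x: "x \<in> K"
  shows "cinner x (conj_by K U A x) = s (cinner (V x) (A (V x)))"
proof -
  have "cinner x (conj_by K U A x) = cinner (U (V x)) (U (A (V x)))"
    using x by (simp add: conj_by_apply sym_inv)
  also have "\<dots> = s (cinner (V x) (A (V x)))"
    using x by (intro sym_cinner sym_inv_mem op_mem[OF A])
  finally show ?thesis .
qed

lemma conj_by_form:
  "A \<in> bounded_ops K \<Longrightarrow> x \<in> K \<Longrightarrow> quad (conj_by K U A) x = quad A (V x)"
  by (simp add: conj_by_cinner sym_s)

lemma conj_by_positive: "positive_op K A \<Longrightarrow> positive_op K (conj_by K U A)"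
  by (auto simp: positive_op_def conj_by_bounded conj_by_cinner sym_s sym_inv_mem)

lemma symmetry_onb:
  assumes E: "onb K E"
  shows "onb K (U ` E)"
proof (rule onbI)
  show "U ` E \<subseteq> K"
    using onb_mem[OF E] sym_mem by blast
  have "orthonormal E U"
    using onb_orthonormal[OF E] onb_mem[OF E] by (auto simp: orthonormal_def sym_cinner sym_s)
  then show "orthonormal (U ` E) (\<lambda>e. e)"
    by (rule orthonormal_image)
  fix x
  assume x: "x \<in> K" and ortho: "\<And>e. e \<in> U ` E \<Longrightarrow> cinner e x = 0"
  have "cinner e (V x) = 0" if e: "e \<in> E" for e
  proof -
    have "s (cinner e (V x)) = cinner (U e) (U (V x))"
      by (rule sym_cinner[symmetric, OF onb_mem[OF E e] sym_inv_mem[OF x]])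
    also have "\<dots> = 0"
      using ortho e x by (simp add: sym_inv)
    finally show ?thesis
      by (metis sym_s(1,4))
  qed
  then have "V x = 0"
    by (intro onb_eqI[OF E sym_inv_mem[OF x]]) auto
  then show "x = 0"
    using sym_inv_norm[OF x] by simp
qed

lemma conj_by_trace:
  assumes A: "positive_op K A" and t: "has_trace K A t"
  shows "has_trace K (conj_by K U A) t"
proof -
  obtain E where E: "onb K E"
    using onb_exists by blast
  have "((\<lambda>e. quad (conj_by K U A) e) \<circ> U has_sum t) E"
    using has_traceD[OF t E] onb_mem[OF E]
    by (simp add: o_def conj_by_form[OF positive_op_bounded[OF A]] sym_mem sym_inv' cong: has_sum_cong)
  then have "((\<lambda>e. quad (conj_by K U A) e) has_sum t) (U ` E)"
    using onb_mem[OF E] by (subst has_sum_reindex) (auto intro: inj_on_subset[OF sym_inj])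
  then show ?thesis
    by (rule has_traceI[OF conj_by_positive[OF A] symmetry_onb[OF E]])
qed

lemma conj_by_states: "\<rho> \<in> states K \<Longrightarrow> conj_by K U \<rho> \<in> states K"
  by (simp add: states_iff conj_by_positive conj_by_trace)

lemma conj_by_sqrt:
  assumes A: "positive_op K A" "has_trace K A t"
  shows "op_sqrt K (conj_by K U A) = conj_by K U (op_sqrt K A)"
proof (rule op_sqrt_eqI[OF conj_by_positive[OF op_sqrt(1)[OF A]]])
  note bR = positive_op_bounded[OF op_sqrt(1)[OF A]]
  have "U 0 = 0" "V 0 = 0" "op_sqrt K A 0 = 0"
    using sym_norm[OF zero_mem] sym_inv_norm[OF zero_mem] op_zero[OF bR] by simp_all
  then have "conj_by K U (op_sqrt K A) (conj_by K U (op_sqrt K A) x) = conj_by K U A x" for x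
    using fun_cong[OF op_sqrt(2)[OF A], of "V x"]
    by (auto simp: conj_by_def sym_inv' op_mem[OF bR] sym_mem)
  then show "conj_by K U (op_sqrt K A) \<circ> conj_by K U (op_sqrt K A) = conj_by K U A"
    by (simp add: fun_eq_iff)
qed

end

end

section \<open>Phase operators\<close>

text \<open>For orthonormal \<open>f\<close>, multiplication of \<open>f k\<close> by \<open>w k\<close>, and the identity on the orthogonal complement.\<close>

definition phase_op :: "nat \<Rightarrow> (nat \<Rightarrow> 'a) \<Rightarrow> (nat \<Rightarrow> complex) \<Rightarrow> 'a \<Rightarrow> 'a::complex_inner" where
  "phase_op m f w x = x + (\<Sum>k<m. ((w k - 1) * cinner (f k) x) *\<^sub>C f k)"

locale phases = hilbert_subspace K for K :: "'a::chilbert_space set" +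
  fixes m :: nat and f :: "nat \<Rightarrow> 'a"
  assumes f_orthonormal: "orthonormal {..<m} f" and f_mem: "\<And>k. k < m \<Longrightarrow> f k \<in> K"
begin

abbreviation W where "W \<equiv> phase_op m f"

lemma phase_coef: "k < m \<Longrightarrow> cinner (f k) (W w x) = w k * cinner (f k) x"
  unfolding phase_op_def cinner_add_right
  by (subst cinner_orthonormal_sum[OF f_orthonormal finite_lessThan]) (simp_all add: algebra_simps)

lemma phase_comp: "W v (W w x) = W (\<lambda>k. v k * w k) x"
proof -
  have "W v (W w x) = W w x + (\<Sum>k<m. ((v k - 1) * (w k * cinner (f k) x)) *\<^sub>C f k)"
    by (subst phase_op_def[of m f v]) (simp add: phase_coef)
  also have "\<dots> = x + (\<Sum>k<m. ((w k - 1) * cinner (f k) x + (v k - 1) * (w k * cinner (f k) x)) *\<^sub>C f k)"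
    by (simp add: phase_op_def scaleC_add_left sum.distrib)
  also have "\<dots> = W (\<lambda>k. v k * w k) x"
    unfolding phase_op_def
    by (intro arg_cong2[of _ _ _ _ "(+)"] refl sum.cong arg_cong2[of _ _ _ _ scaleC]) (simp add: algebra_simps)
  finally show ?thesis .
qed

lemma phase_trivial: "(\<And>k. k < m \<Longrightarrow> w k = 1) \<Longrightarrow> W w x = x"
  by (simp add: phase_op_def)

lemma phase_cong: "(\<And>k. k < m \<Longrightarrow> v k = w k) \<Longrightarrow> W v x = W w x"
  by (simp add: phase_op_def)

lemma phase_adj: "cinner (W w x) y = cinner x (W (\<lambda>k. cnj (w k)) y)"
proof -
  have "(\<Sum>k<m. cnj ((w k - 1) * cinner (f k) x) * cinner (f k) y)
      = (\<Sum>k<m. (cnj (w k) - 1) * cinner (f k) y * cinner x (f k))"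
    by (intro sum.cong refl) (simp flip: cinner_commute[of x])
  then show ?thesis
    by (simp add: phase_op_def cinner_add_left cinner_add_right cinner_sum_left cinner_sum_right
        cinner_scaleC_left cinner_scaleC_right)
qed

lemma phase_mem: "x \<in> K \<Longrightarrow> W w x \<in> K"
  unfolding phase_op_def using f_mem by (intro add_mem sum_mem scaleC_mem) auto

definition unimodular :: "(nat \<Rightarrow> complex) \<Rightarrow> bool" where
  "unimodular w \<longleftrightarrow> (\<forall>k<m. cmod (w k) = 1)"

lemma unimodular_cnj: "unimodular w \<Longrightarrow> unimodular (\<lambda>k. cnj (w k))"
  by (simp add: unimodular_def)

lemma unimodular_mult_cnj: "unimodular w \<Longrightarrow> k < m \<Longrightarrow> w k * cnj (w k) = 1" "unimodular w \<Longrightarrow> k < m \<Longrightarrow> cnj (w k) * w k = 1"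
  by (simp_all add: unimodular_def mult_cnj_cmod)

lemma phase_inverse:
  assumes "unimodular w"
  shows "W w (W (\<lambda>k. cnj (w k)) x) = x" "W (\<lambda>k. cnj (w k)) (W w x) = x"
  using unimodular_mult_cnj[OF assms] by (auto simp: phase_comp intro: phase_trivial)

lemma phase_cinner:
  assumes "unimodular w"
  shows "cinner (W w x) (W w y) = cinner x y"
  by (simp add: phase_adj phase_inverse[OF assms])

lemma phase_symmetry:
  assumes w: "unimodular w"
  shows "symmetry_via K (\<lambda>c. c) (W w)"
proof -
  have "K \<subseteq> W w ` K"
    using phase_inverse(1)[OF w] phase_mem by (metis image_iff subsetI)
  then have "W w ` K = K"
    using phase_mem by blast
  moreover have "W w (x + y) = W w x + W w y" for x y
    by (simp add: phase_op_def cinner_add_right distrib_left scaleC_add_left sum.distrib)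
  moreover have "W w (c *\<^sub>C x) = c *\<^sub>C W w x" for c x
    by (simp add: phase_op_def cinner_scaleC_right scaleC_add_right complex_vector.scale_sum_right
        scaleC_scaleC mult_ac)
  ultimately show ?thesis
    by (simp add: symmetry_via_def phase_cinner[OF w])
qed

lemma phase_inv_into:
  assumes w: "unimodular w" and x: "x \<in> K"
  shows "inv_into K (W w) x = W (\<lambda>k. cnj (w k)) x"
  using sym_inj[OF phase_symmetry[OF w]] phase_mem[OF x] phase_inverse(1)[OF w]
  by (intro inv_into_f_eq) auto

definition rot :: "(nat \<Rightarrow> complex) \<Rightarrow> ('a \<Rightarrow> 'a) \<Rightarrow> 'a \<Rightarrow> 'a" where
  "rot w A = conj_by K (W w) A"

lemma rot_apply: "unimodular w \<Longrightarrow> x \<in> K \<Longrightarrow> rot w A x = W w (A (W (\<lambda>k. cnj (w k)) x))"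
  by (simp add: rot_def conj_by_def phase_inv_into)

lemma rot_outside: "x \<notin> K \<Longrightarrow> rot w A x = 0"
  by (simp add: rot_def conj_by_def)

lemma rot_form:
  assumes w: "unimodular w" and "A \<in> bounded_ops K" "x \<in> K"
  shows "quad (rot w A) x = quad A (W (\<lambda>k. cnj (w k)) x)"
  using conj_by_form[OF phase_symmetry[OF w] assms(2,3)] by (simp add: rot_def phase_inv_into assms)

lemma rot_positive: "unimodular w \<Longrightarrow> positive_op K A \<Longrightarrow> positive_op K (rot w A)"
  unfolding rot_def by (rule conj_by_positive[OF phase_symmetry])

lemma rot_trace: "unimodular w \<Longrightarrow> positive_op K A \<Longrightarrow> has_trace K A t \<Longrightarrow> has_trace K (rot w A) t"
  unfolding rot_def by (rule conj_by_trace[OF phase_symmetry])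

lemma rot_states: "unimodular w \<Longrightarrow> \<rho> \<in> states K \<Longrightarrow> rot w \<rho> \<in> states K"
  by (simp add: states_iff rot_positive rot_trace)

lemma rot_inverse:
  assumes w: "unimodular w" and A: "A \<in> bounded_ops K"
  shows "rot (\<lambda>k. cnj (w k)) (rot w A) = A"
proof
  fix x
  show "rot (\<lambda>k. cnj (w k)) (rot w A) x = A x"
    using w by (cases "x \<in> K")
      (simp_all add: rot_apply unimodular_cnj phase_mem phase_inverse rot_outside opD(2)[OF A])
qed

lemma rot_cong: "(\<And>k. k < m \<Longrightarrow> v k = w k) \<Longrightarrow> rot v A = rot w A"
proof -
  assume "\<And>k. k < m \<Longrightarrow> v k = w k"
  then have "W v = W w"
    by (intro ext phase_cong)
  then show ?thesis
    by (simp add: rot_def)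
qed

definition level :: "('a \<Rightarrow> 'a) \<Rightarrow> nat \<Rightarrow> real" where
  "level A k = quad A (f k)"

lemma phase_f:
  assumes "k < m"
  shows "W w (f k) = w k *\<^sub>C f k"
proof -
  have "(\<Sum>j<m. ((w j - 1) * cinner (f j) (f k)) *\<^sub>C f j) = (\<Sum>j<m. if j = k then (w k - 1) *\<^sub>C f k else 0)"
    using f_orthonormal assms by (intro sum.cong) (auto simp: orthonormal_def)
  then show ?thesis
    using assms by (simp add: phase_op_def complex_vector.scale_left_diff_distrib)
qed

text \<open>Each \<open>f k\<close> is an eigenvector of the phase operator. That the levels survive makes conjugation by
  level-dependent phases invertible.\<close>

lemma rot_level:
  assumes w: "unimodular w" and A: "A \<in> bounded_ops K" and k: "k < m"
  shows "level (rot w A) k = level A k"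
proof -
  have "level (rot w A) k = quad A (cnj (w k) *\<^sub>C f k)"
    using k by (simp add: level_def rot_form[OF w A] f_mem phase_f)
  also have "\<dots> = Re ((w k * cnj (w k)) * cinner (f k) (A (f k)))"
    using k by (simp add: f_mem opD(4)[OF A] cinner_scaleC_left cinner_scaleC_right mult_ac)
  finally show ?thesis
    using unimodular_mult_cnj[OF w k] by (simp add: level_def)
qed

lemma level_nonneg: "\<rho> \<in> states K \<Longrightarrow> k < m \<Longrightarrow> 0 \<le> level \<rho> k"
  unfolding level_def states_iff by (intro positive_op_nonneg f_mem) auto

lemma level_sum: "\<rho> \<in> states K \<Longrightarrow> (\<Sum>k<m. level \<rho> k) \<le> 1"
  unfolding level_def states_iff using f_orthonormal f_mem by (intro has_trace_family_le) auto

lemma phase_family: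
  assumes "unimodular w" "orthonormal I u"
  shows "orthonormal I (\<lambda>i. W w (u i))"
  using assms by (simp add: orthonormal_def phase_cinner)

section \<open>The effect of phases on the two metrics\<close>

text \<open>The Hilbert--Schmidt norm of \<open>\<Sum>\<^sub>k |c\<^sub>k\<rangle>\<langle>f\<^sub>k|\<close>.\<close>

lemma finite_rank_hilbert_schmidt:
  assumes c: "\<And>k. k < m \<Longrightarrow> c k \<in> K" and u: "orthonormal I u" "finite I" "\<And>i. i \<in> I \<Longrightarrow> u i \<in> K"
  shows "(\<Sum>i\<in>I. (norm (\<Sum>k<m. cinner (f k) (u i) *\<^sub>C c k))\<^sup>2) \<le> (\<Sum>k<m. (norm (c k))\<^sup>2)"
proof -
  obtain G where G: "onb K G"
    using onb_exists by blast
  define z where "z i = (\<Sum>k<m. cinner (f k) (u i) *\<^sub>C c k)" for i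
  have zK: "z i \<in> K" for i
    unfolding z_def using c by (intro sum_mem scaleC_mem) auto
  have "((\<lambda>g. \<Sum>i\<in>I. (cmod (cinner g (z i)))\<^sup>2) has_sum (\<Sum>i\<in>I. (norm (z i))\<^sup>2)) G"
    by (intro has_sum_sum onb_parseval_norm[OF G zK])
  moreover have "((\<lambda>g. \<Sum>k<m. (cmod (cinner g (c k)))\<^sup>2) has_sum (\<Sum>k<m. (norm (c k))\<^sup>2)) G"
    using c by (intro has_sum_sum onb_parseval_norm[OF G]) auto
  moreover have "(\<Sum>i\<in>I. (cmod (cinner g (z i)))\<^sup>2) \<le> (\<Sum>k<m. (cmod (cinner g (c k)))\<^sup>2)" for g
  proof -
    define h where "h = (\<Sum>k<m. cnj (cinner g (c k)) *\<^sub>C f k)"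
    have "cinner g (z i) = cinner h (u i)" for i
      by (simp add: z_def h_def cinner_sum_right cinner_sum_left cinner_scaleC_left cinner_scaleC_right mult.commute)
    then have "(\<Sum>i\<in>I. (cmod (cinner g (z i)))\<^sup>2) = (\<Sum>i\<in>I. (cmod (cinner (u i) h))\<^sup>2)"
      by (simp add: cmod_cinner_commute[of h])
    also have "\<dots> \<le> (norm h)\<^sup>2"
      by (rule bessel_finite[OF u(1,2)])
    also have "\<dots> = (\<Sum>k<m. (cmod (cinner g (c k)))\<^sup>2)"
      unfolding h_def norm_orthonormal_sum[OF f_orthonormal finite_lessThan] by simp
    finally show ?thesis .
  qed
  ultimately have "(\<Sum>i\<in>I. (norm (z i))\<^sup>2) \<le> (\<Sum>k<m. (norm (c k))\<^sup>2)"
    by (rule has_sum_mono)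
  then show ?thesis
    by (simp add: z_def)
qed

text \<open>With \<open>B = \<surd>\<rho>\<close>, \<open>x = W\<^sub>v u\<^sub>i\<close> and \<open>y = W\<^sub>w u\<^sub>i\<close>, each summand is
  \<open>|\<parallel>B x\<parallel>\<^sup>2 - \<parallel>B y\<parallel>\<^sup>2| \<le> \<parallel>B (x - y)\<parallel> (\<parallel>B x\<parallel> + \<parallel>B y\<parallel>)\<close>; the Cauchy--Schwarz inequality sums these up.\<close>

lemma phase_form_change:
  assumes \<rho>: "\<rho> \<in> states K" and v: "unimodular v" and w: "unimodular w"
    and u: "orthonormal I u" "finite I" "\<And>i. i \<in> I \<Longrightarrow> u i \<in> K"
  shows "(\<Sum>i\<in>I. \<bar>quad \<rho> (W v (u i)) - quad \<rho> (W w (u i))\<bar>)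
    \<le> 2 * sqrt (\<Sum>k<m. (cmod (v k - w k))\<^sup>2 * level \<rho> k)"
proof -
  have \<rho>': "positive_op K \<rho>" "has_trace K \<rho> 1"
    using \<rho> by (auto simp: states_iff)
  define B where "B = op_sqrt K \<rho>"
  have bB: "B \<in> bounded_ops K"
    unfolding B_def by (intro positive_op_bounded op_sqrt[OF \<rho>'])
  have nB: "(norm (B x))\<^sup>2 = quad \<rho> x" if "x \<in> K" for x
    unfolding B_def by (rule norm_op_sqrt[OF \<rho>' that])
  define x y where "x i = W v (u i)" and "y i = W w (u i)" for i
  have xK: "x i \<in> K" and yK: "y i \<in> K" if "i \<in> I" for i
    using u(3)[OF that] by (simp_all add: x_def y_def phase_mem)
  have total: "(\<Sum>i\<in>I. (norm (B (W t (u i))))\<^sup>2) \<le> 1" if "unimodular t" for t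
    using has_trace_family_le[OF \<rho>' phase_family[OF that u(1)] u(2)] u(3) by (simp add: nB phase_mem)
  have "B (x i - y i) = (\<Sum>k<m. cinner (f k) (u i) *\<^sub>C ((v k - w k) *\<^sub>C B (f k)))" for i
  proof -
    have "x i - y i = (\<Sum>k<m. ((v k - 1) * cinner (f k) (u i)) *\<^sub>C f k - ((w k - 1) * cinner (f k) (u i)) *\<^sub>C f k)"
      by (simp add: x_def y_def phase_op_def sum_subtractf)
    also have "\<dots> = (\<Sum>k<m. (cinner (f k) (u i) * (v k - w k)) *\<^sub>C f k)"
      by (intro sum.cong refl, subst complex_vector.scale_left_diff_distrib[symmetric]) (simp add: algebra_simps)
    also have "B \<dots> = (\<Sum>k<m. B ((cinner (f k) (u i) * (v k - w k)) *\<^sub>C f k))"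
      using f_mem by (intro op_sum[OF bB]) (auto intro: scaleC_mem)
    also have "\<dots> = (\<Sum>k<m. cinner (f k) (u i) *\<^sub>C ((v k - w k) *\<^sub>C B (f k)))"
      using f_mem by (intro sum.cong refl) (auto simp: opD(4)[OF bB] scaleC_scaleC)
    finally show ?thesis .
  qed
  then have "(\<Sum>i\<in>I. (norm (B (x i - y i)))\<^sup>2) \<le> (\<Sum>k<m. (norm ((v k - w k) *\<^sub>C B (f k)))\<^sup>2)"
    using finite_rank_hilbert_schmidt[OF _ u, of "\<lambda>k. (v k - w k) *\<^sub>C B (f k)"] by (simp add: scaleC_mem op_mem[OF bB])
  also have "\<dots> = (\<Sum>k<m. (cmod (v k - w k))\<^sup>2 * level \<rho> k)"
    by (intro sum.cong refl) (simp add: norm_scaleC power_mult_distrib nB f_mem level_def)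
  finally have diff: "(\<Sum>i\<in>I. (norm (B (x i - y i)))\<^sup>2) \<le> (\<Sum>k<m. (cmod (v k - w k))\<^sup>2 * level \<rho> k)" .
  have "\<bar>quad \<rho> (x i) - quad \<rho> (y i)\<bar>
      \<le> norm (B (x i - y i)) * norm (B (x i)) + norm (B (x i - y i)) * norm (B (y i))" if i: "i \<in> I" for i
  proof -
    have "\<bar>quad \<rho> (x i) - quad \<rho> (y i)\<bar>
        = \<bar>norm (B (x i)) - norm (B (y i))\<bar> * (norm (B (x i)) + norm (B (y i)))"
    proof -
      have "quad \<rho> (x i) - quad \<rho> (y i)
          = (norm (B (x i)) - norm (B (y i))) * (norm (B (x i)) + norm (B (y i)))"
        using nB[OF xK[OF i]] nB[OF yK[OF i]] by (simp add: power2_eq_square algebra_simps)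
      then show ?thesis
        by (simp add: abs_mult)
    qed
    also have "\<dots> \<le> norm (B (x i - y i)) * (norm (B (x i)) + norm (B (y i)))"
      unfolding op_diff[OF bB xK[OF i] yK[OF i]] by (intro mult_right_mono norm_triangle_ineq3) simp
    finally show ?thesis
      by (simp add: distrib_left)
  qed
  then have "(\<Sum>i\<in>I. \<bar>quad \<rho> (x i) - quad \<rho> (y i)\<bar>)
      \<le> (\<Sum>i\<in>I. norm (B (x i - y i)) * norm (B (x i))) + (\<Sum>i\<in>I. norm (B (x i - y i)) * norm (B (y i)))"
    by (simp add: sum_mono flip: sum.distrib)
  also have "\<dots> \<le> sqrt (\<Sum>i\<in>I. (norm (B (x i - y i)))\<^sup>2) * sqrt (\<Sum>i\<in>I. (norm (B (x i)))\<^sup>2)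
      + sqrt (\<Sum>i\<in>I. (norm (B (x i - y i)))\<^sup>2) * sqrt (\<Sum>i\<in>I. (norm (B (y i)))\<^sup>2)"
    by (intro add_mono sum_mult_le_sqrt)
  also have "\<dots> \<le> sqrt (\<Sum>k<m. (cmod (v k - w k))\<^sup>2 * level \<rho> k) * 1
      + sqrt (\<Sum>k<m. (cmod (v k - w k))\<^sup>2 * level \<rho> k) * 1"
    using diff total[OF v] total[OF w] order.trans[OF _ diff, of 0]
    by (intro add_mono mult_mono) (auto simp: x_def y_def sum_nonneg)
  finally show ?thesis
    by (simp add: x_def y_def)
qed

text \<open>The weights make the condition void in a direction where one of the states has level \<open>0\<close>, and
  weak where the levels are very different.\<close>

definition phases_close :: "real \<Rightarrow> (nat \<Rightarrow> complex) \<Rightarrow> (nat \<Rightarrow> complex) \<Rightarrow> ('a \<Rightarrow> 'a) \<Rightarrow> ('a \<Rightarrow> 'a) \<Rightarrow> bool" where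
  "phases_close \<delta> w v \<rho> \<sigma> \<longleftrightarrow> (\<forall>k<m. cmod (w k - v k) * sqrt (min (level \<rho> k) (level \<sigma> k))
     \<le> \<delta> * sqrt (max (level \<rho> k) (level \<sigma> k)))"

lemma weighted_difference_le:
  assumes \<rho>: "\<rho> \<in> states K" and \<sigma>: "\<sigma> \<in> states K" and "0 \<le> \<delta>"
    and le: "\<And>k. k < m \<Longrightarrow> cmod (z k) * sqrt (level \<rho> k) \<le> \<delta> * sqrt (level \<sigma> k)"
  shows "(\<Sum>k<m. (cmod (z k))\<^sup>2 * level \<rho> k) \<le> \<delta>\<^sup>2"
proof -
  have "(cmod (z k))\<^sup>2 * level \<rho> k \<le> \<delta>\<^sup>2 * level \<sigma> k" if k: "k < m" for k
    using power_mono[OF le[OF k], of 2] level_nonneg[OF \<rho> k] level_nonneg[OF \<sigma> k]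
    by (simp add: power_mult_distrib)
  then have "(\<Sum>k<m. (cmod (z k))\<^sup>2 * level \<rho> k) \<le> (\<Sum>k<m. \<delta>\<^sup>2 * level \<sigma> k)"
    by (intro sum_mono) auto
  also have "\<dots> \<le> \<delta>\<^sup>2 * 1"
    unfolding sum_distrib_left[symmetric] by (intro mult_left_mono level_sum \<sigma>) simp
  finally show ?thesis
    by simp
qed

text \<open>A single unitary serves both states: in direction \<open>f\<^sub>k\<close> it uses the phase of the state
  with the larger level, and for the other state the difference is then negligible.\<close>

lemma rot_trace_dist_le:
  assumes \<rho>: "\<rho> \<in> states K" and \<sigma>: "\<sigma> \<in> states K" and w: "unimodular w" and v: "unimodular v"
    and close: "phases_close \<delta> w v \<rho> \<sigma>" and \<delta>: "0 \<le> \<delta>"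
  shows "trace_dist K (rot w \<rho>) (rot v \<sigma>) \<le> trace_dist K \<rho> \<sigma> + 4 * \<delta>"
proof -
  have \<rho>': "positive_op K \<rho>" "has_trace K \<rho> 1" and \<sigma>': "positive_op K \<sigma>" "has_trace K \<sigma> 1"
    using \<rho> \<sigma> by (auto simp: states_iff)
  note b\<rho> = positive_op_bounded[OF \<rho>'(1)] and b\<sigma> = positive_op_bounded[OF \<sigma>'(1)]
  define t where "t k = (if level \<sigma> k \<le> level \<rho> k then w k else v k)" for k
  have t: "unimodular t"
    using v w by (auto simp: unimodular_def t_def)
  have closeD: "cmod (w k - v k) * sqrt (min (level \<rho> k) (level \<sigma> k))
      \<le> \<delta> * sqrt (max (level \<rho> k) (level \<sigma> k))" if "k < m" for k
    using close that by (simp add: phases_close_def)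
  let ?c = "\<lambda>w k. cnj (w k)"
  have d\<rho>: "(\<Sum>k<m. (cmod (?c w k - ?c t k))\<^sup>2 * level \<rho> k) \<le> \<delta>\<^sup>2"
  proof (rule weighted_difference_le[OF \<rho> \<sigma> \<delta>])
    fix k
    assume k: "k < m"
    show "cmod (?c w k - ?c t k) * sqrt (level \<rho> k) \<le> \<delta> * sqrt (level \<sigma> k)"
      using closeD[OF k] \<delta> level_nonneg[OF \<sigma> k]
      by (cases "level \<sigma> k \<le> level \<rho> k") (simp_all add: t_def min.absorb1 max.absorb2 flip: complex_cnj_diff)
  qed
  have d\<sigma>: "(\<Sum>k<m. (cmod (?c v k - ?c t k))\<^sup>2 * level \<sigma> k) \<le> \<delta>\<^sup>2"
  proof (rule weighted_difference_le[OF \<sigma> \<rho> \<delta>])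
    fix k
    assume k: "k < m"
    show "cmod (?c v k - ?c t k) * sqrt (level \<sigma> k) \<le> \<delta> * sqrt (level \<rho> k)"
      using closeD[OF k] \<delta> level_nonneg[OF \<rho> k]
      by (cases "level \<sigma> k \<le> level \<rho> k")
        (simp_all add: t_def min.absorb2 max.absorb1 norm_minus_commute[of "v k"] flip: complex_cnj_diff)
  qed
  show ?thesis
  proof (rule trace_dist_leI[OF rot_positive[OF w \<rho>'(1)] rot_trace[OF w \<rho>'] rot_positive[OF v \<sigma>'(1)] rot_trace[OF v \<sigma>']])
    fix F
    assume F: "finite F" "F \<subseteq> K" "orthonormal F (\<lambda>e. e)"
    define q where "q A w e = quad A (W (?c w) e)" for A w e
    have "(\<Sum>e\<in>F. \<bar>quad (rot w \<rho>) e - quad (rot v \<sigma>) e\<bar>) = (\<Sum>e\<in>F. \<bar>q \<rho> w e - q \<sigma> v e\<bar>)"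
      using F(2) by (intro sum.cong refl) (auto simp: q_def rot_form w v b\<rho> b\<sigma> subset_iff)
    also have "\<dots> \<le> (\<Sum>e\<in>F. \<bar>q \<rho> w e - q \<rho> t e\<bar> + \<bar>q \<rho> t e - q \<sigma> t e\<bar> + \<bar>q \<sigma> v e - q \<sigma> t e\<bar>)"
      by (intro sum_mono) linarith
    also have "\<dots> = (\<Sum>e\<in>F. \<bar>q \<rho> w e - q \<rho> t e\<bar>) + (\<Sum>e\<in>F. \<bar>q \<rho> t e - q \<sigma> t e\<bar>) + (\<Sum>e\<in>F. \<bar>q \<sigma> v e - q \<sigma> t e\<bar>)"
      by (simp add: sum.distrib)
    also have "\<dots> \<le> 2 * sqrt (\<delta>\<^sup>2) + trace_dist K \<rho> \<sigma> + 2 * sqrt (\<delta>\<^sup>2)"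
    proof (intro add_mono)
      have "(\<Sum>e\<in>F. \<bar>q \<rho> w e - q \<rho> t e\<bar>) \<le> 2 * sqrt (\<Sum>k<m. (cmod (?c w k - ?c t k))\<^sup>2 * level \<rho> k)"
        unfolding q_def using F by (intro phase_form_change[OF \<rho>] unimodular_cnj w t) auto
      also have "\<dots> \<le> 2 * sqrt (\<delta>\<^sup>2)"
        by (intro mult_left_mono real_sqrt_le_mono d\<rho>) simp
      finally show "(\<Sum>e\<in>F. \<bar>q \<rho> w e - q \<rho> t e\<bar>) \<le> 2 * sqrt (\<delta>\<^sup>2)" .
      have "(\<Sum>e\<in>F. \<bar>q \<sigma> v e - q \<sigma> t e\<bar>) \<le> 2 * sqrt (\<Sum>k<m. (cmod (?c v k - ?c t k))\<^sup>2 * level \<sigma> k)"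
        unfolding q_def using F by (intro phase_form_change[OF \<sigma>] unimodular_cnj v t) auto
      also have "\<dots> \<le> 2 * sqrt (\<delta>\<^sup>2)"
        by (intro mult_left_mono real_sqrt_le_mono d\<sigma>) simp
      finally show "(\<Sum>e\<in>F. \<bar>q \<sigma> v e - q \<sigma> t e\<bar>) \<le> 2 * sqrt (\<delta>\<^sup>2)" .
      show "(\<Sum>e\<in>F. \<bar>q \<rho> t e - q \<sigma> t e\<bar>) \<le> trace_dist K \<rho> \<sigma>"
        unfolding q_def using F
        by (intro trace_dist_family_ge[OF \<rho>' \<sigma>' phase_family[OF unimodular_cnj[OF t]]]) (auto intro: phase_mem)
    qed
    finally show "(\<Sum>e\<in>F. \<bar>quad (rot w \<rho>) e - quad (rot v \<sigma>) e\<bar>) \<le> trace_dist K \<rho> \<sigma> + 4 * \<delta>"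
      using \<delta> by simp
  qed
qed

text \<open>The difference of \<open>\<surd>\<sigma> W\<^sub>v\<^sup>* W\<^sub>w \<surd>\<rho>\<close> and \<open>\<surd>\<sigma> \<surd>\<rho>\<close>, \<open>\<surd>\<sigma> (W\<^sub>v\<^sup>* W\<^sub>w - 1) \<surd>\<rho>\<close>, is a sum of rank-one operators of norms
  \<open>|w\<^sub>k - v\<^sub>k| \<parallel>\<surd>\<sigma> f\<^sub>k\<parallel> \<parallel>\<surd>\<rho> f\<^sub>k\<parallel>\<close>.\<close>

lemma rot_fidelity_le:
  assumes \<rho>: "\<rho> \<in> states K" and \<sigma>: "\<sigma> \<in> states K" and w: "unimodular w" and v: "unimodular v"
    and close: "phases_close \<delta> w v \<rho> \<sigma>" and \<delta>: "0 \<le> \<delta>"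
  shows "fidelity (rot w \<rho>) (rot v \<sigma>) \<le> fidelity \<rho> \<sigma> + 2 * \<delta>"
proof -
  have \<rho>': "positive_op K \<rho>" "has_trace K \<rho> 1" and \<sigma>': "positive_op K \<sigma>" "has_trace K \<sigma> 1"
    using \<rho> \<sigma> by (auto simp: states_iff)
  define R where "R = op_sqrt K \<rho>"
  define S where "S = op_sqrt K \<sigma>"
  have R: "positive_op K R" and S: "positive_op K S"
    using op_sqrt[OF \<rho>'] op_sqrt[OF \<sigma>'] by (auto simp: R_def S_def)
  note bR = positive_op_bounded[OF R] and bS = positive_op_bounded[OF S]
  have sqrts: "op_sqrt K (rot w \<rho>) = rot w R" "op_sqrt K (rot v \<sigma>) = rot v S"
    unfolding rot_def R_def S_def
    by (rule conj_by_sqrt[OF phase_symmetry[OF w] \<rho>'] conj_by_sqrt[OF phase_symmetry[OF v] \<sigma>'])+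
  let ?c = "\<lambda>w k. cnj (w k)"
  define d where "d k = cnj (v k) * w k - 1" for k
  have cmod_d: "cmod (d k) = cmod (w k - v k)" if "k < m" for k
  proof -
    have "d k = cnj (v k) * (w k - v k)"
      using unimodular_mult_cnj[OF v that] by (simp add: d_def algebra_simps)
    then show ?thesis
      using v that by (simp add: norm_mult unimodular_def)
  qed
  have expand: "cinner y (rot v S (rot w R x)) = cinner (W (?c v) y) (S (R (W (?c w) x)))
      + (\<Sum>k<m. d k * (cinner (W (?c v) y) (S (f k)) * cinner (R (f k)) (W (?c w) x)))"
    if x: "x \<in> K" and y: "y \<in> K" for x y
  proof -
    define x' where "x' = W (?c w) x"
    define y' where "y' = W (?c v) y"
    have x'K: "x' \<in> K"
      by (simp add: x'_def phase_mem x)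
    have "rot v S (rot w R x) = W v (S (W (?c v) (W w (R x'))))"
      using x by (simp add: rot_apply v w phase_mem op_mem[OF bR] x'_def)
    also have "W (?c v) (W w (R x')) = R x' + (\<Sum>k<m. (d k * cinner (f k) (R x')) *\<^sub>C f k)"
      by (simp add: phase_comp) (simp add: phase_op_def d_def)
    also have "S \<dots> = S (R x') + (\<Sum>k<m. (d k * cinner (f k) (R x')) *\<^sub>C S (f k))"
    proof -
      have "S (\<Sum>k<m. (d k * cinner (f k) (R x')) *\<^sub>C f k) = (\<Sum>k<m. (d k * cinner (f k) (R x')) *\<^sub>C S (f k))"
        using f_mem by (subst op_sum[OF bS]) (auto simp: opD(4)[OF bS] scaleC_mem)
      then show ?thesis
        using f_mem by (subst opD(3)[OF bS]) (auto simp: op_mem[OF bR] intro!: sum_mem scaleC_mem)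
    qed
    finally have "cinner y (rot v S (rot w R x))
        = cinner y' (S (R x') + (\<Sum>k<m. (d k * cinner (f k) (R x')) *\<^sub>C S (f k)))"
      using phase_adj[of "?c v" y] by (simp add: y'_def)
    also have "\<dots> = cinner y' (S (R x')) + (\<Sum>k<m. d k * (cinner y' (S (f k)) * cinner (R (f k)) x'))"
      using selfadjD(2)[OF positive_selfadj[OF R] f_mem x'K]
      by (simp add: cinner_add_right cinner_sum_right cinner_scaleC_right mult_ac)
    finally show ?thesis
      by (simp add: x'_def y'_def)
  qed
  show ?thesis
  proof (rule fidelity_leI[OF rot_positive[OF w \<rho>'(1)] rot_trace[OF w \<rho>'] rot_positive[OF v \<sigma>'(1)] rot_trace[OF v \<sigma>']],
      unfold sqrts)
    fix F and x y :: "'a \<Rightarrow> 'a"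
    assume F: "finite F" and x: "orthonormal F x" "\<And>g. g \<in> F \<Longrightarrow> x g \<in> K"
      and y: "orthonormal F y" "\<And>g. g \<in> F \<Longrightarrow> y g \<in> K"
    define x' where "x' g = W (?c w) (x g)" for g
    define y' where "y' g = W (?c v) (y g)" for g
    have x': "orthonormal F x'" "\<And>g. g \<in> F \<Longrightarrow> x' g \<in> K" and y': "orthonormal F y'" "\<And>g. g \<in> F \<Longrightarrow> y' g \<in> K"
      unfolding x'_def y'_def using x y by (auto intro: phase_family unimodular_cnj w v phase_mem)
    have "(\<Sum>g\<in>F. cmod (cinner (y g) (rot v S (rot w R (x g)))))
        \<le> (\<Sum>g\<in>F. cmod (cinner (y' g) (S (R (x' g))))
          + (\<Sum>k<m. cmod (d k) * (cmod (cinner (y' g) (S (f k))) * cmod (cinner (R (f k)) (x' g)))))"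
    proof (intro sum_mono)
      fix g
      assume g: "g \<in> F"
      show "cmod (cinner (y g) (rot v S (rot w R (x g)))) \<le> cmod (cinner (y' g) (S (R (x' g))))
          + (\<Sum>k<m. cmod (d k) * (cmod (cinner (y' g) (S (f k))) * cmod (cinner (R (f k)) (x' g))))"
        unfolding expand[OF x(2)[OF g] y(2)[OF g]] x'_def y'_def
        by (intro norm_triangle_le add_left_mono sum_norm_le) (simp add: norm_mult)
    qed
    also have "\<dots> = (\<Sum>g\<in>F. cmod (cinner (y' g) (S (R (x' g)))))
        + (\<Sum>k<m. cmod (d k) * (\<Sum>g\<in>F. cmod (cinner (y' g) (S (f k))) * cmod (cinner (R (f k)) (x' g))))"
      by (simp add: sum.distrib sum_distrib_left) (rule sum.swap)
    also have "\<dots> \<le> fidelity \<rho> \<sigma> + (\<Sum>k<m. \<delta> * (level \<rho> k + level \<sigma> k))"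
    proof (intro add_mono sum_mono)
      show "(\<Sum>g\<in>F. cmod (cinner (y' g) (S (R (x' g))))) \<le> fidelity \<rho> \<sigma>"
        unfolding R_def S_def by (rule fidelity_family_ge[OF \<rho>' \<sigma>' x' y' F])
      fix k
      assume "k \<in> {..<m}"
      then have k: "k < m"
        by simp
      define a where "a = level \<rho> k"
      define b where "b = level \<sigma> k"
      have ab: "0 \<le> a" "0 \<le> b"
        using k by (simp_all add: a_def b_def level_nonneg \<rho> \<sigma>)
      have "(norm (R (f k)))\<^sup>2 = a" "(norm (S (f k)))\<^sup>2 = b"
        using k by (simp_all add: R_def S_def a_def b_def level_def norm_op_sqrt[OF \<rho>'] norm_op_sqrt[OF \<sigma>'] f_mem)
      then have norms: "norm (R (f k)) = sqrt a" "norm (S (f k)) = sqrt b"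
        by (metis norm_ge_zero real_sqrt_unique)+
      have "cmod (d k) * (\<Sum>g\<in>F. cmod (cinner (y' g) (S (f k))) * cmod (cinner (R (f k)) (x' g)))
          \<le> cmod (d k) * (norm (S (f k)) * norm (R (f k)))"
        by (intro mult_left_mono sum_rank_one_le x' y' F) simp
      also have "\<dots> = (cmod (w k - v k) * sqrt (min a b)) * sqrt (max a b)"
        by (auto simp: cmod_d[OF k] norms min_def max_def)
      also have "\<dots> \<le> (\<delta> * sqrt (max a b)) * sqrt (max a b)"
        using close k ab by (intro mult_right_mono) (auto simp: phases_close_def a_def b_def)
      also have "\<dots> = \<delta> * max a b"
        using ab by (simp add: mult.assoc)
      also have "\<dots> \<le> \<delta> * (a + b)"
        using ab \<delta> by (intro mult_left_mono) auto
      finally show "cmod (d k) * (\<Sum>g\<in>F. cmod (cinner (y' g) (S (f k))) * cmod (cinner (R (f k)) (x' g)))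
          \<le> \<delta> * (level \<rho> k + level \<sigma> k)"
        by (simp add: a_def b_def)
    qed
    also have "(\<Sum>k<m. \<delta> * (level \<rho> k + level \<sigma> k)) \<le> \<delta> * (1 + 1)"
      unfolding sum_distrib_left[symmetric] sum.distrib by (intro mult_left_mono add_mono level_sum \<rho> \<sigma> \<delta>)
    finally show "(\<Sum>g\<in>F. cmod (cinner (y g) (rot v S (rot w R (x g))))) \<le> fidelity \<rho> \<sigma> + 2 * \<delta>"
      by simp
  qed
qed

end

section \<open>The twisted map\<close>

lemma cmod_cis_diff_le:
  fixes x y :: real
  shows "cmod (cis x - cis y) \<le> \<bar>x - y\<bar>"
proof (rule power2_le_imp_le)
  have "(cmod (cis x - cis y))\<^sup>2 = (cos x - cos y)\<^sup>2 + (sin x - sin y)\<^sup>2"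
    by (simp add: cmod_power2)
  also have "\<dots> = 2 - 2 * cos (x - y)"
    unfolding cos_diff using sin_cos_squared_add[of x] sin_cos_squared_add[of y] by algebra
  also have "x - y = 2 * ((x - y) / 2)"
    using field_sum_of_halves[of "x - y"] by (simp only: mult_2)
  also have "2 - 2 * cos (2 * ((x - y) / 2)) = (2 * sin ((x - y) / 2))\<^sup>2"
    by (subst cos_double_sin) (simp add: power_mult_distrib)
  also have "\<dots> \<le> \<bar>x - y\<bar>\<^sup>2"
    using abs_sin_x_le_abs_x[of "(x - y) / 2"] by (subst power2_abs[symmetric], intro power_mono) (auto simp: abs_mult)
  finally show "(cmod (cis x - cis y))\<^sup>2 \<le> \<bar>x - y\<bar>\<^sup>2" .
qed simp

lemma abs_sqrt_diff_le:
  assumes "0 \<le> x" "0 \<le> y"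
  shows "\<bar>sqrt x - sqrt y\<bar> \<le> sqrt \<bar>x - y\<bar>"
proof -
  have *: "sqrt x \<le> sqrt y + sqrt \<bar>x - y\<bar>" if "0 \<le> x" "0 \<le> y" for x y :: real
  proof -
    have "sqrt x \<le> sqrt (y + \<bar>x - y\<bar>)"
      by simp
    also have "\<dots> \<le> sqrt y + sqrt \<bar>x - y\<bar>"
      using that by (intro sqrt_add_le_add_sqrt) auto
    finally show ?thesis .
  qed
  show ?thesis
    using *[OF assms] *[OF assms(2,1)] by (simp add: abs_minus_commute abs_le_iff)
qed

text \<open>With \<open>\<delta> = 2 \<pi> / ln m\<close>, the trace distance will change by at most \<open>4 \<delta>\<close> and the Bures distance by at
  most \<open>2 \<surd>\<delta>\<close>.\<close>

definition twist_error :: "nat \<Rightarrow> real" where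
  "twist_error m = 8 * pi / ln (real m) + 2 * sqrt (2 * pi / ln (real m))"

context hilbert_subspace
begin

definition uniform_state :: "'i set \<Rightarrow> ('i \<Rightarrow> 'a) \<Rightarrow> 'a \<Rightarrow> 'a" where
  "uniform_state I u x = (if x \<in> K then (1 / real (card I)) *\<^sub>R (\<Sum>i\<in>I. cinner (u i) x *\<^sub>C u i) else 0)"

context
  fixes I :: "'i set" and u :: "'i \<Rightarrow> 'a"
  assumes u: "orthonormal I u" "finite I" "I \<noteq> {}" "\<And>i. i \<in> I \<Longrightarrow> u i \<in> K"
begin

lemma uniform_state_cinner:
  assumes "x \<in> K"
  shows "cinner x (uniform_state I u x) = complex_of_real ((\<Sum>i\<in>I. (cmod (cinner (u i) x))\<^sup>2) / real (card I))"
proof -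
  have "cinner x (\<Sum>i\<in>I. cinner (u i) x *\<^sub>C u i) = (\<Sum>i\<in>I. complex_of_real ((cmod (cinner (u i) x))\<^sup>2))"
    unfolding cinner_sum_right cinner_scaleC_right
    by (intro sum.cong refl) (metis cinner_commute mult_cnj_cmod(1))
  then show ?thesis
    using assms by (simp add: uniform_state_def cinner_scaleR_right)
qed

lemma uniform_state_form:
  "x \<in> K \<Longrightarrow> quad (uniform_state I u) x = (\<Sum>i\<in>I. (cmod (cinner (u i) x))\<^sup>2) / real (card I)"
  by (simp add: uniform_state_cinner del: of_real_divide of_real_sum)

lemma uniform_state_states: "uniform_state I u \<in> states K"
proof -
  have norm: "norm (uniform_state I u x) \<le> (1 / real (card I)) * norm x" if "x \<in> K" for x
  proof -
    have "(norm (\<Sum>i\<in>I. cinner (u i) x *\<^sub>C u i))\<^sup>2 \<le> (norm x)\<^sup>2"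
      unfolding norm_orthonormal_sum[OF u(1,2)] by (rule bessel_finite[OF u(1,2)])
    then have "norm (\<Sum>i\<in>I. cinner (u i) x *\<^sub>C u i) \<le> norm x"
      by (rule power2_le_imp_le) simp
    then show ?thesis
      using that by (simp add: uniform_state_def divide_right_mono)
  qed
  have mem: "uniform_state I u x \<in> K" if "x \<in> K" for x
    using that u(4) by (auto simp: uniform_state_def intro!: scaleR_mem sum_mem scaleC_mem)
  have zero: "uniform_state I u x = 0" if "x \<notin> K" for x
    using that by (simp add: uniform_state_def)
  have add: "uniform_state I u (x + y) = uniform_state I u x + uniform_state I u y" if "x \<in> K" "y \<in> K" for x y
    using that by (simp add: uniform_state_def add_mem cinner_add_right scaleC_add_left sum.distrib scaleR_add_right)
  have scale: "uniform_state I u (c *\<^sub>C x) = c *\<^sub>C uniform_state I u x" if "x \<in> K" for c x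
    using that by (simp add: uniform_state_def scaleC_mem cinner_scaleC_right scaleR_scaleC
        complex_vector.scale_sum_right scaleC_scaleC mult_ac)
  have bdd: "uniform_state I u \<in> bounded_ops K"
    unfolding bounded_ops_def using norm mem add scale zero by blast
  have pos: "positive_op K (uniform_state I u)"
    unfolding positive_op_def using bdd
    by (auto simp: uniform_state_cinner complex_nonneg_Reals_iff sum_nonneg simp del: of_real_divide of_real_sum)
  have "has_trace K (uniform_state I u) 1"
    unfolding has_trace_def
  proof (intro allI impI)
    fix E
    assume E: "onb K E"
    have "((\<lambda>e. (\<Sum>i\<in>I. (cmod (cinner (u i) e))\<^sup>2) * (1 / real (card I))) has_sum
        (\<Sum>i\<in>I. (norm (u i))\<^sup>2) * (1 / real (card I))) E"
      unfolding cmod_cinner_commute[of "u _"]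
      by (intro has_sum_cmult_left has_sum_sum onb_parseval_norm[OF E] u(4))
    also have "(\<Sum>i\<in>I. (norm (u i))\<^sup>2) * (1 / real (card I)) = 1"
      using u by (simp add: orthonormal_norm[OF u(1)])
    finally show "((\<lambda>e. quad (uniform_state I u) e) has_sum 1) E"
      by (simp add: uniform_state_form onb_mem[OF E] cong: has_sum_cong)
  qed
  then show ?thesis
    using pos by (simp add: states_iff)
qed

end

end

locale twisted = phases +
  fixes g :: "nat \<Rightarrow> 'a"
  assumes g_orthonormal: "orthonormal {..<m} g" and g_mem: "\<And>k. k < m \<Longrightarrow> g k \<in> K"
    and f_g: "\<And>j k. j < m \<Longrightarrow> k < m \<Longrightarrow> cinner (f j) (g k) = 0" and m2: "2 \<le> m"
begin

definition L :: real where "L = ln (real m)"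

lemma L_pos: "0 < L"
  using m2 by (simp add: L_def)

text \<open>From \<open>\<pi>\<close> at level \<open>1 / (2 m)\<close> down to \<open>0\<close> at level \<open>1 / 2\<close>, linearly in the logarithm; on positive levels
  constant outside this range. The default value of \<open>ln 0\<close> is harmless, as a positive operator whose
  level in direction \<open>f k\<close> is \<open>0\<close> annihilates \<open>f k\<close>.\<close>

definition angle :: "real \<Rightarrow> real" where
  "angle x = pi * max 0 (min 1 (- ln (2 * x) / L))"

definition twist :: "('a \<Rightarrow> 'a) \<Rightarrow> nat \<Rightarrow> complex" where
  "twist \<rho> k = cis (angle (level \<rho> k))"

definition \<Theta> :: "('a \<Rightarrow> 'a) \<Rightarrow> 'a \<Rightarrow> 'a" where
  "\<Theta> \<rho> = rot (twist \<rho>) \<rho>"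

definition \<delta> :: real where "\<delta> = 2 * pi / L"

lemma \<delta>_pos: "0 \<le> \<delta>"
  using L_pos by (simp add: \<delta>_def)

lemma angle_half: "angle (1 / 2) = 0"
  by (simp add: angle_def)

lemma angle_uniform: "angle (1 / (2 * real m)) = pi"
  using L_pos m2 by (simp add: angle_def ln_div L_def)

lemma angle_lipschitz:
  assumes "0 < a" "0 < b"
  shows "\<bar>angle a - angle b\<bar> \<le> pi / L * \<bar>ln a - ln b\<bar>"
proof -
  have clamp: "\<bar>max 0 (min 1 x) - max 0 (min 1 y)\<bar> \<le> \<bar>x - y\<bar>" for x y :: real
    by (simp add: max_def min_def)
  have "angle a - angle b = pi * (max 0 (min 1 (- ln (2 * a) / L)) - max 0 (min 1 (- ln (2 * b) / L)))"
    by (simp add: angle_def algebra_simps)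
  then have "\<bar>angle a - angle b\<bar> = pi * \<bar>max 0 (min 1 (- ln (2 * a) / L)) - max 0 (min 1 (- ln (2 * b) / L))\<bar>"
    by (simp add: abs_mult)
  also have "\<dots> \<le> pi * \<bar>- ln (2 * a) / L - - ln (2 * b) / L\<bar>"
    by (intro mult_left_mono clamp) simp
  also have "- ln (2 * a) / L - - ln (2 * b) / L = (ln b - ln a) / L"
    using assms by (simp add: ln_mult diff_divide_distrib add_divide_distrib)
  also have "pi * \<bar>(ln b - ln a) / L\<bar> = pi / L * \<bar>ln a - ln b\<bar>"
    using L_pos by (simp add: abs_divide abs_minus_commute)
  finally show ?thesis .
qed

text \<open>The slow variation of the angle: \<open>ln a - ln b = 2 ln \<surd>(a/b) \<le> 2 \<surd>(a/b)\<close>.\<close>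

lemma twist_difference:
  assumes "0 \<le> b" "b \<le> a"
  shows "cmod (cis (angle a) - cis (angle b)) * sqrt b \<le> \<delta> * sqrt a"
proof (cases "b = 0")
  case False
  then have ab: "0 < a" "0 < b"
    using assms by auto
  have "ln a - ln b = 2 * ln (sqrt (a / b))"
    using ab by (simp add: ln_sqrt ln_div)
  also have "\<dots> \<le> 2 * sqrt (a / b)"
    using ln_le_minus_one[of "sqrt (a / b)"] ab by simp
  finally have le: "\<bar>ln a - ln b\<bar> \<le> 2 * sqrt (a / b)"
    using ab assms by simp
  have "cmod (cis (angle a) - cis (angle b)) \<le> \<bar>angle a - angle b\<bar>"
    by (rule cmod_cis_diff_le)
  also have "\<dots> \<le> pi / L * \<bar>ln a - ln b\<bar>"
    by (rule angle_lipschitz[OF ab])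
  also have "\<dots> \<le> pi / L * (2 * sqrt (a / b))"
    using L_pos by (intro mult_left_mono le) simp
  finally have "cmod (cis (angle a) - cis (angle b)) * sqrt b \<le> pi / L * (2 * sqrt (a / b)) * sqrt b"
    using ab by (intro mult_right_mono) auto
  also have "\<dots> = \<delta> * sqrt a"
    using ab by (simp add: \<delta>_def real_sqrt_divide)
  finally show ?thesis .
qed (use assms \<delta>_pos in simp)

lemma twist_unimodular: "unimodular (twist \<rho>)"
  by (simp add: unimodular_def twist_def)

lemma twist_close:
  assumes "\<rho> \<in> states K" "\<sigma> \<in> states K"
  shows "phases_close \<delta> (twist \<rho>) (twist \<sigma>) \<rho> \<sigma>"
  unfolding phases_close_def twist_def
proof (intro allI impI)
  fix k
  assume k: "k < m"
  show "cmod (cis (angle (level \<rho> k)) - cis (angle (level \<sigma> k))) * sqrt (min (level \<rho> k) (level \<sigma> k))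
      \<le> \<delta> * sqrt (max (level \<rho> k) (level \<sigma> k))"
  proof (cases "level \<rho> k \<le> level \<sigma> k")
    case True
    then show ?thesis
      using twist_difference[OF level_nonneg[OF assms(1) k] True]
      by (simp only: min.absorb1 max.absorb2 norm_minus_commute[of "cis (angle (level \<rho> k))"])
  next
    case False
    then have "level \<sigma> k \<le> level \<rho> k"
      by simp
    then show ?thesis
      using twist_difference[OF level_nonneg[OF assms(2) k]]
      by (simp only: min.absorb2 max.absorb1)
  qed
qed

lemma \<Theta>_states: "\<rho> \<in> states K \<Longrightarrow> \<Theta> \<rho> \<in> states K"
  unfolding \<Theta>_def by (intro rot_states twist_unimodular)

lemma states_bounded: "\<rho> \<in> states K \<Longrightarrow> \<rho> \<in> bounded_ops K"
  by (simp add: states_iff positive_op_bounded)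

lemma \<Theta>_level: "\<rho> \<in> states K \<Longrightarrow> k < m \<Longrightarrow> level (\<Theta> \<rho>) k = level \<rho> k"
  unfolding \<Theta>_def by (intro rot_level twist_unimodular states_bounded)

lemma \<Theta>_inverse:
  assumes "\<rho> \<in> states K"
  shows "rot (\<lambda>k. cnj (twist \<rho> k)) (\<Theta> \<rho>) = \<rho>"
  unfolding \<Theta>_def using assms by (intro rot_inverse twist_unimodular states_bounded)

lemma \<Theta>_bij: "bij_betw \<Theta> (states K) (states K)"
proof (rule bij_betw_byWitness[where f' = "\<lambda>\<rho>. rot (\<lambda>k. cnj (twist \<rho> k)) \<rho>"])
  show "\<forall>\<rho>\<in>states K. rot (\<lambda>k. cnj (twist (\<Theta> \<rho>) k)) (\<Theta> \<rho>) = \<rho>"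
  proof
    fix \<rho>
    assume \<rho>: "\<rho> \<in> states K"
    have "rot (\<lambda>k. cnj (twist (\<Theta> \<rho>) k)) (\<Theta> \<rho>) = rot (\<lambda>k. cnj (twist \<rho> k)) (\<Theta> \<rho>)"
      by (rule rot_cong) (simp add: twist_def \<Theta>_level[OF \<rho>])
    then show "rot (\<lambda>k. cnj (twist (\<Theta> \<rho>) k)) (\<Theta> \<rho>) = \<rho>"
      by (simp add: \<Theta>_inverse[OF \<rho>])
  qed
  show "\<forall>\<rho>\<in>states K. \<Theta> (rot (\<lambda>k. cnj (twist \<rho> k)) \<rho>) = \<rho>"
  proof
    fix \<rho>
    assume \<rho>: "\<rho> \<in> states K"
    define \<sigma> where "\<sigma> = rot (\<lambda>k. cnj (twist \<rho> k)) \<rho>"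
    have "level \<sigma> k = level \<rho> k" if "k < m" for k
      unfolding \<sigma>_def using \<rho> that by (intro rot_level unimodular_cnj twist_unimodular states_bounded)
    then have "\<Theta> \<sigma> = rot (twist \<rho>) \<sigma>"
      unfolding \<Theta>_def by (intro rot_cong) (simp add: twist_def)
    also have "\<dots> = \<rho>"
      using rot_inverse[OF unimodular_cnj[OF twist_unimodular[of \<rho>]] states_bounded[OF \<rho>]]
      by (simp add: \<sigma>_def)
    finally show "\<Theta> (rot (\<lambda>k. cnj (twist \<rho> k)) \<rho>) = \<rho>"
      by (simp add: \<sigma>_def)
  qed
qed (auto simp: \<Theta>_states rot_states unimodular_cnj twist_unimodular)

text \<open>The inverse of \<open>\<Theta>\<close> rotates by the conjugate phases, which are as close to each other;
  so each upper bound on distances between images gives a lower bound as well.\<close>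

lemma twist_close_inverse:
  assumes "\<rho> \<in> states K" "\<sigma> \<in> states K"
  shows "phases_close \<delta> (\<lambda>k. cnj (twist \<rho> k)) (\<lambda>k. cnj (twist \<sigma> k)) (\<Theta> \<rho>) (\<Theta> \<sigma>)"
  using twist_close[OF assms]
  by (simp add: phases_close_def \<Theta>_level[OF assms(1)] \<Theta>_level[OF assms(2)] flip: complex_cnj_diff)

lemma \<Theta>_trace_dist:
  assumes \<rho>: "\<rho> \<in> states K" and \<sigma>: "\<sigma> \<in> states K"
  shows "\<bar>trace_dist K (\<Theta> \<rho>) (\<Theta> \<sigma>) - trace_dist K \<rho> \<sigma>\<bar> \<le> 4 * \<delta>"
proof -
  have "trace_dist K (\<Theta> \<rho>) (\<Theta> \<sigma>) \<le> trace_dist K \<rho> \<sigma> + 4 * \<delta>"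
    unfolding \<Theta>_def by (rule rot_trace_dist_le[OF \<rho> \<sigma> twist_unimodular twist_unimodular twist_close[OF \<rho> \<sigma>] \<delta>_pos])
  moreover have "trace_dist K \<rho> \<sigma> \<le> trace_dist K (\<Theta> \<rho>) (\<Theta> \<sigma>) + 4 * \<delta>"
    using rot_trace_dist_le[OF \<Theta>_states[OF \<rho>] \<Theta>_states[OF \<sigma>] unimodular_cnj[OF twist_unimodular]
        unimodular_cnj[OF twist_unimodular] twist_close_inverse[OF \<rho> \<sigma>] \<delta>_pos]
    by (simp add: \<Theta>_inverse \<rho> \<sigma>)
  ultimately show ?thesis
    by (simp add: abs_le_iff)
qed

lemma \<Theta>_fidelity:
  assumes \<rho>: "\<rho> \<in> states K" and \<sigma>: "\<sigma> \<in> states K"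
  shows "\<bar>fidelity (\<Theta> \<rho>) (\<Theta> \<sigma>) - fidelity \<rho> \<sigma>\<bar> \<le> 2 * \<delta>"
proof -
  have "fidelity (\<Theta> \<rho>) (\<Theta> \<sigma>) \<le> fidelity \<rho> \<sigma> + 2 * \<delta>"
    unfolding \<Theta>_def by (rule rot_fidelity_le[OF \<rho> \<sigma> twist_unimodular twist_unimodular twist_close[OF \<rho> \<sigma>] \<delta>_pos])
  moreover have "fidelity \<rho> \<sigma> \<le> fidelity (\<Theta> \<rho>) (\<Theta> \<sigma>) + 2 * \<delta>"
    using rot_fidelity_le[OF \<Theta>_states[OF \<rho>] \<Theta>_states[OF \<sigma>] unimodular_cnj[OF twist_unimodular]
        unimodular_cnj[OF twist_unimodular] twist_close_inverse[OF \<rho> \<sigma>] \<delta>_pos]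
    by (simp add: \<Theta>_inverse \<rho> \<sigma>)
  ultimately show ?thesis
    by (simp add: abs_le_iff)
qed

lemma \<Theta>_bures_dist:
  assumes \<rho>: "\<rho> \<in> states K" and \<sigma>: "\<sigma> \<in> states K"
  shows "\<bar>bures_dist K (\<Theta> \<rho>) (\<Theta> \<sigma>) - bures_dist K \<rho> \<sigma>\<bar> \<le> 2 * sqrt \<delta>"
proof -
  note \<Theta>\<rho> = \<Theta>_states[OF \<rho>] and \<Theta>\<sigma> = \<Theta>_states[OF \<sigma>]
  have "\<bar>bures_dist K (\<Theta> \<rho>) (\<Theta> \<sigma>) - bures_dist K \<rho> \<sigma>\<bar>
      \<le> sqrt \<bar>(2 - 2 * fidelity (\<Theta> \<rho>) (\<Theta> \<sigma>)) - (2 - 2 * fidelity \<rho> \<sigma>)\<bar>"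
    unfolding bures_dist_states[OF \<rho> \<sigma>] bures_dist_states[OF \<Theta>\<rho> \<Theta>\<sigma>]
    using fidelity_le_1[OF \<rho> \<sigma>] fidelity_le_1[OF \<Theta>\<rho> \<Theta>\<sigma>] by (intro abs_sqrt_diff_le) auto
  also have "\<dots> \<le> sqrt (4 * \<delta>)"
    using \<Theta>_fidelity[OF \<rho> \<sigma>] by (intro real_sqrt_le_mono) (simp add: abs_le_iff)
  finally show ?thesis
    by (simp add: real_sqrt_mult)
qed

lemma twist_error_ge: "4 * \<delta> \<le> twist_error m" "2 * sqrt \<delta> \<le> twist_error m"
  using L_pos by (simp_all add: twist_error_def \<delta>_def L_def)

lemma \<Theta>_eps_isometry:
  "eps_isometry K (trace_dist K) (twist_error m) \<Theta>" "eps_isometry K (bures_dist K) (twist_error m) \<Theta>"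
  unfolding eps_isometry_def
  using \<Theta>_states \<Theta>_trace_dist \<Theta>_bures_dist twist_error_ge by (meson order.trans)+

section \<open>Distance from the symmetries\<close>

text \<open>A change of sign of \<open>f k\<close> exchanges \<open>\<phi> k\<close> and \<open>\<psi> k\<close>.\<close>

definition \<phi> :: "nat \<Rightarrow> 'a" where "\<phi> k = (1 / sqrt 2) *\<^sub>R (g k + f k)"
definition \<psi> :: "nat \<Rightarrow> 'a" where "\<psi> k = (1 / sqrt 2) *\<^sub>R (g k - f k)"

lemma inverse_sqrt2_mult: "complex_of_real (1 / sqrt 2) * (complex_of_real (1 / sqrt 2) * 2) = 1"
  unfolding mult.assoc[symmetric] of_real_mult[symmetric] by simp

lemma two_div_sqrt2: "2 / complex_of_real (sqrt 2) = complex_of_real (sqrt 2)"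
  by (metis of_real_divide of_real_numeral real_div_sqrt zero_le_numeral)

lemma g_f: "j < m \<Longrightarrow> k < m \<Longrightarrow> cinner (g j) (f k) = 0"
  by (metis f_g cinner_commute complex_cnj_zero)

lemma \<phi>_mem: "k < m \<Longrightarrow> \<phi> k \<in> K" and \<psi>_mem: "k < m \<Longrightarrow> \<psi> k \<in> K"
  by (simp_all add: \<phi>_def \<psi>_def scaleR_mem add_mem diff_mem f_mem g_mem)

lemma \<phi>_\<psi>:
  assumes "j < m" "k < m"
  shows "cinner (\<phi> j) (\<phi> k) = (if j = k then 1 else 0)" "cinner (\<psi> j) (\<psi> k) = (if j = k then 1 else 0)"
    "cinner (\<phi> j) (\<psi> k) = 0" "cinner (\<psi> j) (\<phi> k) = 0"
    "cinner (f j) (\<phi> k) = (if j = k then complex_of_real (1 / sqrt 2) else 0)"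
    "cinner (f j) (\<psi> k) = (if j = k then - complex_of_real (1 / sqrt 2) else 0)"
    "cinner (\<phi> j) (f k) = (if j = k then complex_of_real (1 / sqrt 2) else 0)"
  using assms f_g[of j k] g_f[of j k] f_orthonormal g_orthonormal inverse_sqrt2_mult
  by (auto simp: \<phi>_def \<psi>_def cinner_scaleR_left cinner_scaleR_right cinner_add_left cinner_add_right
      cinner_diff_left cinner_diff_right orthonormal_def)

lemma \<phi>_orthonormal: "orthonormal {..<m} \<phi>" and \<psi>_orthonormal: "orthonormal {..<m} \<psi>"
  by (simp_all add: orthonormal_def \<phi>_\<psi>)

definition pure :: "nat \<Rightarrow> 'a \<Rightarrow> 'a" where "pure k = uniform_state {k} \<phi>"
definition mixed :: "'a \<Rightarrow> 'a" where "mixed = uniform_state {..<m} \<phi>"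

lemma m_nonempty: "{..<m} \<noteq> {}"
  using m2 by (metis empty_iff lessThan_iff less_le_trans pos2)

lemma pure_states: "k < m \<Longrightarrow> pure k \<in> states K"
  unfolding pure_def using orthonormal_subset[OF \<phi>_orthonormal] by (intro uniform_state_states) (auto simp: \<phi>_mem)

lemma mixed_states: "mixed \<in> states K"
  unfolding mixed_def using m_nonempty by (intro uniform_state_states \<phi>_orthonormal) (auto simp: \<phi>_mem)

lemma pure_form: "k < m \<Longrightarrow> x \<in> K \<Longrightarrow> quad (pure k) x = (cmod (cinner (\<phi> k) x))\<^sup>2"
  unfolding pure_def using orthonormal_subset[OF \<phi>_orthonormal, of "{k}"]
  by (subst uniform_state_form) (auto simp: \<phi>_mem)

lemma mixed_form: "x \<in> K \<Longrightarrow> quad mixed x = (\<Sum>i<m. (cmod (cinner (\<phi> i) x))\<^sup>2) / real m"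
  unfolding mixed_def using m_nonempty by (subst uniform_state_form[OF \<phi>_orthonormal]) (auto simp: \<phi>_mem)

lemma \<Theta>_form:
  assumes "\<rho> \<in> states K" "x \<in> K"
  shows "quad (\<Theta> \<rho>) x = quad \<rho> (W (\<lambda>k. cnj (twist \<rho> k)) x)"
  unfolding \<Theta>_def using assms by (intro rot_form twist_unimodular states_bounded)

text \<open>The pure states have level \<open>1/2\<close>, where the angle is \<open>0\<close>, and are fixed.\<close>

lemma \<Theta>_pure:
  assumes k: "k < m"
  shows "quad (\<Theta> (pure k)) (\<phi> k) = 1"
proof -
  have "level (pure k) k = 1 / 2"
    using k by (simp add: level_def pure_form f_mem \<phi>_\<psi> norm_divide power_divide)
  then have "twist (pure k) k = 1"
    unfolding twist_def by (simp only: angle_half cis_zero)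
  then have *: "(cnj (twist (pure k) j) - 1) * cinner (f j) (\<phi> k) = 0" if "j < m" for j
    using that k by (cases "j = k") (simp_all add: \<phi>_\<psi>)
  have "(\<Sum>j<m. ((cnj (twist (pure k) j) - 1) * cinner (f j) (\<phi> k)) *\<^sub>C f j) = 0"
    by (intro sum.neutral ballI, subst *) simp_all
  then have "W (\<lambda>j. cnj (twist (pure k) j)) (\<phi> k) = \<phi> k"
    unfolding phase_op_def by simp
  then show ?thesis
    using k by (simp add: \<Theta>_form pure_states \<phi>_mem pure_form \<phi>_\<psi>)
qed

text \<open>The mixed state has all levels \<open>1/(2m)\<close>, where the angle is \<open>\<pi>\<close>; the signs of all \<open>f\<^sub>k\<close> are
  reversed.\<close>

lemma \<Theta>_mixed: "(\<Sum>k<m. quad (\<Theta> mixed) (\<psi> k)) = 1"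
proof -
  have "quad (\<Theta> mixed) (\<psi> k) = 1 / real m" if k: "k < m" for k
  proof -
    have "twist mixed j = - 1" if j: "j < m" for j
    proof -
      have "level mixed j = (\<Sum>i<m. if i = j then 1 / 2 else 0) / real m"
        unfolding level_def mixed_form[OF f_mem[OF j]] using j
        by (intro arg_cong2[of _ _ _ _ "(/)"] sum.cong refl) (auto simp: \<phi>_\<psi> norm_divide power_divide)
      then have "level mixed j = 1 / (2 * real m)"
        using j by simp
      then show ?thesis
        by (simp add: twist_def angle_uniform)
    qed
    then have "W (\<lambda>j. cnj (twist mixed j)) (\<psi> k) = \<psi> k + (\<Sum>j<m. if j = k then complex_of_real (sqrt 2) *\<^sub>C f k else 0)"
      unfolding phase_op_def using k
      by (intro arg_cong2[of _ _ _ _ "(+)"] refl sum.cong) (auto simp: \<phi>_\<psi> two_div_sqrt2)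
    also have "\<dots> = \<phi> k"
    proof -
      have "sqrt 2 = 1 / sqrt 2 + 1 / sqrt 2"
        by (simp add: real_div_sqrt)
      then have "sqrt 2 *\<^sub>R f k = (1 / sqrt 2) *\<^sub>R f k + (1 / sqrt 2) *\<^sub>R f k"
        by (metis scaleR_add_left)
      then show ?thesis
        using k by (simp add: \<phi>_def \<psi>_def scaleC_of_real scaleR_add_right scaleR_diff_right)
    qed
    finally have "quad (\<Theta> mixed) (\<psi> k) = (\<Sum>i<m. (cmod (cinner (\<phi> i) (\<phi> k)))\<^sup>2) / real m"
      using k by (simp add: \<Theta>_form mixed_states \<psi>_mem mixed_form \<phi>_mem)
    also have "(\<Sum>i<m. (cmod (cinner (\<phi> i) (\<phi> k)))\<^sup>2) = (\<Sum>i<m. if i = k then 1 else 0)"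
      using k by (intro sum.cong) (auto simp: \<phi>_\<psi>)
    finally show ?thesis
      using k by simp
  qed
  then show ?thesis
    using m2 by simp
qed

lemma form_\<phi>_\<psi>_le:
  assumes "\<sigma> \<in> states K"
  shows "(\<Sum>k<m. quad \<sigma> (\<phi> k)) + (\<Sum>k<m. quad \<sigma> (\<psi> k)) \<le> 1"
proof -
  define u where "u = (\<lambda>(b, k). if b then \<phi> k else \<psi> k)"
  have "(\<Sum>i\<in>UNIV \<times> {..<m}. quad \<sigma> (u i)) \<le> 1"
    using assms unfolding states_iff
    by (intro has_trace_family_le) (auto simp: orthonormal_def u_def \<phi>_\<psi> \<phi>_mem \<psi>_mem)
  then show ?thesis
    unfolding sum.cartesian_product' by (simp add: UNIV_bool u_def add.commute)
qed

context
  fixes s U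
  assumes U: "symmetry_via K s U"
begin

definition overlap :: "nat \<Rightarrow> real" where
  "overlap k = (cmod (cinner (\<phi> k) (inv_into K U (\<phi> k))))\<^sup>2"

lemma conj_states: "\<rho> \<in> states K \<Longrightarrow> conj_by K U \<rho> \<in> states K"
  by (rule conj_by_states[OF U])

lemma conj_pure: "k < m \<Longrightarrow> quad (conj_by K U (pure k)) (\<phi> k) = overlap k"
  by (simp add: conj_by_form[OF U] states_bounded pure_states \<phi>_mem pure_form sym_inv_mem[OF U] overlap_def)

text \<open>A fraction of at least \<open>p\<close> of the conjugated mixture stays on the span of the \<open>\<phi> k\<close>, which is
  orthogonal to the \<open>\<psi> k\<close>.\<close>

lemma conj_mixed:
  assumes p: "\<And>k. k < m \<Longrightarrow> p \<le> overlap k"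
  shows "(\<Sum>k<m. quad (conj_by K U mixed) (\<psi> k)) \<le> 1 - p"
proof -
  have "p / real m \<le> quad (conj_by K U mixed) (\<phi> k)" if k: "k < m" for k
  proof -
    have "overlap k \<le> (\<Sum>i<m. (cmod (cinner (\<phi> i) (inv_into K U (\<phi> k))))\<^sup>2)"
      unfolding overlap_def using k by (intro member_le_sum) auto
    then have "p \<le> (\<Sum>i<m. (cmod (cinner (\<phi> i) (inv_into K U (\<phi> k))))\<^sup>2)"
      using p[OF k] by linarith
    then show ?thesis
      using k by (simp add: conj_by_form[OF U] states_bounded mixed_states \<phi>_mem mixed_form sym_inv_mem[OF U]
          divide_right_mono)
  qed
  then have "(\<Sum>k<m. p / real m) \<le> (\<Sum>k<m. quad (conj_by K U mixed) (\<phi> k))"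
    by (intro sum_mono) auto
  then show ?thesis
    using form_\<phi>_\<psi>_le[OF conj_states[OF mixed_states]] m2 by simp
qed

text \<open>If the pure states do not tell the symmetry from \<open>\<Theta>\<close>, all overlaps are at least \<open>1/2\<close> (and at least
  \<open>3/4\<close> in the case of the Bures distance); then the mixed state tells them apart.\<close>

lemma trace_dist_far: "\<exists>\<rho>\<in>states K. 1 \<le> trace_dist K (\<Theta> \<rho>) (conj_by K U \<rho>)"
proof (rule ccontr)
  assume "\<not> ?thesis"
  then have close: "trace_dist K (\<Theta> \<rho>) (conj_by K U \<rho>) < 1" if "\<rho> \<in> states K" for \<rho>
    using that by force
  have "1 / 2 \<le> overlap k" if k: "k < m" for k
  proof -
    note \<rho> = pure_states[OF k]
    have "2 * (1 - overlap k) \<le> trace_dist K (\<Theta> (pure k)) (conj_by K U (pure k))"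
      using trace_dist_supported_ge[OF \<Theta>_states[OF \<rho>] conj_states[OF \<rho>], of "{k}" \<phi>]
        orthonormal_subset[OF \<phi>_orthonormal, of "{k}"] k by (simp add: \<phi>_mem \<Theta>_pure conj_pure)
    then show ?thesis
      using close[OF \<rho>] by simp
  qed
  from conj_mixed[OF this]
  have "(\<Sum>k<m. quad (conj_by K U mixed) (\<psi> k)) \<le> 1 / 2"
    by simp
  moreover have "2 * (1 - (\<Sum>k<m. quad (conj_by K U mixed) (\<psi> k)))
      \<le> trace_dist K (\<Theta> mixed) (conj_by K U mixed)"
    using trace_dist_supported_ge[OF \<Theta>_states[OF mixed_states] conj_states[OF mixed_states] \<psi>_orthonormal]
    by (simp add: \<psi>_mem \<Theta>_mixed)
  ultimately show False
    using close[OF mixed_states] by simp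
qed

lemma bures_dist_far: "\<exists>\<rho>\<in>states K. sqrt (2 - sqrt 3) \<le> bures_dist K (\<Theta> \<rho>) (conj_by K U \<rho>)"
proof (rule ccontr)
  assume "\<not> ?thesis"
  then have close: "bures_dist K (\<Theta> \<rho>) (conj_by K U \<rho>) < sqrt (2 - sqrt 3)" if "\<rho> \<in> states K" for \<rho>
    using that by force
  have fid: "sqrt 3 / 2 < fidelity (\<Theta> \<rho>) (conj_by K U \<rho>)" if "\<rho> \<in> states K" for \<rho>
    using close[OF that] bures_dist_states[OF \<Theta>_states[OF that] conj_states[OF that]] by simp
  have "3 / 4 \<le> overlap k" if k: "k < m" for k
  proof -
    note \<rho> = pure_states[OF k]
    have "fidelity (\<Theta> (pure k)) (conj_by K U (pure k)) \<le> sqrt (overlap k)"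
      using fidelity_supported_le[OF \<Theta>_states[OF \<rho>] conj_states[OF \<rho>], of "{k}" \<phi>]
        orthonormal_subset[OF \<phi>_orthonormal, of "{k}"] k by (simp add: \<phi>_mem \<Theta>_pure conj_pure)
    then have "sqrt 3 / 2 \<le> sqrt (overlap k)"
      using fid[OF \<rho>] by simp
    then have "(sqrt 3 / 2)\<^sup>2 \<le> (sqrt (overlap k))\<^sup>2"
      by (intro power_mono) auto
    then show ?thesis
      by (simp add: power_divide overlap_def)
  qed
  from conj_mixed[OF this]
  have "(\<Sum>k<m. quad (conj_by K U mixed) (\<psi> k)) \<le> 1 / 4"
    by simp
  then have "sqrt (\<Sum>k<m. quad (conj_by K U mixed) (\<psi> k)) \<le> sqrt (1 / 4)"
    by (rule real_sqrt_le_mono)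
  moreover have "fidelity (\<Theta> mixed) (conj_by K U mixed)
      \<le> sqrt (\<Sum>k<m. quad (conj_by K U mixed) (\<psi> k))"
    using fidelity_supported_le[OF \<Theta>_states[OF mixed_states] conj_states[OF mixed_states] \<psi>_orthonormal]
    by (simp add: \<psi>_mem \<Theta>_mixed)
  ultimately have "fidelity (\<Theta> mixed) (conj_by K U mixed) \<le> 1 / 2"
    by (simp add: real_sqrt_divide)
  moreover have "1 < sqrt (3 :: real)"
    by simp
  ultimately show False
    using fid[OF mixed_states] by simp
qed

end

end

section \<open>Instability\<close>

definition far_from_symmetries :: "'a::chilbert_space set \<Rightarrow> (('a \<Rightarrow> 'a) \<Rightarrow> ('a \<Rightarrow> 'a) \<Rightarrow> real) \<Rightarrow> real \<Rightarrow>
    (('a \<Rightarrow> 'a) \<Rightarrow> 'a \<Rightarrow> 'a) \<Rightarrow> bool" where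
  "far_from_symmetries K d c T \<longleftrightarrow>
     (\<forall>U. unitary_on K U \<or> antiunitary_on K U \<longrightarrow> ereal c \<le> (SUP \<rho>\<in>states K. ereal (d (T \<rho>) (conj_by K U \<rho>))))"

lemma far_from_symmetriesI:
  assumes "\<And>s U. symmetry_via K s U \<Longrightarrow> \<exists>\<rho>\<in>states K. c \<le> d (T \<rho>) (conj_by K U \<rho>)"
  shows "far_from_symmetries K d c T"
  unfolding far_from_symmetries_def symmetry_via_iff
proof (intro allI impI)
  fix U
  assume "\<exists>s. symmetry_via K s U"
  then obtain \<rho> where "\<rho> \<in> states K" "c \<le> d (T \<rho>) (conj_by K U \<rho>)"
    using assms by blast
  then show "ereal c \<le> (SUP \<rho>\<in>states K. ereal (d (T \<rho>) (conj_by K U \<rho>)))"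
    by (intro SUP_upper2[of \<rho>]) auto
qed

lemma far_from_symmetries_le:
  assumes "far_from_symmetries K d c T" "unitary_on K U \<or> antiunitary_on K U"
    and "(SUP \<rho>\<in>states K. ereal (d (T \<rho>) (conj_by K U \<rho>))) \<le> ereal r"
  shows "c \<le> r"
proof -
  have "ereal c \<le> (SUP \<rho>\<in>states K. ereal (d (T \<rho>) (conj_by K U \<rho>)))"
    using assms(1,2) unfolding far_from_symmetries_def by blast
  then have "ereal c \<le> ereal r"
    using assms(3) by (rule order.trans)
  then show ?thesis
    by simp
qed

text \<open>The first half of the family serves as \<open>f\<close>, the second half as \<open>g\<close>.\<close>

lemma (in hilbert_subspace) twisted_map_exists:
  assumes h: "orthonormal {..<2 * m} h" "\<And>k. k < 2 * m \<Longrightarrow> h k \<in> K" and m: "2 \<le> m"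
  shows "\<exists>T. bij_betw T (states K) (states K) \<and>
    eps_isometry K (bures_dist K) (twist_error m) T \<and> eps_isometry K (trace_dist K) (twist_error m) T \<and>
    far_from_symmetries K (bures_dist K) (sqrt (2 - sqrt 3)) T \<and> far_from_symmetries K (trace_dist K) 1 T"
proof -
  interpret twisted K m h "\<lambda>k. h (m + k)"
    by unfold_locales (use h m in \<open>auto simp: orthonormal_def\<close>)
  show ?thesis
    using \<Theta>_bij \<Theta>_eps_isometry trace_dist_far bures_dist_far
    by (intro exI[of _ \<Theta>] conjI far_from_symmetriesI)
qed

lemma twist_error_pos: "2 \<le> m \<Longrightarrow> 0 < twist_error m"
  by (auto simp: twist_error_def intro!: add_pos_nonneg divide_pos_pos)

lemma twist_error_tendsto: "(\<lambda>n. twist_error (n + 2)) \<longlonglongrightarrow> 0"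
proof -
  have "filterlim (\<lambda>n. real (n + 2)) at_top sequentially"
    using filterlim_compose[OF filterlim_real_sequentially filterlim_add_const_nat_at_top] .
  then have ln: "filterlim (\<lambda>n. ln (real (n + 2))) at_top sequentially"
    by (rule filterlim_compose[OF ln_at_top])
  have "(\<lambda>n. 8 * pi / ln (real (n + 2)) + 2 * sqrt (2 * pi / ln (real (n + 2)))) \<longlonglongrightarrow> 0 + 2 * sqrt 0"
    by (intro tendsto_intros tendsto_divide_0[OF tendsto_const] filterlim_at_top_imp_at_infinity ln)
  then show ?thesis
    by (simp add: twist_error_def)
qed


lemma no_modulus:
  fixes \<epsilon> :: "nat \<Rightarrow> real" and \<Omega> :: "real \<Rightarrow> real"
  assumes \<Omega>: "(\<Omega> \<longlongrightarrow> 0) (at_right 0)" and \<epsilon>: "\<epsilon> \<longlonglongrightarrow> 0" "\<And>n. 0 < \<epsilon> n"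
    and c: "0 < c" "\<And>n. c \<le> \<Omega> (\<epsilon> n)"
  shows False
proof -
  have "filterlim \<epsilon> (at_right 0) sequentially"
    using \<epsilon> by (intro tendsto_imp_filterlim_at_right always_eventually) auto
  then have "(\<lambda>n. \<Omega> (\<epsilon> n)) \<longlonglongrightarrow> 0"
    by (rule filterlim_compose[OF \<Omega>])
  then have "c \<le> 0"
    by (rule LIMSEQ_le_const) (use c(2) in auto)
  then show False
    using c(1) by simp
qed

text \<open>A finite orthonormal basis would span the space.\<close>

lemma (in hilbert_subspace) orthonormal_sequence_exists:
  assumes "\<not> (\<exists>B. finite B \<and> B \<subseteq> K \<and> cspan B = K)"
  shows "\<exists>h :: nat \<Rightarrow> 'a. orthonormal UNIV h \<and> range h \<subseteq> K"
proof -
  obtain E where E: "onb K E"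
    using onb_exists by blast
  have "infinite E"
  proof
    assume fin: "finite E"
    have "x \<in> cspan E" if "x \<in> K" for x
    proof -
      have "x = (\<Sum>e\<in>E. cinner e x *\<^sub>C e)"
        using has_sum_unique[OF onb_expansion[OF E that] has_sum_finite[OF fin]] .
      then show ?thesis
        by (metis (no_types, lifting) complex_vector.span_sum complex_vector.span_scale complex_vector.span_base)
    qed
    moreover have "cspan E \<subseteq> K"
      using onb_mem[OF E] by (intro complex_vector.span_minimal subspace) auto
    ultimately show False
      using assms fin onb_mem[OF E] by blast
  qed
  then obtain h :: "nat \<Rightarrow> 'a" where h: "inj h" "range h \<subseteq> E"
    using infinite_countable_subset by blast
  have "cinner (h i) (h j) = (if i = j then 1 else 0)" for i j
  proof -
    have "h i \<in> E" "h j \<in> E"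
      using h(2) by auto
    then show ?thesis
      using onb_orthonormal[OF E] h(1) by (simp add: orthonormal_def inj_eq)
  qed
  then have "orthonormal UNIV h"
    by (simp add: orthonormal_def)
  then show ?thesis
    using h(2) onb_mem[OF E] by blast
qed

definition unit_sequence :: "nat \<Rightarrow> ell2" where
  "unit_sequence k = Abs_ell2 (\<lambda>i. if i = k then 1 else 0)"

lemma coord_unit_sequence: "coord (unit_sequence k) i = (if i = k then 1 else 0)"
proof -
  have "summable (\<lambda>i. (cmod (if i = k then 1 else 0))\<^sup>2)"
    by (rule summable_finite[of "{k}"]) auto
  then show ?thesis
    by (simp add: unit_sequence_def coord_Abs)
qed

lemma unit_sequence_mem: "k < d \<Longrightarrow> unit_sequence k \<in> Cn d"
  by (simp add: Cn_def coord_unit_sequence)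

lemma unit_sequence_orthonormal: "orthonormal {..<d} unit_sequence"
  unfolding orthonormal_def
proof (intro ballI)
  fix i j
  assume "i \<in> {..<d}" "j \<in> {..<d}"
  then have "cinner (unit_sequence i) (unit_sequence j)
      = (\<Sum>k<d. cnj (coord (unit_sequence i) k) * coord (unit_sequence j) k)"
    by (intro cinner_Cn unit_sequence_mem) simp
  also have "\<dots> = (\<Sum>k<d. if k = i then if i = j then 1 else 0 else 0)"
    by (intro sum.cong refl) (simp add: coord_unit_sequence)
  finally show "cinner (unit_sequence i) (unit_sequence j) = (if i = j then 1 else 0)"
    using \<open>i \<in> {..<d}\<close> by simp
qed

lemma bures_constant_pos: "0 < sqrt (2 - sqrt 3)"
proof -
  have "sqrt 3 < sqrt (2\<^sup>2)"
    by (intro real_sqrt_less_mono) simp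
  then show ?thesis
    by simp
qed

theorem theorem1p5:
  fixes H :: "'a::chilbert_space set"
  assumes "csubspace H" and "closed H"
    and "\<not> (\<exists>B. finite B \<and> B \<subseteq> H \<and> cspan B = H)"
  shows
    "(\<exists>(\<Theta> :: nat \<Rightarrow> ('a \<Rightarrow> 'a) \<Rightarrow> 'a \<Rightarrow> 'a) (\<epsilon> :: nat \<Rightarrow> real).
        \<epsilon> \<longlonglongrightarrow> 0 \<and>
        (\<forall>n\<ge>1.
          0 \<le> \<epsilon> n \<and>
          bij_betw (\<Theta> n) (states H) (states H) \<and>
          eps_isometry H (bures_dist H) (\<epsilon> n) (\<Theta> n) \<and>
          eps_isometry H (trace_dist H) (\<epsilon> n) (\<Theta> n) \<and>
          (INF U\<in>{U. unitary_on H U \<or> antiunitary_on H U}. SUP \<rho>\<in>states H.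
             ereal (bures_dist H (\<Theta> n \<rho>) (conj_by H U \<rho>))) \<ge> ereal (sqrt (2 - sqrt 3)) \<and>
          (INF U\<in>{U. unitary_on H U \<or> antiunitary_on H U}. SUP \<rho>\<in>states H.
             ereal (trace_dist H (\<Theta> n \<rho>) (conj_by H U \<rho>))) \<ge> 1))
     \<and>
     (\<forall>d\<in>{bures_dist H, trace_dist H}.
        \<not> (\<exists>\<omega> :: real \<Rightarrow> real. (\<forall>\<epsilon>\<ge>0. 0 \<le> \<omega> \<epsilon>) \<and> (\<omega> \<longlongrightarrow> 0) (at_right 0) \<and>
            (\<forall>\<epsilon>\<ge>0. \<forall>T. eps_isometry H d \<epsilon> T \<and> T ` states H = states H \<longrightarrow>
               (\<exists>U. (unitary_on H U \<or> antiunitary_on H U) \<and>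
                  (SUP \<rho>\<in>states H. ereal (d (T \<rho>) (conj_by H U \<rho>))) \<le> ereal (\<omega> \<epsilon>)))))
     \<and>
     (\<forall>d\<in>{bures_dist, trace_dist}.
        \<not> (\<exists>\<omega> :: real \<Rightarrow> real. (\<forall>\<epsilon>\<ge>0. 0 \<le> \<omega> \<epsilon>) \<and> (\<omega> \<longlongrightarrow> 0) (at_right 0) \<and>
            (\<forall>n\<ge>1. \<forall>\<epsilon>\<ge>0. \<forall>T.
               eps_isometry (Cn n) (d (Cn n)) \<epsilon> T \<and> T ` states (Cn n) = states (Cn n) \<longrightarrow>
               (\<exists>U. (unitary_on (Cn n) U \<or> antiunitary_on (Cn n) U) \<and>
                  (SUP \<rho>\<in>states (Cn n). ereal (d (Cn n) (T \<rho>) (conj_by (Cn n) U \<rho>)))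
                    \<le> ereal (\<omega> \<epsilon>)))))"
    (is "?i \<and> ?ii \<and> ?iii")
proof -
  interpret H: hilbert_subspace H
    by unfold_locales (rule assms)+
  define \<epsilon> where "\<epsilon> n = twist_error (n + 2)" for n
  have \<epsilon>0: "0 < \<epsilon> n" for n
    by (simp add: \<epsilon>_def twist_error_pos)
  have \<epsilon>: "\<epsilon> \<longlonglongrightarrow> 0"
    unfolding \<epsilon>_def by (rule twist_error_tendsto)
  obtain h :: "nat \<Rightarrow> 'a" where h: "orthonormal UNIV h" "range h \<subseteq> H"
    using H.orthonormal_sequence_exists[OF assms(3)] by blast
  have "\<exists>T. bij_betw T (states H) (states H) \<and>
      eps_isometry H (bures_dist H) (\<epsilon> n) T \<and> eps_isometry H (trace_dist H) (\<epsilon> n) T \<and>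
      far_from_symmetries H (bures_dist H) (sqrt (2 - sqrt 3)) T \<and> far_from_symmetries H (trace_dist H) 1 T" for n
    unfolding \<epsilon>_def using h by (intro H.twisted_map_exists[of _ h]) (auto intro: orthonormal_subset)
  then obtain \<Theta> where bij: "\<And>n. bij_betw (\<Theta> n) (states H) (states H)"
    and iso: "\<And>n. eps_isometry H (bures_dist H) (\<epsilon> n) (\<Theta> n)" "\<And>n. eps_isometry H (trace_dist H) (\<epsilon> n) (\<Theta> n)"
    and far: "\<And>n. far_from_symmetries H (bures_dist H) (sqrt (2 - sqrt 3)) (\<Theta> n)"
      "\<And>n. far_from_symmetries H (trace_dist H) 1 (\<Theta> n)"
    by metis
  have ?i
  proof (intro exI[of _ \<Theta>] exI[of _ \<epsilon>] conjI allI impI \<epsilon> bij iso)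
    fix n
    show "0 \<le> \<epsilon> n"
      using \<epsilon>0[of n] by simp
    show "(INF U\<in>{U. unitary_on H U \<or> antiunitary_on H U}. SUP \<rho>\<in>states H.
        ereal (bures_dist H (\<Theta> n \<rho>) (conj_by H U \<rho>))) \<ge> ereal (sqrt (2 - sqrt 3))"
      using far(1)[of n] unfolding far_from_symmetries_def by (intro INF_greatest) blast
    show "(INF U\<in>{U. unitary_on H U \<or> antiunitary_on H U}. SUP \<rho>\<in>states H.
        ereal (trace_dist H (\<Theta> n \<rho>) (conj_by H U \<rho>))) \<ge> 1"
      using far(2)[of n] unfolding far_from_symmetries_def one_ereal_def by (intro INF_greatest) blast
  qed
  moreover have ?ii
  proof (intro ballI notI, elim exE conjE)
    fix d and \<omega> :: "real \<Rightarrow> real"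
    assume d: "d \<in> {bures_dist H, trace_dist H}" and \<omega>: "(\<omega> \<longlongrightarrow> 0) (at_right 0)"
      and stable: "\<forall>\<epsilon>\<ge>0. \<forall>T. eps_isometry H d \<epsilon> T \<and> T ` states H = states H \<longrightarrow>
        (\<exists>U. (unitary_on H U \<or> antiunitary_on H U) \<and>
          (SUP \<rho>\<in>states H. ereal (d (T \<rho>) (conj_by H U \<rho>))) \<le> ereal (\<omega> \<epsilon>))"
    obtain c where c: "0 < c" "\<And>n. eps_isometry H d (\<epsilon> n) (\<Theta> n)" "\<And>n. far_from_symmetries H d c (\<Theta> n)"
      using d iso far bures_constant_pos zero_less_one by blast
    have "c \<le> \<omega> (\<epsilon> n)" for n
      using stable[rule_format, OF less_imp_le[OF \<epsilon>0] conjI[OF c(2) bij_betw_imp_surj_on[OF bij]]]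
        far_from_symmetries_le[OF c(3)] by blast
    then show False
      by (rule no_modulus[OF \<omega> \<epsilon> \<epsilon>0 c(1)])
  qed
  moreover have ?iii
  proof (intro ballI notI, elim exE conjE)
    fix d :: "ell2 set \<Rightarrow> (ell2 \<Rightarrow> ell2) \<Rightarrow> (ell2 \<Rightarrow> ell2) \<Rightarrow> real" and \<omega> :: "real \<Rightarrow> real"
    assume d: "d \<in> {bures_dist, trace_dist}" and \<omega>: "(\<omega> \<longlongrightarrow> 0) (at_right 0)"
      and stable: "\<forall>n\<ge>1. \<forall>\<epsilon>\<ge>0. \<forall>T.
        eps_isometry (Cn n) (d (Cn n)) \<epsilon> T \<and> T ` states (Cn n) = states (Cn n) \<longrightarrow>
        (\<exists>U. (unitary_on (Cn n) U \<or> antiunitary_on (Cn n) U) \<and>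
          (SUP \<rho>\<in>states (Cn n). ereal (d (Cn n) (T \<rho>) (conj_by (Cn n) U \<rho>))) \<le> ereal (\<omega> \<epsilon>))"
    define c where "c = (if d = bures_dist then sqrt (2 - sqrt 3) else 1)"
    have "c \<le> \<omega> (\<epsilon> n)" for n
    proof -
      define K where "K = Cn (2 * (n + 2))"
      interpret K: hilbert_subspace K
        unfolding K_def by unfold_locales (rule csubspace_Cn closed_Cn)+
      obtain T where T: "bij_betw T (states K) (states K)"
        "eps_isometry K (bures_dist K) (\<epsilon> n) T" "eps_isometry K (trace_dist K) (\<epsilon> n) T"
        "far_from_symmetries K (bures_dist K) (sqrt (2 - sqrt 3)) T" "far_from_symmetries K (trace_dist K) 1 T"
        using K.twisted_map_exists[OF unit_sequence_orthonormal, of "n + 2"]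
        unfolding \<epsilon>_def K_def by (auto simp: unit_sequence_mem)
      have iso: "eps_isometry K (d K) (\<epsilon> n) T" and far: "far_from_symmetries K (d K) c T"
        using d T(2-5) by (auto simp: c_def)
      show ?thesis
        using stable[rule_format, of "2 * (n + 2)", folded K_def, OF _ less_imp_le[OF \<epsilon>0]
            conjI[OF iso bij_betw_imp_surj_on[OF T(1)]]] far_from_symmetries_le[OF far] by auto
    qed
    moreover have "0 < c"
      using bures_constant_pos by (simp add: c_def)
    ultimately show False
      by (intro no_modulus[OF \<omega> \<epsilon> \<epsilon>0])
  qed
  ultimately show ?thesis
    by blast
qed

end
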